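(* Let $l\in\mathbb N-\frac12$, $\tilde{\mathfrak g}=\tilde{\mathfrak g}^{(l)}$, $\dot h\in\mathbb C$ and $\dot z\in\mathbb C\setminus\{0\}$. Then there are isomorphisms of $\tilde{\mathfrak g}$-modules $$M_{\tilde{\mathfrak g}}(\dot z,\dot h)\cong M_{\tilde{\mathcal H}}(\dot z)^{\tilde{\mathfrak g}}\otimes M_{\mathfrak{sl}_2}\big(\dot h+\tfrac12(l+\tfrac12)^2\big)^{\tilde{\mathfrak g}},\qquad \bar M_{\tilde{\mathfrak g}}(\dot z,\dot h)\cong M_{\tilde{\mathcal H}}(\dot z)^{\tilde{\mathfrak g}}\otimes \bar M_{\mathfrak{sl}_2}\big(\dot h+\tfrac12(l+\tfrac12)^2\big)^{\tilde{\mathfrak g}}.$$ Consequently, $M_{\tilde{\mathfrak g}}(\dot z,\dot h)$ is simple if and only if $\dot h+\frac12(l+\frac12)^2\notin\mathbb Z_{\ge0}$.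
   Context: For $l\in\mathbb N-\frac12$, $\tilde{\mathfrak g}^{(l)}$ is the complex Lie algebra with basis $e,h,f,p_0,\dots,p_{2l},z$ and brackets $[h,e]=2e$, $[h,f]=-2f$, $[e,f]=h$, $[h,p_k]=2(l-k)p_k$, $[e,p_k]=kp_{k-1}$, $[f,p_k]=(2l-k)p_{k+1}$ ($p_{-1}=p_{2l+1}=0$), $z$ central, $[p_k,p_{k'}]=\delta_{k+k',2l}(-1)^{k+l+\frac12}k!(2l-k)!\,z$. $\tilde{\mathcal H}=\mathrm{span}\{p_0,\dots,p_{2l},z\}$ (an ideal), and $\mathfrak{sl}_2=\mathrm{span}\{e,h,f\}$. Let $\tilde{\mathfrak g}_+=\mathrm{span}\{e,p_k: 0\le k\le l-\frac12\}$ (the positive eigenspaces of $\mathrm{ad}\,h$) and $\tilde{\mathfrak g}_0=\mathbb Ch+\mathbb Cz$. The Verma module $M_{\tilde{\mathfrak g}}(\dot z,\dot h)=U(\tilde{\mathfrak g})\otimes_{U(\tilde{\mathfrak g}_0+\tilde{\mathfrak g}_+)}\mathbb Cw$ where $hw=\dot hw$, $zw=\dot zw$, $\tilde{\mathfrak g}_+w=0$; $\bar M_{\tilde{\mathfrak g}}(\dot z,\dot h)$ is its unique simple quotient. $M_{\mathfrak{sl}_2}(\mu)$ is the Verma $\mathfrak{sl}_2$-module of highest weight $\mu$ (induced from $\mathbb Ch+\mathbb Ce$, $e$ acting by $0$, $h$ by $\mu$) and $\bar M_{\mathfrak{sl}_2}(\mu)$ its simple quotient. $M_{\tilde{\mathcal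 H}}(\dot z)=U(\tilde{\mathcal H})\otimes_{U(\mathrm{span}\{p_k:k\le l-\frac12\}+\mathbb Cz)}\mathbb Cw$ where the $p_k$ ($k\le l-\frac12$) act by $0$ and $z$ by $\dot z$. For an $\tilde{\mathcal H}$-module $M$ on which $z$ acts as a nonzero scalar, $M^{\tilde{\mathfrak g}}$ denotes $M$ with $\tilde{\mathfrak g}$-action obtained by pulling back along the algebra homomorphism $\Phi_l:U(\tilde{\mathfrak g})\to U(\tilde{\mathcal H})_{(z)}$ (localization at powers of $z$) which is the identity on $\tilde{\mathcal H}$ and sends $e\mapsto \frac{1}{z}\sum_{k=1}^{2l}(-1)^{k+l+\frac12}\frac{l-k}{(k-1)!(2l-k)!}p_{k-1}p_{2l-k}$, $f\mapsto \frac{1}{z}\sum_{k=1}^{2l}(-1)^{k+l-\frac12}\frac{l-k}{(k-1)!(2l-k)!}p_{k}p_{2l-k+1}$, $h\mapsto \frac{2}{z}\sum_{k=0}^{l-\frac12}(-1)^{k+l-\frac12}\frac{l-k}{k!(2l-k)!}p_{2l-k}p_k-\frac{(l+\frac12)^2}{2}$. For an $\mathfrak{sl}_2$-module $N$, $N^{\tilde{\mathfrak g}}$ denotes $N$ with $\tilde{\mathcal H}$ acting by $0$ (via $\tilde{\mathfrak g}\to\tilde{\mathfrak g}/\tilde{\mathcal H}\cong\mathfrak{sl}_2$). Tensor products of $\tilde{\mathfrak g}$-modules carry the diagonal action $x(v\otimes w)=xv\otimes w+v\otimes xw$. *)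

theory Defs
  imports Complex_Main
begin

text \<open>
Modules are encoded concretely by presentations.  A complex vector space with basis B
(elements of type 'b) is the space fsv B of finitely supported functions B -> complex.
A "presented module" is a triple (B, J, rho): the module is the quotient fsv B / J,
and a letter (generator of the Lie algebra) acts by rho a (which preserves J).
The Lie algebra g~^(l) with l = n + 1/2 (n :: nat) has basis letters
E, H, F, P 0, ..., P (2n+1), Z.  The tensor algebra T(g) has basis the words over the
letters; U(g) = T(g)/(Lie relations), and induced modules are quotients of T(g) by the
Lie-relation ideal plus the left ideal generated by (x - chi x).
\<close>

datatype gen = E | H | F | P nat | Z

type_synonym 'b vec = "'b \<Rightarrow> complex"
type_synonym 'b pmod = "'b set \<times> 'b vec set \<times> (gen \<Rightarrow> 'b vec \<Rightarrow> 'b vec)"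

definition fsv :: "'b set \<Rightarrow> 'b vec set" where
  "fsv B = {v. finite {b. v b \<noteq> 0} \<and> {b. v b \<noteq> 0} \<subseteq> B}"

definition vzero :: "'b vec" where "vzero = (\<lambda>_. 0)"
definition vadd :: "'b vec \<Rightarrow> 'b vec \<Rightarrow> 'b vec" where "vadd v w = (\<lambda>b. v b + w b)"
definition vsub :: "'b vec \<Rightarrow> 'b vec \<Rightarrow> 'b vec" where "vsub v w = (\<lambda>b. v b - w b)"
definition vsc :: "complex \<Rightarrow> 'b vec \<Rightarrow> 'b vec" where "vsc c v = (\<lambda>b. c * v b)"
definition dlt :: "'b \<Rightarrow> 'b vec" where "dlt b0 = (\<lambda>b. if b = b0 then 1 else 0)"

inductive_set cspan :: "'b vec set \<Rightarrow> 'b vec set" for S where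
  zero: "vzero \<in> cspan S"
| add: "x \<in> S \<Longrightarrow> y \<in> cspan S \<Longrightarrow> vadd (vsc c x) y \<in> cspan S"

definition lmul :: "gen \<Rightarrow> gen list vec \<Rightarrow> gen list vec" where
  "lmul a v = (\<lambda>w. case w of [] \<Rightarrow> 0 | b # w' \<Rightarrow> (if b = a then v w' else 0))"

text \<open>the product (word u) * r * (word u') in the tensor algebra\<close>
definition sw :: "gen list \<Rightarrow> gen list vec \<Rightarrow> gen list \<Rightarrow> gen list vec" where
  "sw u r u' = (\<lambda>w. if length u + length u' \<le> length w \<and> take (length u) w = u
        \<and> drop (length w - length u') w = u'
      then r (take (length w - length u - length u') (drop (length u) w)) else 0)"

fun brk :: "nat \<Rightarrow> gen \<Rightarrow> gen \<Rightarrow> gen list vec" where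
  "brk n H E = vsc 2 (dlt [E])"
| "brk n E H = vsc (-2) (dlt [E])"
| "brk n H F = vsc (-2) (dlt [F])"
| "brk n F H = vsc 2 (dlt [F])"
| "brk n E F = dlt [H]"
| "brk n F E = vsc (-1) (dlt [H])"
| "brk n H (P k) = vsc (2 * (of_nat n + 1/2 - of_nat k)) (dlt [P k])"
| "brk n (P k) H = vsc (- 2 * (of_nat n + 1/2 - of_nat k)) (dlt [P k])"
| "brk n E (P k) = vsc (of_nat k) (dlt [P (k - 1)])"
| "brk n (P k) E = vsc (- of_nat k) (dlt [P (k - 1)])"
| "brk n F (P k) = vsc (of_nat (2*n+1) - of_nat k) (dlt [P (k + 1)])"
| "brk n (P k) F = vsc (- (of_nat (2*n+1) - of_nat k)) (dlt [P (k + 1)])"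
| "brk n (P k) (P k') = (if k + k' = 2*n+1
      then vsc ((-1) ^ (k + n + 1) * of_nat (fact k * fact (2*n+1-k))) (dlt [Z]) else vzero)"
| "brk n _ _ = vzero"

definition lierel :: "nat \<Rightarrow> gen \<Rightarrow> gen \<Rightarrow> gen list vec" where
  "lierel n a b = vsub (vsub (dlt [a, b]) (dlt [b, a])) (brk n a b)"

definition Gl :: "nat \<Rightarrow> gen set" where "Gl n = {E, H, F, Z} \<union> P ` {..2*n+1}"
definition GH :: "nat \<Rightarrow> gen set" where "GH n = {Z} \<union> P ` {..2*n+1}"
definition GS :: "gen set" where "GS = {E, H, F}"

definition lie_ideal :: "nat \<Rightarrow> gen set \<Rightarrow> gen list vec set" where
  "lie_ideal n A = {sw u (lierel n a b) u' | u u' a b. u \<in> lists A \<and> u' \<in> lists A \<and> a \<in> A \<and> b \<in> A}"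

definition ann :: "gen list \<Rightarrow> gen \<Rightarrow> complex \<Rightarrow> gen list vec" where
  "ann u x c = sw u (vsub (dlt [x]) (vsc c (dlt []))) []"

definition Mg :: "nat \<Rightarrow> complex \<Rightarrow> complex \<Rightarrow> gen list pmod" where
  "Mg n zdot hdot = (lists (Gl n),
     cspan (lie_ideal n (Gl n)
       \<union> {ann u E 0 | u. u \<in> lists (Gl n)}
       \<union> {ann u (P k) 0 | u k. u \<in> lists (Gl n) \<and> k \<le> n}
       \<union> {ann u H hdot | u. u \<in> lists (Gl n)}
       \<union> {ann u Z zdot | u. u \<in> lists (Gl n)}),
     lmul)"

text \<open>the image of e, f, h under Phi_l, acting on a module over T(H~) by left multiplication
  (with z acting by zdot)\<close>
definition phiE :: "nat \<Rightarrow> complex \<Rightarrow> gen list vec \<Rightarrow> gen list vec" where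
  "phiE n zdot v = (\<lambda>w. (1 / zdot) * (\<Sum>k\<in>{1..2*n+1}.
      (-1) ^ (k + n + 1) * (of_nat n + 1/2 - of_nat k) / of_nat (fact (k - 1) * fact (2*n+1-k))
      * lmul (P (k - 1)) (lmul (P (2*n+1-k)) v) w))"

definition phiF :: "nat \<Rightarrow> complex \<Rightarrow> gen list vec \<Rightarrow> gen list vec" where
  "phiF n zdot v = (\<lambda>w. (1 / zdot) * (\<Sum>k\<in>{1..2*n+1}.
      (-1) ^ (k + n) * (of_nat n + 1/2 - of_nat k) / of_nat (fact (k - 1) * fact (2*n+1-k))
      * lmul (P k) (lmul (P (2*n+2-k)) v) w))"

definition phiH :: "nat \<Rightarrow> complex \<Rightarrow> gen list vec \<Rightarrow> gen list vec" where
  "phiH n zdot v = (\<lambda>w. (2 / zdot) * (\<Sum>k\<in>{0..n}.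
      (-1) ^ (k + n) * (of_nat n + 1/2 - of_nat k) / of_nat (fact k * fact (2*n+1-k))
      * lmul (P (2*n+1-k)) (lmul (P k) v) w) - (of_nat n + 1) ^ 2 / 2 * v w)"

definition actHg :: "nat \<Rightarrow> complex \<Rightarrow> gen \<Rightarrow> gen list vec \<Rightarrow> gen list vec" where
  "actHg n zdot a = (case a of E \<Rightarrow> phiE n zdot | F \<Rightarrow> phiF n zdot | H \<Rightarrow> phiH n zdot | _ \<Rightarrow> lmul a)"

definition MHg :: "nat \<Rightarrow> complex \<Rightarrow> gen list pmod" where
  "MHg n zdot = (lists (GH n),
     cspan (lie_ideal n (GH n)
       \<union> {ann u (P k) 0 | u k. u \<in> lists (GH n) \<and> k \<le> n}
       \<union> {ann u Z zdot | u. u \<in> lists (GH n)}),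
     actHg n zdot)"

definition Msl2g :: "complex \<Rightarrow> gen list pmod" where
  "Msl2g mu = (lists GS,
     cspan (lie_ideal 0 GS
       \<union> {ann u E 0 | u. u \<in> lists GS}
       \<union> {ann u H mu | u. u \<in> lists GS}),
     (\<lambda>a v. if a \<in> GS then lmul a v else vzero))"

definition bas :: "'b pmod \<Rightarrow> 'b set" where "bas M = fst M"
definition jdl :: "'b pmod \<Rightarrow> 'b vec set" where "jdl M = fst (snd M)"
definition act :: "'b pmod \<Rightarrow> gen \<Rightarrow> 'b vec \<Rightarrow> 'b vec" where "act M = snd (snd M)"

text \<open>submodules of fsv B / J (for the Lie algebra with letters A), as subspaces containing J\<close>
definition submod :: "gen set \<Rightarrow> 'b pmod \<Rightarrow> 'b vec set \<Rightarrow> bool" where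
  "submod A M N \<longleftrightarrow> jdl M \<subseteq> N \<and> N \<subseteq> fsv (bas M) \<and> cspan N = N
     \<and> (\<forall>a\<in>A. \<forall>v\<in>N. act M a v \<in> N)"

definition simple_mod :: "gen set \<Rightarrow> 'b pmod \<Rightarrow> bool" where
  "simple_mod A M \<longleftrightarrow> jdl M \<noteq> fsv (bas M) \<and>
     (\<forall>N. submod A M N \<longrightarrow> N = jdl M \<or> N = fsv (bas M))"

text \<open>quotient by the sum of all proper submodules (the unique simple quotient of a Verma module)\<close>
definition simple_quot :: "gen set \<Rightarrow> 'b pmod \<Rightarrow> 'b pmod" where
  "simple_quot A M = (bas M,
     cspan (jdl M \<union> \<Union>{N. submod A M N \<and> N \<noteq> fsv (bas M)}), act M)"

definition tp :: "'b vec \<Rightarrow> 'c vec \<Rightarrow> ('b \<times> 'c) vec" where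
  "tp v w = (\<lambda>(b, c). v b * w c)"

definition ext1 :: "('b vec \<Rightarrow> 'b vec) \<Rightarrow> ('b \<times> 'c) vec \<Rightarrow> ('b \<times> 'c) vec" where
  "ext1 T x = (\<lambda>(b, c). \<Sum>p\<in>{p. x p \<noteq> 0}. x p * T (dlt (fst p)) b * dlt (snd p) c)"

definition ext2 :: "('c vec \<Rightarrow> 'c vec) \<Rightarrow> ('b \<times> 'c) vec \<Rightarrow> ('b \<times> 'c) vec" where
  "ext2 T x = (\<lambda>(b, c). \<Sum>p\<in>{p. x p \<noteq> 0}. x p * dlt (fst p) b * T (dlt (snd p)) c)"

definition tensor :: "'b pmod \<Rightarrow> 'c pmod \<Rightarrow> ('b \<times> 'c) pmod" where
  "tensor M1 M2 = (bas M1 \<times> bas M2,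
     cspan ({tp v w | v w. v \<in> jdl M1 \<and> w \<in> fsv (bas M2)}
          \<union> {tp v w | v w. v \<in> fsv (bas M1) \<and> w \<in> jdl M2}),
     (\<lambda>a x. vadd (ext1 (act M1 a) x) (ext2 (act M2 a) x)))"

definition pmod_iso :: "gen set \<Rightarrow> 'b pmod \<Rightarrow> 'c pmod \<Rightarrow> bool" where
  "pmod_iso A M1 M2 \<longleftrightarrow> (\<exists>T.
     (\<forall>v\<in>fsv (bas M1). T v \<in> fsv (bas M2))
   \<and> (\<forall>v\<in>fsv (bas M1). \<forall>w\<in>fsv (bas M1). T (vadd v w) = vadd (T v) (T w))
   \<and> (\<forall>v\<in>fsv (bas M1). \<forall>c. T (vsc c v) = vsc c (T v))
   \<and> (\<forall>v\<in>fsv (bas M1). T v \<in> jdl M2 \<longleftrightarrow> v \<in> jdl M1)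
   \<and> (\<forall>w\<in>fsv (bas M2). \<exists>v\<in>fsv (bas M1). vsub (T v) w \<in> jdl M2)
   \<and> (\<forall>a\<in>A. \<forall>v\<in>fsv (bas M1). vsub (T (act M1 a v)) (act M2 a (T v)) \<in> jdl M2))"

end

theory Submission
  imports Defs "HOL-Library.Function_Algebras"
begin

text \<open>
  Since \<open>z\<close> acts invertibly, subtracting from \<open>x \<in> sl\<^sub>2\<close> its Heisenberg realisation \<open>\<Phi> x\<close> gives
  an operator \<open>D x = x - \<Phi> x\<close> which commutes with all \<open>p\<^sub>k\<close>, and the \<open>D x\<close> again satisfy the
  relations of \<open>sl\<^sub>2\<close>.  Hence \<open>u \<otimes> s \<mapsto> u (D s) w\<close>, for words \<open>u\<close> in the Heisenberg letters and \<open>s\<close>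
  in \<open>e, h, f\<close>, is a well-defined inverse of the map from the Verma module to the tensor product
  which sends the highest weight vector \<open>w\<close> to \<open>w \<otimes> w\<close>; no PBW theorem is needed.
  The normalised Euler operator \<open>\<Sum>\<^sub>k p\<^bsub>2l-k\<^esub> p\<^sub>k\<close> filters the Fock module by degree, and a descent along this
  filtration shows that every submodule of the tensor product has the form \<open>M\<^sub>H \<otimes> K\<close>; so simplicity
  and maximal submodules reduce to the Verma module of \<open>sl\<^sub>2\<close>.
\<close>

text \<open>Quotients are never formed: a module is a carrier with a subspace \<open>J\<close>, and
  every identity is a congruence modulo \<open>J\<close>. The obstacle is that the size of such a
  quotient is unknown beforehand. Maps out of a presented module come for free once a vector of the
  target satisfies the defining equations modulo the target's \<open>J\<close>; this gives
  well-definedness in both directions. Properness does not come for free: for it the two factors are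
  mapped to explicit models, power series and sequences, where the highest weight vector is visibly
  nonzero. Since 2l = 2n+1 is odd, the pairing of \<open>p_k\<close> with \<open>p_{2l-k}\<close> is
  antisymmetric and has no self-paired index, so the \<open>p_k\<close> with k <= n act as
  annihilators and the others as creators. A quadratic expression in them has a linear commutator
  with each \<open>p_j\<close>, which is how Phi can imitate sl2. The constant (n+1)^2/2 is a
  normal-ordering term: moving annihilators to the right in the commutator of Phi e and Phi f leaves
  a scalar, hence the vacuum has h-weight -(n+1)^2/2 and the sl2 factor must start at
  \<open>hdot + (n+1)^2/2\<close>.\<close>

lemma vadd_eq: "vadd v w = v + w"
  by (simp add: fun_eq_iff vadd_def plus_fun_def fun_diff_def zero_fun_def)

lemma vsub_eq: "vsub v w = v - w"
  by (simp add: fun_eq_iff vsub_def plus_fun_def fun_diff_def zero_fun_def)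

lemma vzero_eq: "vzero = 0"
  by (simp add: fun_eq_iff vzero_def plus_fun_def fun_diff_def zero_fun_def)

lemma vsc_apply: "vsc c v b = c * v b"
  by (simp add: vsc_def)

(* Terms of type 'b vec are often eta-expanded by unification; these rules would then unfold them pointwise. *)
declare plus_fun_apply [simp del] zero_fun_apply [simp del] uminus_apply [simp del] minus_apply [simp del]

lemma minus_fun_apply: "(f - g) x = f x - g x" for f g :: "'a \<Rightarrow> 'b::minus"
  by (simp add: fun_diff_def)

lemmas vec_simps = vsc_apply plus_fun_apply zero_fun_apply minus_fun_apply

lemma dlt_apply: "dlt b c = (if c = b then 1 else 0)"
  by (simp add: dlt_def)

interpretation vs: vector_space "vsc :: complex \<Rightarrow> 'b vec \<Rightarrow> 'b vec"
  by unfold_locales (auto simp: fun_eq_iff vec_simps algebra_simps)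

lemma cspan_eq: "cspan S = vs.span S"
proof (intro set_eqI iffI)
  fix x assume "x \<in> cspan S"
  then show "x \<in> vs.span S"
    by (rule cspan.induct)
      (auto simp: vzero_eq vadd_eq vs.span_zero intro: vs.span_add vs.span_scale vs.span_base)
next
  fix x assume "x \<in> vs.span S"
  then show "x \<in> cspan S"
    by (rule vs.span_induct_alt)
      (auto simp: vzero_eq[symmetric] vadd_eq[symmetric] intro: cspan.intros)
qed

lemma cspan_eq_self_iff: "cspan N = N \<longleftrightarrow> vs.subspace N"
  by (metis cspan_eq vs.span_eq_iff)

lemma sum_fun_apply: "(\<Sum>a\<in>A. f a) x = (\<Sum>a\<in>A. f a x)"
  for f :: "'a \<Rightarrow> 'b \<Rightarrow> 'c::comm_monoid_add"
  by (induction A rule: infinite_finite_induct) (auto simp: vec_simps)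

section \<open>Linear algebra of finitely supported functions\<close>

lemma fsv_iff: "v \<in> fsv B \<longleftrightarrow> finite {b. v b \<noteq> 0} \<and> (\<forall>b. v b \<noteq> 0 \<longrightarrow> b \<in> B)"
  by (auto simp: fsv_def)

lemma dlt_in_fsv [simp]: "dlt b \<in> fsv B \<longleftrightarrow> b \<in> B"
  by (auto simp: fsv_iff dlt_apply)

lemma subspace_fsv [simp]: "vs.subspace (fsv B)"
proof (rule vs.subspaceI)
  show "(0 :: 'a vec) \<in> fsv B" by (simp add: fsv_iff vec_simps)
next
  fix x y :: "'a vec" assume "x \<in> fsv B" "y \<in> fsv B"
  moreover have "{b. (x + y) b \<noteq> 0} \<subseteq> {b. x b \<noteq> 0} \<union> {b. y b \<noteq> 0}" by (auto simp: vec_simps)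
  ultimately show "x + y \<in> fsv B"
    unfolding fsv_iff by (metis (mono_tags, lifting) finite_Un finite_subset mem_Collect_eq plus_fun_apply add_0)
next
  fix c and x :: "'a vec" assume "x \<in> fsv B"
  then show "vsc c x \<in> fsv B" unfolding fsv_iff
    by (auto simp: vec_simps elim!: rev_finite_subset)
qed

lemma fsv_expand:
  assumes "v \<in> fsv B"
  shows "v = (\<Sum>b | v b \<noteq> 0. vsc (v b) (dlt b))"
proof
  fix c
  have fin: "finite {b. v b \<noteq> 0}" using assms by (simp add: fsv_iff)
  have "(\<Sum>b | v b \<noteq> 0. vsc (v b) (dlt b)) c = (\<Sum>b | v b \<noteq> 0. if b = c then v b else 0)"
    by (auto simp: sum_fun_apply vec_simps dlt_apply intro!: sum.cong)
  also have "\<dots> = v c" using fin by simp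
  finally show "v c = (\<Sum>b | v b \<noteq> 0. vsc (v b) (dlt b)) c" by simp
qed

lemma fsv_eq_span: "fsv B = vs.span (dlt ` B)"
proof
  show "fsv B \<subseteq> vs.span (dlt ` B)"
  proof
    fix v assume v: "v \<in> fsv B"
    have "(\<Sum>b | v b \<noteq> 0. vsc (v b) (dlt b)) \<in> vs.span (dlt ` B)"
      using v by (intro vs.span_sum vs.span_scale vs.span_base) (auto simp: fsv_iff)
    then show "v \<in> vs.span (dlt ` B)" using fsv_expand[OF v] by simp
  qed
  show "vs.span (dlt ` B) \<subseteq> fsv B"
    by (rule vs.span_minimal) auto
qed

text \<open>Linearity is asked only on a subspace \<open>V\<close>: \<open>lext\<close> sums over a
  support, and a sum over an infinite set is 0 by default, so additivity can fail outside finitely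
  supported vectors. An isomorphism of presented modules is likewise constrained only on
  \<open>fsv\<close>.\<close>

definition linon :: "'b vec set \<Rightarrow> ('b vec \<Rightarrow> 'c vec) \<Rightarrow> bool" where
  "linon V f \<longleftrightarrow> (\<forall>v\<in>V. \<forall>w\<in>V. f (v + w) = f v + f w) \<and> (\<forall>c. \<forall>v\<in>V. f (vsc c v) = vsc c (f v))"

lemma linonI:
  assumes "\<And>v w. v \<in> V \<Longrightarrow> w \<in> V \<Longrightarrow> f (v + w) = f v + f w"
    and "\<And>c v. v \<in> V \<Longrightarrow> f (vsc c v) = vsc c (f v)"
  shows "linon V f"
  using assms by (auto simp: linon_def)

lemma linon_add: "linon V f \<Longrightarrow> v \<in> V \<Longrightarrow> w \<in> V \<Longrightarrow> f (v + w) = f v + f w"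
  by (auto simp: linon_def)

lemma linon_scale: "linon V f \<Longrightarrow> v \<in> V \<Longrightarrow> f (vsc c v) = vsc c (f v)"
  by (auto simp: linon_def)

lemma linon_zero:
  assumes "linon V f" "vs.subspace V"
  shows "f 0 = 0"
  using linon_scale[OF assms(1) vs.subspace_0[OF assms(2)], of 0] by simp

lemma linon_diff:
  assumes "linon V f" "vs.subspace V" "v \<in> V" "w \<in> V"
  shows "f (v - w) = f v - f w"
  using linon_add[OF assms(1) vs.subspace_diff[OF assms(2-4)] assms(4)] by simp

lemma linon_sum:
  assumes "linon V f" "vs.subspace V" "\<And>k. k \<in> K \<Longrightarrow> g k \<in> V"
  shows "f (\<Sum>k\<in>K. g k) = (\<Sum>k\<in>K. f (g k))"
  using assms(3)
  by (induction K rule: infinite_finite_induct)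
    (auto simp: linon_zero[OF assms(1,2)] linon_add[OF assms(1)] vs.subspace_sum[OF assms(2)])

lemma linon_comp: "linon V f \<Longrightarrow> linon U g \<Longrightarrow> f ` V \<subseteq> U \<Longrightarrow> linon V (\<lambda>v. g (f v))"
  by (auto simp: linon_def image_subset_iff)

lemma linon_id: "linon V (\<lambda>v. v)"
  by (simp add: linon_def)

lemma linon_zero_fun: "linon V (\<lambda>v. 0)"
  by (simp add: linon_def)

lemma linon_plus: "linon V f \<Longrightarrow> linon V g \<Longrightarrow> linon V (\<lambda>v. f v + g v)"
  by (auto simp: linon_def vs.scale_right_distrib)

lemma linon_minus: "linon V f \<Longrightarrow> linon V g \<Longrightarrow> linon V (\<lambda>v. f v - g v)"
  by (auto simp: linon_def vs.scale_right_diff_distrib)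

lemma linon_vsc: "linon V f \<Longrightarrow> linon V (\<lambda>v. vsc c (f v))"
  by (auto simp: linon_def vs.scale_right_distrib mult.commute)

lemma linon_setsum: "(\<And>k. k \<in> K \<Longrightarrow> linon V (f k)) \<Longrightarrow> linon V (\<lambda>v. \<Sum>k\<in>K. f k v)"
  by (induction K rule: infinite_finite_induct) (auto intro: linon_zero_fun linon_plus)

lemma linon_into_span:
  assumes "linon V f" "vs.subspace V" "S \<subseteq> V" "vs.subspace J" "\<And>x. x \<in> S \<Longrightarrow> f x \<in> J"
    and "v \<in> vs.span S"
  shows "f v \<in> J"
proof -
  have "v \<in> V \<and> f v \<in> J" using assms(6)
  proof (rule vs.span_induct_alt)
    show "0 \<in> V \<and> f 0 \<in> J"
      using assms by (simp add: linon_zero[OF assms(1,2)] vs.subspace_0)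
  next
    fix c x y assume "x \<in> S" "y \<in> V \<and> f y \<in> J"
    then have "x \<in> V" "vsc c x \<in> V" "y \<in> V" "f x \<in> J" "f y \<in> J"
      using assms(2,3,5) by (auto intro: vs.subspace_scale)
    then show "vsc c x + y \<in> V \<and> f (vsc c x + y) \<in> J" using assms(1,2,4)
      by (simp add: linon_add linon_scale vs.subspace_add vs.subspace_scale)
  qed
  then show ?thesis ..
qed

lemma linon_into_fsv:
  assumes "linon (fsv B) f" "vs.subspace J" "\<And>b. b \<in> B \<Longrightarrow> f (dlt b) \<in> J" "v \<in> fsv B"
  shows "f v \<in> J"
proof (rule linon_into_span[OF assms(1) subspace_fsv _ assms(2)])
  show "v \<in> vs.span (dlt ` B)" using assms(4) by (simp add: fsv_eq_span)
qed (use assms(3) in auto)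

text \<open>The actions on tensor products, the evaluation \<open>run\<close> and the comparison
  maps \<open>T\<close>, \<open>S\<close> and \<open>theta\<close> are all instances of this
  extension from a basis, so their linearity is proved once.\<close>

definition lext :: "('b \<Rightarrow> 'c vec) \<Rightarrow> 'b vec \<Rightarrow> 'c vec" where
  "lext f v = (\<Sum>b | v b \<noteq> 0. vsc (v b) (f b))"

lemma lext_superset:
  assumes "finite A" "{b. v b \<noteq> 0} \<subseteq> A"
  shows "lext f v = (\<Sum>b\<in>A. vsc (v b) (f b))"
  unfolding lext_def using assms by (intro sum.mono_neutral_left) auto

lemma linon_lext: "linon (fsv B) (lext f)"
proof (rule linonI)
  fix v w :: "'a vec" assume "v \<in> fsv B" "w \<in> fsv B"
  then have fin: "finite ({b. v b \<noteq> 0} \<union> {b. w b \<noteq> 0})" (is "finite ?A") by (simp add: fsv_iff)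
  have "lext f (v + w) = (\<Sum>b\<in>?A. vsc ((v + w) b) (f b))"
    by (rule lext_superset[OF fin]) (auto simp: vec_simps)
  also have "\<dots> = (\<Sum>b\<in>?A. vsc (v b) (f b)) + (\<Sum>b\<in>?A. vsc (w b) (f b))"
    by (simp add: vec_simps vs.scale_left_distrib sum.distrib)
  also have "\<dots> = lext f v + lext f w"
    using fin by (intro arg_cong2[where f = "(+)"] lext_superset[symmetric]) auto
  finally show "lext f (v + w) = lext f v + lext f w" .
next
  fix c and v :: "'a vec" assume "v \<in> fsv B"
  then have fin: "finite {b. v b \<noteq> 0}" by (simp add: fsv_iff)
  have "lext f (vsc c v) = (\<Sum>b | v b \<noteq> 0. vsc (vsc c v b) (f b))"
    using fin by (intro lext_superset) (auto simp: vec_simps)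
  then show "lext f (vsc c v) = vsc c (lext f v)"
    by (simp add: lext_def vs.scale_sum_right vsc_apply)
qed

lemma lext_dlt [simp]: "lext f (dlt b) = f b"
  by (subst lext_superset[of "{b}"]) (auto simp: dlt_apply)

lemma lext_vsc [simp]: "lext f (vsc c (dlt b)) = vsc c (f b)"
  using linon_scale[OF linon_lext[of UNIV], of "dlt b" f c] by simp

lemma lext_minus [simp]: "lext f (- v) = - lext f v"
  by (simp add: lext_def uminus_apply sum_negf)

lemma lext_0 [simp]: "lext f 0 = 0"
  by (simp add: lext_def vec_simps)

lemma lext_in:
  assumes "vs.subspace V" "\<And>b. b \<in> B \<Longrightarrow> f b \<in> V" "v \<in> fsv B"
  shows "lext f v \<in> V"
  using linon_into_fsv[OF linon_lext assms(1) _ assms(3)] assms(2) by simp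

lemma lext_unique:
  assumes "linon (fsv B) g" "\<And>b. b \<in> B \<Longrightarrow> g (dlt b) = f b" "v \<in> fsv B"
  shows "g v = lext f v"
proof -
  have "g v - lext f v \<in> {0}"
    using assms linon_into_fsv[OF linon_minus[OF assms(1) linon_lext], of "{0}" f v]
    by (simp add: vs.subspace_single_0)
  then show ?thesis by simp
qed

lemma linon_eq_fsv:
  assumes "linon (fsv B) f" "linon (fsv B) g" "\<And>b. b \<in> B \<Longrightarrow> f (dlt b) = g (dlt b)" "v \<in> fsv B"
  shows "f v = g v"
  using lext_unique[OF assms(1) _ assms(4), of "\<lambda>b. g (dlt b)"]
    lext_unique[OF assms(2) _ assms(4), of "\<lambda>b. g (dlt b)"] assms(3) by simp

section \<open>Words and presented ideals\<close>

lemma linon_lmul: "linon V (lmul a)"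
  by (rule linonI) (auto simp: lmul_def fun_eq_iff vec_simps split: list.splits)

lemma lmul_dlt [simp]: "lmul a (dlt w) = dlt (a # w)"
  by (auto simp: lmul_def fun_eq_iff dlt_apply split: list.splits)

lemma lmul_fsv: "a \<in> A \<Longrightarrow> v \<in> fsv (lists A) \<Longrightarrow> lmul a v \<in> fsv (lists A)"
  by (rule linon_into_fsv[OF linon_lmul]) auto

lemma linon_sw: "linon V (\<lambda>r. sw u r u')"
  by (rule linonI) (auto simp: sw_def fun_eq_iff vec_simps)

lemma sw_dlt [simp]: "sw u (dlt w) u' = dlt (u @ w @ u')"
proof
  fix x
  have "length u + length u' \<le> length x \<and> take (length u) x = u \<and> drop (length x - length u') x = u'
      \<and> take (length x - length u - length u') (drop (length u) x) = w \<longleftrightarrow> x = u @ w @ u'"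
  proof safe
    assume *: "length u + length u' \<le> length x" "take (length u) x = u" "drop (length x - length u') x = u'"
    have "x = take (length x - length u') x @ drop (length x - length u') x" by simp
    also have "take (length x - length u') x
        = take (length u) (take (length x - length u') x) @ drop (length u) (take (length x - length u') x)"
      by (metis append_take_drop_id)
    also have "\<dots> = take (length u) x @ take (length x - length u - length u') (drop (length u) x)"
      using *(1) by (auto simp: drop_take min_def add.commute)
    finally show "x = u @ take (length x - length u - length u') (drop (length u) x) @ u'"
      unfolding * by simp
  qed auto
  then show "sw u (dlt w) u' x = dlt (u @ w @ u') x"
    by (auto simp: sw_def dlt_apply)
qed

lemma sw_lmul: "sw (a # u) r u' = lmul a (sw u r u')" if "r \<in> fsv UNIV"
  using linon_eq_fsv[OF linon_sw linon_comp[OF linon_sw linon_lmul[of UNIV]] _ that]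
  by simp

text \<open>Evaluation of a noncommutative polynomial \<open>r\<close>: each letter becomes its
  operator, and the resulting operator is applied to \<open>x\<close>. On \<open>brk n a b\<close>
  it gives the action of the Lie bracket.\<close>

abbreviation run :: "(gen \<Rightarrow> 'c vec \<Rightarrow> 'c vec) \<Rightarrow> 'c vec \<Rightarrow> gen list vec \<Rightarrow> 'c vec" where
  "run \<rho> x r \<equiv> lext (\<lambda>w. foldr \<rho> w x) r"

text \<open>Stronger than closure under brackets: in this basis a bracket is a multiple of a single
  letter, so \<open>run\<close> of a bracket reduces to \<open>vsc c (\<rho> x v)\<close>. Vanishing
  brackets are covered by \<open>c = 0\<close>.\<close>

definition brk_closed :: "nat \<Rightarrow> gen set \<Rightarrow> bool" where
  "brk_closed n A \<longleftrightarrow> (\<forall>a\<in>A. \<forall>b\<in>A. \<exists>c. \<exists>x\<in>A. brk n a b = vsc c (dlt [x]))"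

text \<open>With a zero coefficient the letter is arbitrary, and \<open>a\<close> itself serves;
  this absorbs letters that fall outside the index range.\<close>

lemma brk_cases:
  assumes "\<exists>c x. brk n a b = vsc c (dlt [x]) \<and> (c = 0 \<or> x \<in> A)" "a \<in> A"
  shows "\<exists>c. \<exists>x\<in>A. brk n a b = vsc c (dlt [x])"
proof -
  obtain c x where cx: "brk n a b = vsc c (dlt [x])" "c = 0 \<or> x \<in> A" using assms(1) by blast
  show ?thesis
  proof (cases "c = 0")
    case True
    then have "brk n a b = vsc 0 (dlt [a])" using cx by simp
    then show ?thesis using assms(2) by blast
  qed (use cx in blast)
qed

lemma vzero_eq_vsc: "vzero = vsc 0 (dlt x)"
  by (simp add: vzero_eq)

lemma brk_single: "\<exists>c x. brk n a b = vsc c (dlt [x]) \<and> (c = 0 \<or>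
    (a \<in> Gl n \<longrightarrow> b \<in> Gl n \<longrightarrow> x \<in> Gl n) \<and> (a \<in> GH n \<longrightarrow> b \<in> GH n \<longrightarrow> x \<in> GH n)
    \<and> (a \<in> GS \<longrightarrow> b \<in> GS \<longrightarrow> x \<in> GS))"
proof (cases "(n, a, b)" rule: brk.cases)
  case (1 n)
  then show ?thesis by (intro exI[of _ "2"] exI[of _ "E"]) (auto simp: Gl_def GH_def GS_def)
next
  case (2 n)
  then show ?thesis by (intro exI[of _ "-2"] exI[of _ "E"]) (auto simp: Gl_def GH_def GS_def)
next
  case (3 n)
  then show ?thesis by (intro exI[of _ "-2"] exI[of _ "F"]) (auto simp: Gl_def GH_def GS_def)
next
  case (4 n)
  then show ?thesis by (intro exI[of _ "2"] exI[of _ "F"]) (auto simp: Gl_def GH_def GS_def)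
next
  case (5 n)
  then show ?thesis by (intro exI[of _ "1"] exI[of _ "H"]) (auto simp: Gl_def GH_def GS_def)
next
  case (6 n)
  then show ?thesis by (intro exI[of _ "-1"] exI[of _ "H"]) (auto simp: Gl_def GH_def GS_def)
next
  case (7 n k)
  then show ?thesis by (intro exI[of _ "2 * (of_nat n + 1/2 - of_nat k)"] exI[of _ "P k"]) (auto simp: Gl_def GH_def GS_def)
next
  case (8 n k)
  then show ?thesis by (intro exI[of _ "- 2 * (of_nat n + 1/2 - of_nat k)"] exI[of _ "P k"]) (auto simp: Gl_def GH_def GS_def)
next
  case (9 n k)
  then show ?thesis by (intro exI[of _ "of_nat k"] exI[of _ "P (k - 1)"]) (auto simp: Gl_def GH_def GS_def)
next
  case (10 n k)
  then show ?thesis by (intro exI[of _ "- of_nat k"] exI[of _ "P (k - 1)"]) (auto simp: Gl_def GH_def GS_def)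
next
  \<comment> \<open>For \<open>k = 2*n+1\<close> the letter \<open>P (k + 1)\<close> leaves the
    range, but its coefficient is zero there; this is why the claim allows
    \<open>c = 0\<close>.\<close>
  case (11 n k)
  then show ?thesis
    by (intro exI[of _ "of_nat (2*n+1) - of_nat k"] exI[of _ "P (k + 1)"])
      (cases "k = 2*n+1", auto simp: Gl_def GH_def GS_def)
next
  case (12 n k)
  then show ?thesis
    by (intro exI[of _ "- (of_nat (2*n+1) - of_nat k)"] exI[of _ "P (k + 1)"])
      (cases "k = 2*n+1", auto simp: Gl_def GH_def GS_def)
next
  case (13 n k k')
  then show ?thesis
    by (intro exI[of _ "if k + k' = 2*n+1 then (-1) ^ (k + n + 1) * of_nat (fact k * fact (2*n+1-k)) else 0"]
        exI[of _ Z]) (auto simp: Gl_def GH_def GS_def vzero_eq_vsc[of "[Z]"])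
qed (auto simp: vzero_eq intro!: exI[of _ "0::complex"])

lemma brk_closed_Gl: "brk_closed n (Gl n)"
  unfolding brk_closed_def using brk_single by (blast intro: brk_cases)

lemma brk_closed_GH: "brk_closed n (GH n)"
  unfolding brk_closed_def using brk_single by (blast intro: brk_cases)

lemma brk_closed_GS: "brk_closed n GS"
  unfolding brk_closed_def using brk_single by (blast intro: brk_cases)

lemma brk_antisym: "brk n b a = - brk n a b"
proof (cases "(n, a, b)" rule: brk.cases)
  case (13 n k k')
  \<comment> \<open>\<open>k + k'\<close> is odd, so the two exponents have opposite parity, while
    \<open>k' = 2*n+1-k\<close> only swaps the two factorials.\<close>
  have "(- 1) ^ (k' + n) = - ((- 1) ^ (k + n) :: complex)" if "k + k' = 2 * n + 1"
    using that by (simp add: minus_one_power_iff) presburger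
  moreover have "fact k' * fact (2 * n + 1 - k') = (fact k * fact (2 * n + 1 - k) :: nat)" if "k + k' = 2 * n + 1"
    using that by (metis add_diff_cancel_left' add_diff_cancel_right' mult.commute)
  ultimately show ?thesis using 13
    by (auto simp: fun_eq_iff vsc_def fun_Compl_def vzero_def add.commute simp del: of_nat_mult)
qed (auto simp: fun_eq_iff vsc_def fun_Compl_def vzero_def algebra_simps)

section \<open>Representations on a quotient \<open>V\<close>/\<open>J\<close> and their universal
  property\<close>

definition opr :: "'b vec set \<Rightarrow> 'b vec set \<Rightarrow> ('b vec \<Rightarrow> 'b vec) \<Rightarrow> bool" where
  "opr V J f \<longleftrightarrow> linon V f \<and> f ` V \<subseteq> V \<and> f ` J \<subseteq> J"

text \<open>A Lie algebra action on \<open>V\<close>/\<open>J\<close> kept on representatives: the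
  operators descend to the quotient, and the bracket relations are required only modulo
  \<open>J\<close>. A quotient module is then obtained by enlarging \<open>J\<close> with the same
  operators.\<close>

definition rep :: "nat \<Rightarrow> gen set \<Rightarrow> 'b vec set \<Rightarrow> 'b vec set \<Rightarrow> (gen \<Rightarrow> 'b vec \<Rightarrow> 'b vec) \<Rightarrow> bool" where
  "rep n A V J \<rho> \<longleftrightarrow> vs.subspace V \<and> vs.subspace J \<and> J \<subseteq> V \<and> (\<forall>a\<in>A. opr V J (\<rho> a)) \<and>
     (\<forall>a\<in>A. \<forall>b\<in>A. \<forall>v\<in>V. \<rho> a (\<rho> b v) - \<rho> b (\<rho> a v) - run \<rho> v (brk n a b) \<in> J)"

lemma opr_V: "opr V J f \<Longrightarrow> v \<in> V \<Longrightarrow> f v \<in> V"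
  by (auto simp: opr_def)

lemma opr_J: "opr V J f \<Longrightarrow> v \<in> J \<Longrightarrow> f v \<in> J"
  by (auto simp: opr_def)

lemma opr_linon: "opr V J f \<Longrightarrow> linon V f"
  by (auto simp: opr_def)

lemma foldr_opr:
  assumes "\<forall>a\<in>A. opr V J (\<rho> a)" "u \<in> lists A"
  shows "opr V J (foldr \<rho> u)"
  using assms(2)
proof induction
  case Nil
  then show ?case by (auto simp: opr_def linon_def)
next
  case (Cons a u)
  then have "opr V J (\<rho> a)" "opr V J (foldr \<rho> u)" using assms(1) by auto
  then show ?case unfolding opr_def by (auto intro: linon_comp[of V _ V] simp: comp_def image_subset_iff)
qed

lemma run_in:
  assumes "\<forall>a\<in>A. opr V J (\<rho> a)" "vs.subspace V" "x \<in> V" "r \<in> fsv (lists A)"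
  shows "run \<rho> x r \<in> V"
  using opr_V[OF foldr_opr[OF assms(1)] assms(3)] by (intro lext_in[OF assms(2) _ assms(4)]) auto

lemma fsv_UNIV: "v \<in> fsv A \<Longrightarrow> v \<in> fsv UNIV"
  by (auto simp: fsv_iff)

lemma run_lmul: "run \<rho> x (lmul a r) = \<rho> a (run \<rho> x r)"
  if "\<forall>a\<in>A. opr V J (\<rho> a)" "vs.subspace V" "x \<in> V" "r \<in> fsv (lists A)" "a \<in> A"
proof (rule linon_eq_fsv[OF _ _ _ that(4)])
  show "linon (fsv (lists A)) (\<lambda>r. run \<rho> x (lmul a r))"
    by (rule linon_comp[OF linon_lmul linon_lext]) (use lmul_fsv[OF that(5)] in auto)
  show "linon (fsv (lists A)) (\<lambda>r. \<rho> a (run \<rho> x r))"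
    using run_in[OF that(1-3)] that(1,5) by (intro linon_comp[OF linon_lext, where U = V]) (auto simp: opr_def)
qed simp

lemma sw_fsv: "u \<in> lists A \<Longrightarrow> u' \<in> lists A \<Longrightarrow> r \<in> fsv (lists A) \<Longrightarrow> sw u r u' \<in> fsv (lists A)"
  by (rule linon_into_fsv[OF linon_sw]) auto

lemma run_sw:
  assumes "\<forall>a\<in>A. opr V J (\<rho> a)" "vs.subspace V" "x \<in> V" "r \<in> fsv (lists A)"
    "u \<in> lists A" "u' \<in> lists A"
  shows "run \<rho> x (sw u r u') = foldr \<rho> u (run \<rho> (foldr \<rho> u' x) r)"
proof (rule linon_eq_fsv[OF _ _ _ assms(4)])
  have y: "foldr \<rho> u' x \<in> V" using foldr_opr[OF assms(1,6)] assms(3) by (auto intro: opr_V)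
  show "linon (fsv (lists A)) (\<lambda>r. run \<rho> x (sw u r u'))"
    by (rule linon_comp[OF linon_sw linon_lext]) (use sw_fsv[OF assms(5,6)] in auto)
  show "linon (fsv (lists A)) (\<lambda>r. foldr \<rho> u (run \<rho> (foldr \<rho> u' x) r))"
    using run_in[OF assms(1,2) y] opr_linon[OF foldr_opr[OF assms(1,5)]]
    by (intro linon_comp[OF linon_lext, where U = V]) auto
qed simp

lemma lierel_eq: "lierel n a b = dlt [a, b] - dlt [b, a] - brk n a b"
  by (simp add: lierel_def vsub_eq)

lemma brk_fsv: "brk_closed n A \<Longrightarrow> a \<in> A \<Longrightarrow> b \<in> A \<Longrightarrow> brk n a b \<in> fsv (lists A)"
  unfolding brk_closed_def by (metis Cons_in_lists_iff dlt_in_fsv lists.Nil subspace_fsv vs.subspace_scale)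

lemma lierel_fsv: "brk_closed n A \<Longrightarrow> a \<in> A \<Longrightarrow> b \<in> A \<Longrightarrow> lierel n a b \<in> fsv (lists A)"
  unfolding lierel_eq by (intro vs.subspace_diff brk_fsv subspace_fsv) auto

definition anns :: "gen set \<Rightarrow> (gen \<times> complex) set \<Rightarrow> gen list vec set" where
  "anns A C = {ann u x c | u x c. u \<in> lists A \<and> (x, c) \<in> C}"

text \<open>Lie relations may be multiplied by words on both sides, the conditions
  \<open>x = c\<close> only from the left, so this is a left ideal of the tensor algebra. Its
  quotient is the module generated by one vector on which \<open>x\<close> acts by
  \<open>c\<close>.\<close>

definition pideal :: "nat \<Rightarrow> gen set \<Rightarrow> (gen \<times> complex) set \<Rightarrow> gen list vec set" where
  "pideal n A C = vs.span (lie_ideal n A \<union> anns A C)"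

lemma ann_rel_fsv: "x \<in> A \<Longrightarrow> vsub (dlt [x]) (vsc c (dlt [])) \<in> fsv (lists A)"
  unfolding vsub_eq by (intro vs.subspace_diff vs.subspace_scale subspace_fsv) auto

lemma gens_fsv:
  assumes "brk_closed n A" "fst ` C \<subseteq> A"
  shows "lie_ideal n A \<union> anns A C \<subseteq> fsv (lists A)"
  using assms by (force simp: lie_ideal_def anns_def ann_def intro!: sw_fsv lierel_fsv ann_rel_fsv)

text \<open>Universal property of an induced module: a vector that satisfies the eigenvalue
  conditions modulo \<open>J\<close> receives a homomorphism. Lie relations go to \<open>J\<close>
  because \<open>\<rho>\<close> is a representation, and the conditions in \<open>C\<close> because
  the operators of a prefixed word preserve \<open>J\<close>.\<close>

lemma universal:
  assumes "rep n A V J \<rho>" "brk_closed n A" "fst ` C \<subseteq> A" "x \<in> V"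
    and C: "\<And>y c. (y, c) \<in> C \<Longrightarrow> \<rho> y x - vsc c x \<in> J" and r: "r \<in> pideal n A C"
  shows "run \<rho> x r \<in> J"
proof (rule linon_into_span[OF linon_lext subspace_fsv gens_fsv[OF assms(2,3)] _ _ r[unfolded pideal_def]])
  have rep: "vs.subspace V" "vs.subspace J" "J \<subseteq> V" "\<forall>a\<in>A. opr V J (\<rho> a)"
      "\<And>a b v. a \<in> A \<Longrightarrow> b \<in> A \<Longrightarrow> v \<in> V \<Longrightarrow> \<rho> a (\<rho> b v) - \<rho> b (\<rho> a v) - run \<rho> v (brk n a b) \<in> J"
    using assms(1) by (auto simp: rep_def)
  show "vs.subspace J" by fact
  fix y assume "y \<in> lie_ideal n A \<union> anns A C"
  then show "run \<rho> x y \<in> J"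
  proof
    assume "y \<in> lie_ideal n A"
    then obtain u u' a b where y: "y = sw u (lierel n a b) u'" "u \<in> lists A" "u' \<in> lists A" "a \<in> A" "b \<in> A"
      by (auto simp: lie_ideal_def)
    let ?v = "foldr \<rho> u' x"
    have v: "?v \<in> V" using opr_V[OF foldr_opr[OF rep(4) y(3)]] assms(4) by auto
    have "run \<rho> ?v (lierel n a b) = \<rho> a (\<rho> b ?v) - \<rho> b (\<rho> a ?v) - run \<rho> ?v (brk n a b)"
      using brk_fsv[OF assms(2) y(4,5)] y(4,5) unfolding lierel_eq
      by (simp add: linon_diff[OF linon_lext subspace_fsv, of _ "lists A"] vs.subspace_diff)
    then have "run \<rho> ?v (lierel n a b) \<in> J" using rep(5)[OF y(4,5) v] by simp
    then show ?thesis unfolding y(1)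
      using opr_J[OF foldr_opr[OF rep(4) y(2)]]
      by (subst run_sw[OF rep(4) rep(1) assms(4) lierel_fsv[OF assms(2) y(4,5)] y(2,3)]) auto
  next
    assume "y \<in> anns A C"
    then obtain u z c where y: "y = ann u z c" "u \<in> lists A" "(z, c) \<in> C" by (auto simp: anns_def)
    then have z: "z \<in> A" using assms(3) by force
    have "run \<rho> x (vsub (dlt [z]) (vsc c (dlt []))) = \<rho> z x - vsc c x"
      using z by (simp add: vsub_eq linon_diff[OF linon_lext subspace_fsv, of _ "lists A"] vs.subspace_scale)
    then show ?thesis unfolding y(1) ann_def
      using opr_J[OF foldr_opr[OF rep(4) y(2)]] C[OF y(3)]
      by (subst run_sw[OF rep(4) rep(1) assms(4) ann_rel_fsv[OF z] y(2)]) auto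
  qed
qed

text \<open>Prefixing a letter sends each generator of the ideal to another generator.\<close>

lemma lmul_pideal:
  assumes "brk_closed n A" "fst ` C \<subseteq> A" "a \<in> A" "v \<in> pideal n A C"
  shows "lmul a v \<in> pideal n A C"
proof (rule linon_into_span[OF linon_lmul subspace_fsv gens_fsv[OF assms(1,2)] _ _ assms(4)[unfolded pideal_def]])
  show "vs.subspace (pideal n A C)" by (simp add: pideal_def)
  fix x assume "x \<in> lie_ideal n A \<union> anns A C"
  then have "lmul a x \<in> lie_ideal n A \<union> anns A C"
  proof
    assume "x \<in> lie_ideal n A"
    then obtain u u' d b where y: "x = sw u (lierel n d b) u'" "u \<in> lists A" "u' \<in> lists A" "d \<in> A" "b \<in> A"
      by (auto simp: lie_ideal_def)
    then have "lmul a x = sw (a # u) (lierel n d b) u'"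
      using lierel_fsv[OF assms(1) y(4,5)] by (simp add: sw_lmul fsv_UNIV)
    moreover have "a # u \<in> lists A" using y assms(3) by simp
    ultimately show ?thesis using y(3-5) unfolding lie_ideal_def by blast
  next
    assume "x \<in> anns A C"
    then obtain u z c where y: "x = ann u z c" "u \<in> lists A" "(z, c) \<in> C" by (auto simp: anns_def)
    then have z: "z \<in> A" using assms(2) by force
    then have "lmul a x = ann (a # u) z c"
      using y by (simp add: ann_def sw_lmul[OF fsv_UNIV[OF ann_rel_fsv[OF z]]])
    moreover have "a # u \<in> lists A" using y assms(3) by simp
    ultimately show ?thesis using y(3) unfolding anns_def by blast
  qed
  then show "lmul a x \<in> pideal n A C" by (auto simp: pideal_def intro: vs.span_base)
qed

lemma rep_lmul:
  assumes "brk_closed n A" "fst ` C \<subseteq> A"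
  shows "rep n A (fsv (lists A)) (pideal n A C) lmul"
  unfolding rep_def
proof (intro conjI ballI subspace_fsv)
  show sub: "vs.subspace (pideal n A C)" by (simp add: pideal_def)
  show "pideal n A C \<subseteq> fsv (lists A)"
    unfolding pideal_def using gens_fsv[OF assms] by (rule vs.span_minimal) simp
  show opr: "opr (fsv (lists A)) (pideal n A C) (lmul a)" if "a \<in> A" for a
    using that lmul_pideal[OF assms that] by (auto simp: opr_def linon_lmul lmul_fsv)
  fix a b v assume ab: "a \<in> A" "b \<in> A" and v: "v \<in> fsv (lists A)"
  obtain c x where cx: "x \<in> A" "brk n a b = vsc c (dlt [x])"
    using assms(1) ab unfolding brk_closed_def by blast
  have "lmul a (lmul b v) - lmul b (lmul a v) - vsc c (lmul x v) \<in> pideal n A C"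
  proof (rule linon_into_fsv[OF _ sub _ v])
    show "linon (fsv (lists A)) (\<lambda>v. lmul a (lmul b v) - lmul b (lmul a v) - vsc c (lmul x v))"
      by (intro linon_minus linon_vsc linon_comp[OF linon_lmul linon_lmul[where V = UNIV]] linon_lmul) auto
    fix w assume "w \<in> lists A"
    \<comment> \<open>Here the right factors of the two-sided ideal enter: the Lie relation
      multiplied by \<open>w\<close> on the right is the commutation rule in front of the word
      \<open>w\<close>.\<close>
    then have "sw [] (lierel n a b) w \<in> lie_ideal n A" using ab by (auto simp: lie_ideal_def)
    then have "sw [] (lierel n a b) w \<in> pideal n A C" by (auto simp: pideal_def intro: vs.span_base)
    moreover have "sw [] (lierel n a b) w = dlt (a # b # w) - dlt (b # a # w) - vsc c (dlt (x # w))"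
      by (simp add: lierel_eq cx linon_diff[OF linon_sw, where V = UNIV] linon_scale[OF linon_sw, where V = UNIV])
    ultimately show "lmul a (lmul b (dlt w)) - lmul b (lmul a (dlt w)) - vsc c (lmul x (dlt w)) \<in> pideal n A C"
      by simp
  qed
  then show "lmul a (lmul b v) - lmul b (lmul a v) - run lmul v (brk n a b) \<in> pideal n A C"
    using cx(2) by simp
qed

lemma ann_in_pideal:
  assumes "(x, c) \<in> C" "u \<in> lists A"
  shows "dlt (u @ [x]) - vsc c (dlt u) \<in> pideal n A C"
proof -
  have "ann u x c \<in> pideal n A C"
    using assms by (auto simp: pideal_def anns_def intro!: vs.span_base)
  then show ?thesis
    by (simp add: ann_def vsub_eq linon_diff[OF linon_sw, where V = UNIV] linon_scale[OF linon_sw, where V = UNIV])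
qed

section \<open>The quadratic operators\<close>

text \<open>The scalar in \<open>[p_k, p_{2l-k}] = gm n k * z\<close>; with l = n + 1/2 the exponent
  k + l + 1/2 is k + n + 1.\<close>

definition gm :: "nat \<Rightarrow> nat \<Rightarrow> complex" where
  "gm n k = (-1) ^ (k + n + 1) * of_nat (fact k * fact (2*n+1-k))"

lemma gm_nz: "gm n k \<noteq> 0"
  by (simp add: gm_def)

lemma gm_flip: "k \<le> 2*n+1 \<Longrightarrow> gm n (2*n+1-k) = - gm n k"
proof -
  assume k: "k \<le> 2*n+1"
  then have "(- 1) ^ (2*n+1-k + n + 1) = - ((- 1) ^ (k + n + 1) :: complex)"
    by (auto simp: minus_one_power_iff)
  moreover have "2*n+1-(2*n+1-k) = k" using k by simp
  ultimately show ?thesis by (simp add: gm_def mult.commute)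
qed

text \<open>Neighbouring constants differ by a factor moved between the factorials and by a sign.
  The identity expresses that e annihilates the central element \<open>[p_{k+1}, p_{2l-k}]\<close>,
  and it is what allows sums with shifted index to be compared.\<close>

lemma gm_Suc:
  assumes "k \<le> 2*n"
  shows "of_nat (k + 1) * gm n k = - (of_nat (2*n+1) - of_nat k) * gm n (k + 1)"
proof -
  obtain d where d: "2*n = k + d" using assms by (metis le_Suc_ex)
  have "2*n+1-k = Suc d" "2*n+1-(k+1) = d" "of_nat (2*n+1) - of_nat k = (of_nat (Suc d) :: complex)"
    unfolding d by simp_all
  then show ?thesis by (simp add: gm_def algebra_simps)
qed

text \<open>One shape for the images of e, f, h and for the Euler operator, so that commutators with
  quadratic expressions are computed once.\<close>

definition quad :: "(nat \<Rightarrow> 'b vec \<Rightarrow> 'b vec) \<Rightarrow> nat set \<Rightarrow> (nat \<Rightarrow> complex) \<Rightarrow> (nat \<Rightarrow> nat) \<Rightarrow> (nat \<Rightarrow> nat) \<Rightarrow> 'b vec \<Rightarrow> 'b vec" where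
  "quad p K c i l v = (\<Sum>k\<in>K. vsc (c k) (p (i k) (p (l k) v)))"

text \<open>The given formulas with \<open>1 / ((k-1)! (2l-k)!)\<close> rewritten as
  \<open>k / (k! (2l-k)!)\<close> and the sign moved into the denominator: each coefficient then has
  the denominator \<open>gm n k * zdot\<close>, which cancels against a commutator constant. The
  operators \<open>p\<close> stay abstract because Phi is used on several modules.\<close>

definition Phi :: "nat \<Rightarrow> complex \<Rightarrow> (nat \<Rightarrow> 'b vec \<Rightarrow> 'b vec) \<Rightarrow> gen \<Rightarrow> 'b vec \<Rightarrow> 'b vec" where
  "Phi n zdot p a = (case a of
     E \<Rightarrow> quad p {1..2*n+1} (\<lambda>k. (of_nat n + 1/2 - of_nat k) * of_nat k / (gm n k * zdot)) (\<lambda>k. k - 1) (\<lambda>k. 2*n+1-k)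
   | F \<Rightarrow> quad p {1..2*n+1} (\<lambda>k. - (of_nat n + 1/2 - of_nat k) * of_nat k / (gm n k * zdot)) (\<lambda>k. k) (\<lambda>k. 2*n+2-k)
   | H \<Rightarrow> (\<lambda>v. quad p {0..n} (\<lambda>k. - 2 * (of_nat n + 1/2 - of_nat k) / (gm n k * zdot)) (\<lambda>k. 2*n+1-k) (\<lambda>k. k) v
            - vsc ((of_nat n + 1) ^ 2 / 2) v)
   | _ \<Rightarrow> (\<lambda>v. 0))"

text \<open>Together with \<open>sh\<close> this writes \<open>[a, p_j]\<close> for all three sl2
  letters as a weight times a shifted letter. At the ends the shift is meaningless
  (\<open>0 - 1 = 0\<close> for \<open>E\<close>, \<open>2*n+2\<close> for \<open>F\<close>), but
  the weight is zero there.\<close>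

fun wt :: "nat \<Rightarrow> gen \<Rightarrow> nat \<Rightarrow> complex" where
  "wt n E j = of_nat j"
| "wt n H j = 2 * (of_nat n + 1/2 - of_nat j)"
| "wt n F j = of_nat (2*n+1) - of_nat j"
| "wt n _ j = 0"

fun sh :: "gen \<Rightarrow> nat \<Rightarrow> nat" where
  "sh E j = j - 1"
| "sh F j = j + 1"
| "sh _ j = j"

lemma brk_wt: "a \<in> GS \<Longrightarrow> brk n a (P j) = vsc (wt n a j) (dlt [P (sh a j)])"
  by (auto simp: GS_def)

lemma sum_single: "finite K \<Longrightarrow> k0 \<in> K \<Longrightarrow> (\<And>k. k \<in> K \<Longrightarrow> k \<noteq> k0 \<Longrightarrow> f k = 0) \<Longrightarrow> sum f K = f k0"
  for f :: "'a \<Rightarrow> 'b::comm_monoid_add"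
  by (subst sum.mono_neutral_right[of K "{k0}"]) auto

text \<open>This sum is the scalar produced when the quadratic expression \<open>[\<Phi> e, \<Phi> f]\<close> is brought into normal order;
  it is the source of the constant in \<open>\<Phi> h\<close>.\<close>

lemma sum_central_charge:
  "(\<Sum>k\<in>{0..n}. (of_nat n - 1/2 - of_nat k) * (of_nat k + 1) * (of_nat (2*n+1) - of_nat k)
     - (of_nat n + 1/2 - of_nat k) * of_nat k * (of_nat (2*n+2) - of_nat k)) = - ((of_nat n + 1) ^ 2 / 2 :: complex)"
proof -
  \<comment> \<open>\<open>n\<close> is both the bound of the sum and a parameter of its terms;
    separating the two into \<open>m\<close> and \<open>x\<close> makes induction possible.\<close>
  have main: "(\<Sum>k\<in>{0..m}. (x - 1/2 - of_nat k) * (of_nat k + 1) * (2*x+1 - of_nat k)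
     - (x + 1/2 - of_nat k) * of_nat k * (2*x+2 - of_nat k))
    = (of_nat m + 1) * (of_nat m ^ 2 - 3 * of_nat m * x + 2 * x ^ 2 - of_nat m / 2 - 1 / 2)"
    for m and x :: complex
  proof (induction m)
    case (Suc m)
    show ?case unfolding sum.atLeast0_atMost_Suc Suc.IH by (simp add: field_simps power2_eq_square)
  qed (simp add: field_simps power2_eq_square)
  from main[of "of_nat n" n] show ?thesis
    unfolding of_nat_add of_nat_mult of_nat_numeral of_nat_1 by (rule trans) (simp add: field_simps power2_eq_square)
qed

text \<open>Heisenberg operators modulo \<open>J\<close>, with \<open>z\<close> already replaced by
  the scalar \<open>zdot\<close>. The two main instances are the Heisenberg module, where Phi
  defines the action, and the full Verma module, where Phi is compared with e, f, h.\<close>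

locale heis =
  fixes n :: nat and zdot :: complex and V J :: "'b vec set" and p :: "nat \<Rightarrow> 'b vec \<Rightarrow> 'b vec"
  assumes zdot: "zdot \<noteq> 0" and subV: "vs.subspace V" and subJ: "vs.subspace J" and JV: "J \<subseteq> V"
    and opr_p: "k \<le> 2*n+1 \<Longrightarrow> opr V J (p k)"
    and comm: "j \<le> 2*n+1 \<Longrightarrow> k \<le> 2*n+1 \<Longrightarrow> v \<in> V \<Longrightarrow>
      p j (p k v) - p k (p j v) - vsc (if j + k = 2*n+1 then gm n j * zdot else 0) v \<in> J"
begin

definition om :: "nat \<Rightarrow> nat \<Rightarrow> complex" where
  "om j k = (if j + k = 2*n+1 then gm n j * zdot else 0)"

lemma om_flip: "j \<le> 2*n+1 \<Longrightarrow> om (2*n+1-j) j = - gm n j * zdot"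
  unfolding om_def by (subst gm_flip) auto

lemma p_V [simp]: "k \<le> 2*n+1 \<Longrightarrow> v \<in> V \<Longrightarrow> p k v \<in> V"
  by (rule opr_V[OF opr_p])

lemma p_J [simp]: "k \<le> 2*n+1 \<Longrightarrow> v \<in> J \<Longrightarrow> p k v \<in> J"
  by (rule opr_J[OF opr_p])

lemma p_diff: "k \<le> 2*n+1 \<Longrightarrow> v \<in> V \<Longrightarrow> w \<in> V \<Longrightarrow> p k (v - w) = p k v - p k w"
  by (rule linon_diff[OF opr_linon[OF opr_p] subV])

lemma p_vsc: "k \<le> 2*n+1 \<Longrightarrow> v \<in> V \<Longrightarrow> p k (vsc c v) = vsc c (p k v)"
  by (rule linon_scale[OF opr_linon[OF opr_p]])

lemma V_closed [simp]:
  "v \<in> V \<Longrightarrow> w \<in> V \<Longrightarrow> v + w \<in> V" "v \<in> V \<Longrightarrow> w \<in> V \<Longrightarrow> v - w \<in> V" "v \<in> V \<Longrightarrow> vsc c v \<in> V"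
  using subV by (auto intro: vs.subspace_add vs.subspace_diff vs.subspace_scale)

lemma J_closed:
  "v \<in> J \<Longrightarrow> w \<in> J \<Longrightarrow> v + w \<in> J" "v \<in> J \<Longrightarrow> w \<in> J \<Longrightarrow> v - w \<in> J" "v \<in> J \<Longrightarrow> vsc c v \<in> J"
  using subJ by (auto intro: vs.subspace_add vs.subspace_diff vs.subspace_scale)

lemma J_trans: "x - y \<in> J \<Longrightarrow> y - z \<in> J \<Longrightarrow> x - z \<in> J"
  using J_closed(1)[of "x - y" "y - z"] by simp

lemma J_sum: "(\<And>k. k \<in> K \<Longrightarrow> f k \<in> J) \<Longrightarrow> (\<Sum>k\<in>K. f k) \<in> J"
  by (rule vs.subspace_sum[OF subJ])

lemma opr_quad:
  assumes "\<And>k. k \<in> K \<Longrightarrow> i k \<le> 2*n+1 \<and> l k \<le> 2*n+1"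
  shows "opr V J (quad p K c i l)"
proof -
  have pp: "linon V (\<lambda>v. p (i k) (p (l k) v))" if "k \<in> K" for k
    using assms[OF that] by (intro linon_comp[OF opr_linon[OF opr_p] opr_linon[OF opr_p]]) auto
  have "linon V (quad p K c i l)"
    unfolding quad_def by (intro linon_setsum linon_vsc pp)
  moreover have "quad p K c i l v \<in> U" if "U = V \<or> U = J" "v \<in> U" for U v
    unfolding quad_def using assms that subV subJ by (auto intro!: vs.subspace_sum J_closed)
  ultimately show ?thesis unfolding opr_def image_subset_iff by blast
qed

lemma opr_minus_vsc: "opr V J f \<Longrightarrow> opr V J (\<lambda>v. f v - vsc c v)"
  by (auto simp: opr_def image_subset_iff J_closed intro!: linon_minus linon_vsc linon_id)

lemma opr_Phi: "opr V J (Phi n zdot p a)"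
proof (cases a)
  case H
  show ?thesis unfolding H Phi_def gen.case by (rule opr_minus_vsc[OF opr_quad]) auto
qed (auto simp: Phi_def intro!: opr_quad, auto simp: opr_def linon_zero_fun vs.subspace_0 subV subJ)

text \<open>Leibniz rule: an operator that commutes with each \<open>p_j\<close> up to a multiple of
  \<open>p (s j)\<close> acts on products as a derivation. \<open>p i\<close> is linear only on
  \<open>V\<close>, so \<open>s j\<close> has to be in range unless its weight vanishes.\<close>

lemma ad_pp:
  assumes "opr V J X" "\<And>j v. j \<le> 2*n+1 \<Longrightarrow> v \<in> V \<Longrightarrow> X (p j v) - p j (X v) - vsc (w j) (p (s j) v) \<in> J"
    "i \<le> 2*n+1" "j \<le> 2*n+1" "w j = 0 \<or> s j \<le> 2*n+1" "v \<in> V"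
  shows "X (p i (p j v)) - p i (p j (X v)) - (vsc (w i) (p (s i) (p j v)) + vsc (w j) (p i (p (s j) v))) \<in> J"
proof -
  have X: "X v \<in> V" "X (p j v) \<in> V" using assms by (auto intro: opr_V)
  have 1: "X (p i (p j v)) - p i (X (p j v)) - vsc (w i) (p (s i) (p j v)) \<in> J"
    using assms by simp
  have "p i (X (p j v) - p j (X v) - vsc (w j) (p (s j) v)) \<in> J"
    using assms by simp
  then have 2: "p i (X (p j v)) - p i (p j (X v)) - vsc (w j) (p i (p (s j) v)) \<in> J"
    using assms(3-6) X by (auto simp: p_diff p_vsc)
  show ?thesis using J_closed(1)[OF 1 2] by (simp add: algebra_simps)
qed

text \<open>The Leibniz rule summed over a quadratic expression. With the weights \<open>wt\<close>
  it yields the brackets among the images of e, f, h; with zero weights, the commutation of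
  \<open>D\<close> with Phi.\<close>

lemma ad_quad:
  assumes "opr V J X" "\<And>j v. j \<le> 2*n+1 \<Longrightarrow> v \<in> V \<Longrightarrow> X (p j v) - p j (X v) - vsc (w j) (p (s j) v) \<in> J"
    "\<And>k. k \<in> K \<Longrightarrow> i k \<le> 2*n+1 \<and> l k \<le> 2*n+1 \<and> (w (l k) = 0 \<or> s (l k) \<le> 2*n+1)" "v \<in> V"
  shows "X (quad p K c i l v) - quad p K c i l (X v)
     - (\<Sum>k\<in>K. vsc (c k) (vsc (w (i k)) (p (s (i k)) (p (l k) v)) + vsc (w (l k)) (p (i k) (p (s (l k)) v)))) \<in> J"
proof -
  have "X (quad p K c i l v) = (\<Sum>k\<in>K. vsc (c k) (X (p (i k) (p (l k) v))))"
    unfolding quad_def using assms(3,4)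
    by (subst linon_sum[OF opr_linon[OF assms(1)] subV])
       (auto intro!: sum.cong linon_scale[OF opr_linon[OF assms(1)]])
  then have "X (quad p K c i l v) - quad p K c i l (X v)
     - (\<Sum>k\<in>K. vsc (c k) (vsc (w (i k)) (p (s (i k)) (p (l k) v)) + vsc (w (l k)) (p (i k) (p (s (l k)) v))))
     = (\<Sum>k\<in>K. vsc (c k) (X (p (i k) (p (l k) v)) - p (i k) (p (l k) (X v))
        - (vsc (w (i k)) (p (s (i k)) (p (l k) v)) + vsc (w (l k)) (p (i k) (p (s (l k)) v)))))"
    by (simp add: quad_def sum_subtractf vs.scale_right_diff_distrib)
  also have "\<dots> \<in> J"
    using assms(3,4) ad_pp[OF assms(1,2)] by (intro J_sum J_closed(3)) simp
  finally show ?thesis .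
qed

text \<open>Moving \<open>p_j\<close> through a product contracts one of the two factors with
  \<open>p_j\<close>; a contraction is a scalar, so what remains is linear in the
  \<open>p\<close>.\<close>

lemma quad_ad_p:
  assumes "\<And>k. k \<in> K \<Longrightarrow> i k \<le> 2*n+1 \<and> l k \<le> 2*n+1" "j \<le> 2*n+1" "v \<in> V"
  shows "quad p K c i l (p j v) - p j (quad p K c i l v)
     - ((\<Sum>k\<in>K. vsc (c k * om (l k) j) (p (i k) v)) + (\<Sum>k\<in>K. vsc (c k * om (i k) j) (p (l k) v))) \<in> J"
proof -
  have 1: "p (i k) (p (l k) (p j v)) - p j (p (i k) (p (l k) v)) - (vsc (om (l k) j) (p (i k) v) + vsc (om (i k) j) (p (l k) v)) \<in> J"
    if "k \<in> K" for k
  proof -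
    have ik: "i k \<le> 2*n+1" "l k \<le> 2*n+1" using assms(1) that by auto
    have 1: "p (i k) (p j (p (l k) v)) - p j (p (i k) (p (l k) v)) - vsc (om (i k) j) (p (l k) v) \<in> J"
      using comm[OF ik(1) assms(2), of "p (l k) v"] ik assms by (simp add: om_def)
    have "p (i k) (p (l k) (p j v) - p j (p (l k) v) - vsc (om (l k) j) v) \<in> J"
      using comm[OF ik(2) assms(2,3)] ik by (simp add: om_def)
    then have 2: "p (i k) (p (l k) (p j v)) - p (i k) (p j (p (l k) v)) - vsc (om (l k) j) (p (i k) v) \<in> J"
      using ik assms by (simp add: p_diff p_vsc)
    show ?thesis using J_closed(1)[OF 1 2] by (simp add: algebra_simps)
  qed
  have "p j (quad p K c i l v) = (\<Sum>k\<in>K. vsc (c k) (p j (p (i k) (p (l k) v))))"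
    unfolding quad_def using assms
    by (subst linon_sum[OF opr_linon[OF opr_p] subV]) (auto intro!: sum.cong p_vsc)
  then have "quad p K c i l (p j v) - p j (quad p K c i l v)
     - ((\<Sum>k\<in>K. vsc (c k * om (l k) j) (p (i k) v)) + (\<Sum>k\<in>K. vsc (c k * om (i k) j) (p (l k) v)))
     = (\<Sum>k\<in>K. vsc (c k) (p (i k) (p (l k) (p j v)) - p j (p (i k) (p (l k) v))
        - (vsc (om (l k) j) (p (i k) v) + vsc (om (i k) j) (p (l k) v))))"
    by (simp add: quad_def sum_subtractf sum.distrib vs.scale_right_diff_distrib vs.scale_right_distrib)
  also have "\<dots> \<in> J"
    using 1 by (intro J_sum J_closed(3)) simp
  finally show ?thesis .
qed

text \<open>Each of the two contraction sums has at most one nonzero term, at \<open>k = j\<close>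
  and at \<open>k = 2*n+2-j\<close>. With l = n + 1/2 they contribute -(l-j)j and (l+1-j)j, which
  add up to j.\<close>

lemma Phi_E_p:
  assumes "j \<le> 2*n+1" "v \<in> V"
  shows "Phi n zdot p E (p j v) - p j (Phi n zdot p E v) - vsc (of_nat j) (p (j - 1) v) \<in> J"
proof -
  let ?c = "\<lambda>k. (of_nat n + 1/2 - of_nat k) * of_nat k / (gm n k * zdot)"
  let ?A = "\<Sum>k\<in>{1..2*n+1}. vsc (?c k * om (2*n+1-k) j) (p (k - 1) v)"
  let ?B = "\<Sum>k\<in>{1..2*n+1}. vsc (?c k * om (k - 1) j) (p (2*n+1-k) v)"
  have "?A + ?B = vsc (of_nat j) (p (j - 1) v)"
  proof (cases "j = 0")
    case True
    then have "?A = 0" "?B = 0" by (auto simp: om_def intro!: sum.neutral)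
    then show ?thesis using True by simp
  next
    case False
    have "?A = vsc (?c j * om (2*n+1-j) j) (p (j - 1) v)"
      using False assms by (intro sum_single) (auto simp: om_def)
    moreover have "?B = vsc (?c (2*n+2-j) * om (2*n+1-j) j) (p (j - 1) v)"
      using False assms by (subst sum_single[of _ "2*n+2-j"]) (auto simp: om_def)
    moreover have "?c j * om (2*n+1-j) j = - (of_nat n + 1/2 - of_nat j) * of_nat j"
      using assms gm_nz[of n j] zdot by (simp only: om_flip) (simp add: field_simps)
    moreover have "?c (2*n+2-j) * om (2*n+1-j) j = (of_nat n + 3/2 - of_nat j) * of_nat j"
    proof -
      obtain m where m: "j = Suc m" using False by (cases j) auto
      have g: "gm n (2*n+2-j) = - gm n m" using gm_flip[of m n] assms m by simp
      have X: "of_nat (2*n+2-j) = (of_nat (2*n+1) - of_nat m :: complex)"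
        using assms m by (simp add: of_nat_diff)
      \<comment> \<open>The coefficient has \<open>gm n m\<close> in its denominator, whereas the
        contraction supplies \<open>gm n j\<close>; this relation lets them cancel up to the factor
        \<open>of_nat j\<close>.\<close>
      have g': "of_nat j * gm n m = - (of_nat (2*n+1) - of_nat m) * gm n j"
        using gm_Suc[of m n] assms m by simp
      have "?c (2*n+2-j) * om (2*n+1-j) j
        = (of_nat n + 1/2 - (of_nat (2*n+1) - of_nat m)) * (of_nat (2*n+1) - of_nat m) * gm n j / gm n m"
        unfolding om_flip[OF assms(1)] g X using zdot gm_nz[of n] by (simp add: field_simps)
      also have "\<dots> = (of_nat n + 1/2 - (of_nat (2*n+1) - of_nat m)) * (- of_nat j)"
      proof -
        have "(of_nat (2*n+1) - of_nat m) * gm n j = - of_nat j * gm n m"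
          using g' by (simp only: mult_minus_left minus_minus)
        then have "(of_nat (2*n+1) - of_nat m) * gm n j / gm n m = - of_nat j"
          using gm_nz[of n m] by (metis nonzero_mult_div_cancel_right)
        moreover have "x * y * z / w = x * (y * z / w)" for x y z w :: complex by simp
        ultimately show ?thesis by (simp only:)
      qed
      also have "\<dots> = (of_nat n + 3/2 - of_nat j) * of_nat j"
        using m by (simp add: field_simps)
      finally show ?thesis .
    qed
    ultimately have "?A + ?B = vsc (- (of_nat n + 1/2 - of_nat j) * of_nat j + (of_nat n + 3/2 - of_nat j) * of_nat j) (p (j - 1) v)"
      by (simp only: vs.scale_left_distrib)
    also have "- (of_nat n + 1/2 - of_nat j) * of_nat j + (of_nat n + 3/2 - of_nat j) * of_nat j = (of_nat j :: complex)"
      by (simp add: field_simps)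
    finally show ?thesis .
  qed
  moreover have "Phi n zdot p E (p j v) - p j (Phi n zdot p E v) - (?A + ?B) \<in> J"
    unfolding Phi_def gen.case by (rule quad_ad_p) (use assms in auto)
  ultimately show ?thesis by simp
qed

text \<open>The surviving contractions are at \<open>k = j+1\<close> and \<open>k = 2*n+1-j\<close>,
  with contributions -(l-1-j)(2l-j) and (l-j)(2l-j).\<close>

lemma Phi_F_p:
  assumes "j \<le> 2*n+1" "v \<in> V"
  shows "Phi n zdot p F (p j v) - p j (Phi n zdot p F v) - vsc (of_nat (2*n+1) - of_nat j) (p (j + 1) v) \<in> J"
proof -
  let ?c = "\<lambda>k. - (of_nat n + 1/2 - of_nat k) * of_nat k / (gm n k * zdot)"
  let ?A = "\<Sum>k\<in>{1..2*n+1}. vsc (?c k * om (2*n+2-k) j) (p k v)"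
  let ?B = "\<Sum>k\<in>{1..2*n+1}. vsc (?c k * om k j) (p (2*n+2-k) v)"
  have "?A + ?B = vsc (of_nat (2*n+1) - of_nat j) (p (j + 1) v)"
  proof (cases "j = 2*n+1")
    case True
    then have "?A = 0" "?B = 0" by (auto simp: om_def intro!: sum.neutral)
    then show ?thesis using True by simp
  next
    case False
    have "?A = vsc (?c (j+1) * om (2*n+1-j) j) (p (j + 1) v)"
      using False assms by (subst sum_single[of _ "j+1"]) (auto simp: om_def)
    moreover have "?B = vsc (?c (2*n+1-j) * om (2*n+1-j) j) (p (j + 1) v)"
      using False assms by (subst sum_single[of _ "2*n+1-j"]) (auto simp: om_def)
    moreover have "?c (j+1) * om (2*n+1-j) j = - (of_nat n - 1/2 - of_nat j) * (of_nat (2*n+1) - of_nat j)"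
    proof -
      have g': "of_nat (j + 1) * gm n j = - (of_nat (2*n+1) - of_nat j) * gm n (j + 1)"
        using gm_Suc[of j n] assms False by simp
      have "?c (j+1) * om (2*n+1-j) j = (of_nat n - 1/2 - of_nat j) * (of_nat (j + 1) * gm n j) / gm n (j + 1)"
        using assms zdot gm_nz[of n] by (simp only: om_flip) (simp add: field_simps)
      also have "\<dots> = - (of_nat n - 1/2 - of_nat j) * (of_nat (2*n+1) - of_nat j)"
        unfolding g' using gm_nz[of n "j+1"] by (simp add: field_simps)
      finally show ?thesis .
    qed
    moreover have "?c (2*n+1-j) * om (2*n+1-j) j = (of_nat n + 1/2 - of_nat j) * (of_nat (2*n+1) - of_nat j)"
      using assms gm_nz[of n "2*n+1-j"] zdot by (simp add: om_def of_nat_diff field_simps)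
    ultimately have "?A + ?B = vsc (- (of_nat n - 1/2 - of_nat j) * (of_nat (2*n+1) - of_nat j)
        + (of_nat n + 1/2 - of_nat j) * (of_nat (2*n+1) - of_nat j)) (p (j + 1) v)"
      by (simp only: vs.scale_left_distrib)
    also have "- (of_nat n - 1/2 - of_nat j) * (of_nat (2*n+1) - of_nat j)
        + (of_nat n + 1/2 - of_nat j) * (of_nat (2*n+1) - of_nat j) = (of_nat (2*n+1) - of_nat j :: complex)"
      by (simp add: field_simps)
    finally show ?thesis .
  qed
  moreover have "Phi n zdot p F (p j v) - p j (Phi n zdot p F v) - (?A + ?B) \<in> J"
    unfolding Phi_def gen.case by (rule quad_ad_p) (use assms in auto)
  ultimately show ?thesis by simp
qed

text \<open>Every summand is a creator times an annihilator, so exactly one contraction is nonzero: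
  with the creator if \<open>j \<le> n\<close>, with the annihilator otherwise. The additive
  constant of Phi h is invisible in a commutator.\<close>

lemma Phi_H_p:
  assumes "j \<le> 2*n+1" "v \<in> V"
  shows "Phi n zdot p H (p j v) - p j (Phi n zdot p H v) - vsc (2 * (of_nat n + 1/2 - of_nat j)) (p j v) \<in> J"
proof -
  let ?c = "\<lambda>k. - 2 * (of_nat n + 1/2 - of_nat k) / (gm n k * zdot)"
  let ?A = "\<Sum>k\<in>{0..n}. vsc (?c k * om k j) (p (2*n+1-k) v)"
  let ?B = "\<Sum>k\<in>{0..n}. vsc (?c k * om (2*n+1-k) j) (p k v)"
  let ?q = "quad p {0..n} ?c (\<lambda>k. 2*n+1-k) (\<lambda>k. k)"
  have eq: "?A + ?B = vsc (2 * (of_nat n + 1/2 - of_nat j)) (p j v)"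
  proof (cases "j \<le> n")
    case True
    have "?A = 0" using True by (auto simp: om_def intro!: sum.neutral)
    moreover have "?B = vsc (?c j * om (2*n+1-j) j) (p j v)"
      using True by (intro sum_single) (auto simp: om_def)
    moreover have "?c j * om (2*n+1-j) j = 2 * (of_nat n + 1/2 - of_nat j)"
      using assms gm_nz[of n j] zdot by (simp only: om_flip) (simp add: field_simps)
    ultimately show ?thesis by simp
  next
    case False
    have "?B = 0" using False by (auto simp: om_def intro!: sum.neutral)
    moreover have "?A = vsc (?c (2*n+1-j) * om (2*n+1-j) j) (p j v)"
      using False assms by (subst sum_single[of _ "2*n+1-j"]) (auto simp: om_def)
    moreover have "?c (2*n+1-j) * om (2*n+1-j) j = 2 * (of_nat n + 1/2 - of_nat j)"
      using assms gm_nz[of n "2*n+1-j"] zdot by (simp add: om_def of_nat_diff field_simps)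
    ultimately show ?thesis by simp
  qed
  have "?q (p j v) - p j (?q v) - (?A + ?B) \<in> J"
    by (rule quad_ad_p) (use assms in auto)
  then have 1: "?q (p j v) - p j (?q v) - vsc (2 * (of_nat n + 1/2 - of_nat j)) (p j v) \<in> J"
    by (simp only: eq)
  have "?q v \<in> V" using assms by (intro opr_V[OF opr_quad]) auto
  then have 2: "p j (?q v - vsc ((of_nat n + 1) ^ 2 / 2) v) = p j (?q v) - vsc ((of_nat n + 1) ^ 2 / 2) (p j v)"
    using assms by (simp only: p_diff p_vsc V_closed)
  have "a - b - c \<in> J \<Longrightarrow> (a - s) - (b - s) - c \<in> J" for a b c s by simp
  from this[OF 1] show ?thesis unfolding Phi_def gen.case 2 .
qed

lemma Phi_p:
  assumes "a \<in> GS" "j \<le> 2*n+1" "v \<in> V"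
  shows "Phi n zdot p a (p j v) - p j (Phi n zdot p a v) - vsc (wt n a j) (p (sh a j) v) \<in> J"
  using assms Phi_E_p Phi_F_p Phi_H_p by (auto simp: GS_def)

text \<open>Each summand \<open>p_{k-1} p_{2l-k}\<close> is an eigenvector of ad h with eigenvalue
  2(l-k+1) + 2(k-l) = 2.\<close>

lemma Phi_HE:
  assumes "v \<in> V"
  shows "Phi n zdot p H (Phi n zdot p E v) - Phi n zdot p E (Phi n zdot p H v) - vsc 2 (Phi n zdot p E v) \<in> J"
proof -
  let ?c = "\<lambda>k. (of_nat n + 1/2 - of_nat k) * of_nat k / (gm n k * zdot)"
  let ?R = "\<Sum>k\<in>{1..2*n+1}. vsc (?c k) (vsc (wt n H (k - 1)) (p (sh H (k - 1)) (p (2*n+1-k) v))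
      + vsc (wt n H (2*n+1-k)) (p (k - 1) (p (sh H (2*n+1-k)) v)))"
  have "Phi n zdot p H (quad p {1..2*n+1} ?c (\<lambda>k. k - 1) (\<lambda>k. 2*n+1-k) v)
      - quad p {1..2*n+1} ?c (\<lambda>k. k - 1) (\<lambda>k. 2*n+1-k) (Phi n zdot p H v) - ?R \<in> J"
    by (rule ad_quad[OF opr_Phi Phi_p]) (use assms in \<open>auto simp: GS_def\<close>)
  moreover have "?R = vsc 2 (quad p {1..2*n+1} ?c (\<lambda>k. k - 1) (\<lambda>k. 2*n+1-k) v)"
    unfolding quad_def vs.scale_sum_right
  proof (rule sum.cong[OF refl])
    fix k assume k: "k \<in> {1..2*n+1}"
    then have "wt n H (k - 1) + wt n H (2*n+1-k) = 2" by (simp add: of_nat_diff algebra_simps)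
    then show "vsc (?c k) (vsc (wt n H (k - 1)) (p (sh H (k - 1)) (p (2*n+1-k) v))
      + vsc (wt n H (2*n+1-k)) (p (k - 1) (p (sh H (2*n+1-k)) v))) = vsc 2 (vsc (?c k) (p (k - 1) (p (2*n+1-k) v)))"
      by (simp only: sh.simps vs.scale_left_distrib[symmetric] vs.scale_scale) (simp add: mult.commute)
  qed
  ultimately show ?thesis by (simp add: Phi_def[of _ _ _ E])
qed

lemma Phi_HF:
  assumes "v \<in> V"
  shows "Phi n zdot p H (Phi n zdot p F v) - Phi n zdot p F (Phi n zdot p H v) - vsc (-2) (Phi n zdot p F v) \<in> J"
proof -
  let ?c = "\<lambda>k. - (of_nat n + 1/2 - of_nat k) * of_nat k / (gm n k * zdot)"
  let ?R = "\<Sum>k\<in>{1..2*n+1}. vsc (?c k) (vsc (wt n H k) (p (sh H k) (p (2*n+2-k) v))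
      + vsc (wt n H (2*n+2-k)) (p k (p (sh H (2*n+2-k)) v)))"
  have "Phi n zdot p H (quad p {1..2*n+1} ?c (\<lambda>k. k) (\<lambda>k. 2*n+2-k) v)
      - quad p {1..2*n+1} ?c (\<lambda>k. k) (\<lambda>k. 2*n+2-k) (Phi n zdot p H v) - ?R \<in> J"
    by (rule ad_quad[OF opr_Phi Phi_p]) (use assms in \<open>auto simp: GS_def\<close>)
  moreover have "?R = vsc (-2) (quad p {1..2*n+1} ?c (\<lambda>k. k) (\<lambda>k. 2*n+2-k) v)"
    unfolding quad_def vs.scale_sum_right
  proof (rule sum.cong[OF refl])
    fix k assume k: "k \<in> {1..2*n+1}"
    then have "wt n H k + wt n H (2*n+2-k) = -2" by (simp add: of_nat_diff algebra_simps)
    then show "vsc (?c k) (vsc (wt n H k) (p (sh H k) (p (2*n+2-k) v))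
      + vsc (wt n H (2*n+2-k)) (p k (p (sh H (2*n+2-k)) v))) = vsc (-2) (vsc (?c k) (p k (p (2*n+2-k) v)))"
      by (simp only: sh.simps vs.scale_left_distrib[symmetric] vs.scale_scale) (simp add: mult.commute)
  qed
  ultimately show ?thesis by (simp add: Phi_def[of _ _ _ F])
qed

text \<open>ad of Phi e turns Phi f into a combination of the products
  \<open>q k = p_k p_{2l-k}\<close> over all k. Pairing k with 2l-k and replacing
  \<open>q k\<close>, for k <= n, by the normally ordered \<open>q (2*n+1-k)\<close> plus a scalar
  gives the quadratic part of Phi h and, as constant, the sum of \<open>h k\<close> over k <=
  n.\<close>

lemma Phi_EF:
  assumes v: "v \<in> V"
  shows "Phi n zdot p E (Phi n zdot p F v) - Phi n zdot p F (Phi n zdot p E v) - Phi n zdot p H v \<in> J"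
proof -
  let ?l = "\<lambda>k. of_nat n + 1/2 - of_nat k :: complex"
  let ?c = "\<lambda>k. - ?l k * of_nat k / (gm n k * zdot)"
  let ?Q = "quad p {1..2*n+1} ?c (\<lambda>k. k) (\<lambda>k. 2*n+2-k)"
  define q where "q k = p k (p (2*n+1-k) v)" for k
  \<comment> \<open>\<open>h k / (gm n k * zdot)\<close> is the total coefficient of
    \<open>q k\<close>: the first product comes from e acting on the left factor, after an index
    shift, and the second from e acting on the right factor.\<close>
  define h :: "nat \<Rightarrow> complex" where "h k = (of_nat n - 1/2 - of_nat k) * (of_nat k + 1) * (of_nat (2*n+1) - of_nat k)
     - ?l k * of_nat k * (of_nat (2*n+2) - of_nat k)" for k
  let ?R = "\<Sum>k\<in>{1..2*n+1}. vsc (?c k) (vsc (wt n E k) (p (sh E k) (p (2*n+2-k) v))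
      + vsc (wt n E (2*n+2-k)) (p k (p (sh E (2*n+2-k)) v)))"
  have "Phi n zdot p E (?Q v) - ?Q (Phi n zdot p E v) - ?R \<in> J"
    by (rule ad_quad[OF opr_Phi Phi_p]) (use v in \<open>auto simp: GS_def\<close>)
  then have 1: "Phi n zdot p E (Phi n zdot p F v) - Phi n zdot p F (Phi n zdot p E v) - ?R \<in> J"
    by (simp add: Phi_def[of _ _ _ F])
  let ?h1 = "\<lambda>k. (of_nat n - 1/2 - of_nat k) * (of_nat k + 1) * (of_nat (2*n+1) - of_nat k) / (gm n k * zdot)"
  let ?h2 = "\<lambda>k. ?l k * of_nat k * (of_nat (2*n+2) - of_nat k) / (gm n k * zdot)"
  have "?R = (\<Sum>k\<in>{1..2*n+1}. vsc (?c k * of_nat k) (q (k - 1))) + (\<Sum>k\<in>{1..2*n+1}. vsc (- ?h2 k) (q k))"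
    unfolding sum.distrib[symmetric]
  proof (rule sum.cong[OF refl])
    fix k assume k: "k \<in> {1..2*n+1}"
    then have e: "2*n+2-k = 2*n+1-(k-1)" "2*n+2-k-1 = 2*n+1-k" by auto
    have w: "wt n E (2*n+2-k) = of_nat (2*n+2) - of_nat k" using k by (simp add: of_nat_diff)
    have "- a * b / d * e = - (a * b * e / d)" for a b d e :: complex by simp
    then have "?c k * (of_nat (2*n+2) - of_nat k) = - ?h2 k" .
    then show "vsc (?c k) (vsc (wt n E k) (p (sh E k) (p (2*n+2-k) v))
      + vsc (wt n E (2*n+2-k)) (p k (p (sh E (2*n+2-k)) v)))
      = vsc (?c k * of_nat k) (q (k - 1)) + vsc (- ?h2 k) (q k)"
      unfolding w sh.simps e(2) q_def e(1)[symmetric] vs.scale_right_distrib vs.scale_scale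
      by (simp only: wt.simps)
  qed
  \<comment> \<open>The shift brings the index to 0..2n; the term \<open>k = 2*n+1\<close> can be
    added because its factor \<open>of_nat (2*n+1) - of_nat k\<close> is zero. \<open>gm_Suc\<close>
    adapts the denominators.\<close>
  also have "(\<Sum>k\<in>{1..2*n+1}. vsc (?c k * of_nat k) (q (k - 1))) = (\<Sum>k\<in>{0..2*n+1}. vsc (?h1 k) (q k))"
  proof -
    have "(\<Sum>k\<in>{1..2*n+1}. vsc (?c k * of_nat k) (q (k - 1))) = (\<Sum>k\<in>{0..2*n}. vsc (?h1 k) (q k))"
    proof (rule sum.reindex_bij_witness[of _ Suc "\<lambda>k. k - 1"])
      fix k assume k: "k \<in> {1..2*n+1}"
      then obtain m where m: "k = Suc m" "m \<le> 2*n" by (cases k) auto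
      have "of_nat k / gm n k = - (of_nat (2*n+1) - of_nat m) / gm n m"
        using gm_Suc[OF m(2)] gm_nz[of n m] gm_nz[of n k] m(1) by (simp add: frac_eq_eq mult.commute)
      moreover have "x / (g * z) * y = x * (y / g) / z" for x y g z :: complex by simp
      ultimately have "?c k * of_nat k = - ?l k * of_nat k * (- (of_nat (2*n+1) - of_nat m) / gm n m) / zdot"
        by (simp only:)
      also have "\<dots> = ?h1 (k - 1)"
      proof -
        have k': "of_nat k = (of_nat m + 1 :: complex)" "k - 1 = m" "of_nat n + 1/2 - (of_nat m + 1) = (of_nat n - 1/2 - of_nat m :: complex)"
          using m(1) by simp_all
        have "- x * y * (- w / g) / z = x * y * w / (g * z)" for x y w g z :: complex by simp
        then show ?thesis unfolding k' .
      qed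
      finally have "?c k * of_nat k = ?h1 (k - 1)" .
      then show "vsc (?h1 (k - 1)) (q (k - 1)) = vsc (?c k * of_nat k) (q (k - 1))" by (simp only:)
    qed auto
    then show ?thesis by simp
  qed
  also have "(\<Sum>k\<in>{1..2*n+1}. vsc (- ?h2 k) (q k)) = (\<Sum>k\<in>{0..2*n+1}. vsc (- ?h2 k) (q k))"
    by (simp add: sum.atLeast_Suc_atMost[of 0])
  also have "(\<Sum>k\<in>{0..2*n+1}. vsc (?h1 k) (q k)) + \<dots> = (\<Sum>k\<in>{0..2*n+1}. vsc (h k / (gm n k * zdot)) (q k))"
    unfolding sum.distrib[symmetric] vs.scale_left_distrib[symmetric] h_def
    by (simp only: diff_divide_distrib add_uminus_conv_diff)
  also have "\<dots> = (\<Sum>k\<in>{0..n}. vsc (h k / (gm n k * zdot)) (q k))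
       + (\<Sum>k\<in>{n+1..2*n+1}. vsc (h k / (gm n k * zdot)) (q k))"
  proof -
    have "{0..2*n+1} = {0..n} \<union> {n+1..2*n+1}" by auto
    then show ?thesis by (simp only:) (rule sum.union_disjoint, auto)
  qed
  also have "(\<Sum>k\<in>{n+1..2*n+1}. vsc (h k / (gm n k * zdot)) (q k))
     = (\<Sum>k\<in>{0..n}. vsc (- h (2*n+1-k) / (gm n k * zdot)) (q (2*n+1-k)))"
  proof (rule sum.reindex_bij_witness[of _ "\<lambda>k. 2*n+1-k" "\<lambda>k. 2*n+1-k"])
    fix k assume k: "k \<in> {n+1..2*n+1}"
    then have "2*n+1-(2*n+1-k) = k" "gm n (2*n+1-k) = - gm n k" using gm_flip by auto
    then show "vsc (- h (2*n+1-(2*n+1-k)) / (gm n (2*n+1-k) * zdot)) (q (2*n+1-(2*n+1-k)))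
       = vsc (h k / (gm n k * zdot)) (q k)" by simp
  qed auto
  finally have R: "?R = (\<Sum>k\<in>{0..n}. vsc (h k / (gm n k * zdot)) (q k))
     + (\<Sum>k\<in>{0..n}. vsc (- h (2*n+1-k) / (gm n k * zdot)) (q (2*n+1-k)))" .
  have H: "Phi n zdot p H v = (\<Sum>k\<in>{0..n}. vsc (- 2 * ?l k / (gm n k * zdot)) (q (2*n+1-k)))
      + (\<Sum>k\<in>{0..n}. vsc (h k) v)"
  proof -
    have "(\<Sum>k\<in>{0..n}. vsc (h k) v) = vsc (- ((of_nat n + 1) ^ 2 / 2)) v"
      by (simp only: vs.scale_sum_left[symmetric] h_def sum_central_charge)
    moreover have "p (2*n+1-k) (p k v) = q (2*n+1-k)" if "k \<in> {0..n}" for k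
      using that by (simp add: q_def)
    ultimately show ?thesis by (simp add: Phi_def quad_def)
  qed
  \<comment> \<open>The difference collects into commutators of \<open>p_k\<close> with
    \<open>p_{2l-k}\<close>, weighted by \<open>h k\<close>; this rests on
    \<open>h k - h (2*n+1-k)\<close> being -2(l-k), the numerator in Phi h.\<close>
  have "?R - Phi n zdot p H v = (\<Sum>k\<in>{0..n}. vsc (h k / (gm n k * zdot)) (q k - q (2*n+1-k) - vsc (gm n k * zdot) v))"
  proof -
    have "vsc (h k / (gm n k * zdot)) (q k - q (2*n+1-k) - vsc (gm n k * zdot) v)
       = vsc (h k / (gm n k * zdot)) (q k) + vsc (- h (2*n+1-k) / (gm n k * zdot)) (q (2*n+1-k))
         - (vsc (- 2 * ?l k / (gm n k * zdot)) (q (2*n+1-k)) + vsc (h k) v)" if "k \<in> {0..n}" for k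
    proof -
      have "h k - h (2*n+1-k) = - 2 * ?l k"
        using that by (simp add: h_def of_nat_diff field_simps)
      then have "- h (2*n+1-k) / (gm n k * zdot) - - 2 * ?l k / (gm n k * zdot) = - h k / (gm n k * zdot)"
        by (simp add: diff_divide_distrib[symmetric] add_divide_distrib[symmetric] algebra_simps)
      then have "- h (2*n+1-k) / (gm n k * zdot) = - 2 * ?l k / (gm n k * zdot) + - h k / (gm n k * zdot)"
        by (simp only: diff_eq_eq add.commute)
      then have "vsc (- h (2*n+1-k) / (gm n k * zdot)) (q (2*n+1-k))
          = vsc (- 2 * ?l k / (gm n k * zdot)) (q (2*n+1-k)) + vsc (- h k / (gm n k * zdot)) (q (2*n+1-k))"
        by (simp only: vs.scale_left_distrib)
      moreover have "h k / (gm n k * zdot) * (gm n k * zdot) = h k" using zdot gm_nz by simp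
      ultimately show ?thesis by (simp add: vs.scale_right_diff_distrib)
    qed
    then show ?thesis unfolding R H
      by (simp add: sum.distrib[symmetric] sum_subtractf[symmetric])
  qed
  also have "\<dots> \<in> J"
  proof (intro J_sum J_closed(3))
    fix k assume "k \<in> {0..n}"
    then show "q k - q (2*n+1-k) - vsc (gm n k * zdot) v \<in> J"
      using comm[of k "2*n+1-k" v] v by (simp add: q_def)
  qed
  finally show ?thesis using J_trans[OF 1] by blast
qed

lemma Phi_brk:
  assumes "a \<in> GS" "b \<in> GS" "v \<in> V"
  shows "Phi n zdot p a (Phi n zdot p b v) - Phi n zdot p b (Phi n zdot p a v) - run (Phi n zdot p) v (brk n a b) \<in> J"
proof -
  have "\<And>w. w \<in> J \<Longrightarrow> - w \<in> J" using J_closed(3)[of _ "-1"] by simp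
  then have neg: "x - y - z \<in> J \<Longrightarrow> y - x + z \<in> J" for x y z
    by (metis add_diff_eq minus_diff_eq diff_diff_eq2 add.commute)
  have 0: "0 \<in> J" by (rule vs.subspace_0[OF subJ])
  note * = Phi_HE[OF assms(3)] Phi_HF[OF assms(3)] Phi_EF[OF assms(3)]
  consider "a = b" | "a = H" "b = E" | "a = H" "b = F" | "a = E" "b = F"
    | "a = E" "b = H" | "a = F" "b = H" | "a = F" "b = E"
    using assms(1,2) by (auto simp: GS_def)
  then show ?thesis
  proof cases
    case 1
    then have "brk n a b = 0" using assms(1) by (auto simp: GS_def vzero_eq)
    then show ?thesis using 1 0 by simp
  qed (use * neg[OF *(1)] neg[OF *(2)] neg[OF *(3)] in simp_all)
qed

text \<open>The indices in \<open>p_{k-1} p_{2l-k}\<close> add up to 2n, so the two factors commute,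
  and at least one of them is an annihilator that can be put on the right.\<close>

lemma Phi_E_vacuum:
  assumes v: "v \<in> V" and vac: "\<And>k. k \<le> n \<Longrightarrow> p k v \<in> J"
  shows "Phi n zdot p E v \<in> J"
  unfolding Phi_def gen.case quad_def
proof (intro J_sum J_closed(3))
  fix k assume k: "k \<in> {1..2*n+1}"
  show "p (k - 1) (p (2*n+1-k) v) \<in> J"
  proof (cases "2*n+1-k \<le> n")
    case False
    then have "p (k - 1) (p (2*n+1-k) v) - p (2*n+1-k) (p (k - 1) v) \<in> J"
      using k comm[of "k - 1" "2*n+1-k" v] v by simp
    moreover have "p (2*n+1-k) (p (k - 1) v) \<in> J" using False k vac[of "k - 1"] by simp
    ultimately show ?thesis using J_closed(1) by fastforce
  qed (use k vac in auto)
qed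

text \<open>Phi h is normally ordered, so only its additive constant survives on the vacuum. This is
  the weight that \<open>mu\<close> compensates.\<close>

lemma Phi_H_vacuum:
  assumes "\<And>k. k \<le> n \<Longrightarrow> p k v \<in> J"
  shows "Phi n zdot p H v - vsc (- ((of_nat n + 1) ^ 2 / 2)) v \<in> J"
proof -
  have "quad p {0..n} c (\<lambda>k. 2*n+1-k) (\<lambda>k. k) v \<in> J" for c
    unfolding quad_def using assms by (intro J_sum J_closed(3)) simp
  then show ?thesis by (simp add: Phi_def)
qed

end

section \<open>The modules as representations modulo a subspace\<close>

text \<open>A pair \<open>(x, c)\<close> prescribes that \<open>x\<close> acts on the generating
  vector by \<open>c\<close>.\<close>

definition CH :: "nat \<Rightarrow> complex \<Rightarrow> (gen \<times> complex) set" where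
  "CH n zdot = insert (Z, zdot) ((\<lambda>k. (P k, 0)) ` {..n})"

definition CG :: "nat \<Rightarrow> complex \<Rightarrow> complex \<Rightarrow> (gen \<times> complex) set" where
  "CG n zdot hdot = {(E, 0), (H, hdot)} \<union> CH n zdot"

definition CS :: "complex \<Rightarrow> (gen \<times> complex) set" where
  "CS mu = {(E, 0), (H, mu)}"

lemma CH_sub: "fst ` CH n zdot \<subseteq> GH n"
  by (auto simp: CH_def GH_def)

lemma CG_sub: "fst ` CG n zdot hdot \<subseteq> Gl n"
  by (auto simp: CG_def CH_def Gl_def)

lemma CS_sub: "fst ` CS mu \<subseteq> GS"
  by (auto simp: CS_def GS_def)

lemma Mg_eq: "Mg n zdot hdot = (lists (Gl n), pideal n (Gl n) (CG n zdot hdot), lmul)"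
  unfolding Mg_def pideal_def cspan_eq
  by (intro arg_cong2[where f = Pair] arg_cong[where f = vs.span] refl)
    (auto simp: anns_def CG_def CH_def)

lemma phi_eq:
  "phiE n zdot = Phi n zdot (\<lambda>k. lmul (P k)) E" "phiF n zdot = Phi n zdot (\<lambda>k. lmul (P k)) F"
  "phiH n zdot = Phi n zdot (\<lambda>k. lmul (P k)) H"
proof -
  \<comment> \<open>A sign is its own inverse, so the sign in the numerator can be absorbed into the
    denominator \<open>gm\<close>.\<close>
  have sg: "1 / (-1 :: complex) ^ m = (-1) ^ m" for m
    by (cases "even m") auto
  have c: "(-1) ^ (k + n + 1) * x / of_nat (fact (k - 1) * fact (2*n+1-k)) = x * of_nat k / gm n k"
    if k: "k \<in> {1..2*n+1}" for k x
  proof -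
    obtain m where m: "k = Suc m" using k by (cases k) auto
    have "x * of_nat k / gm n k = 1 / (-1) ^ (k + n + 1) * (x * of_nat k / of_nat (fact k * fact (2*n+1-k)))"
      by (simp add: gm_def)
    also have "of_nat (fact k * fact (2*n+1-k)) = of_nat k * (of_nat (fact (k - 1) * fact (2*n+1-k)) :: complex)"
      unfolding m by (simp add: algebra_simps)
    finally show ?thesis unfolding sg using m by (simp del: of_nat_Suc of_nat_mult)
  qed
  have d: "(-1) ^ (k + n) * x / of_nat (fact k * fact (2*n+1-k)) = - x / gm n k" for k x
  proof -
    have "- x / gm n k = - (1 / (-1) ^ (k + n + 1)) * (x / of_nat (fact k * fact (2*n+1-k)))"
      by (simp add: gm_def)
    then show ?thesis unfolding sg by simp
  qed
  show "phiE n zdot = Phi n zdot (\<lambda>k. lmul (P k)) E"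
    unfolding phiE_def Phi_def gen.case quad_def
    by (intro ext, unfold sum_fun_apply sum_distrib_left, rule sum.cong[OF refl], subst c)
       (auto simp: vsc_apply)
  show "phiF n zdot = Phi n zdot (\<lambda>k. lmul (P k)) F"
    unfolding phiF_def Phi_def gen.case quad_def
  proof (intro ext, unfold sum_fun_apply sum_distrib_left, rule sum.cong[OF refl])
    fix v w k assume "k \<in> {1..2*n+1}"
    have s: "(- 1) ^ (k + n + 1) * (- y) = (- 1) ^ (k + n) * y" for y :: complex by simp
    from c[OF \<open>k \<in> _\<close>, of "- (of_nat n + 1/2 - of_nat k)"]
    have "(- 1) ^ (k + n) * (of_nat n + 1/2 - of_nat k) / of_nat (fact (k - 1) * fact (2*n+1-k))
        = - (of_nat n + 1/2 - of_nat k) * of_nat k / gm n k"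
      unfolding s .
    then show "1 / zdot * ((- 1) ^ (k + n) * (of_nat n + 1/2 - of_nat k) / of_nat (fact (k - 1) * fact (2*n+1-k))
         * lmul (P k) (lmul (P (2*n+2-k)) v) w)
       = vsc (- (of_nat n + 1/2 - of_nat k) * of_nat k / (gm n k * zdot)) (lmul (P k) (lmul (P (2*n+2-k)) v)) w"
      by (simp only:) (simp add: vsc_apply)
  qed
  show "phiH n zdot = Phi n zdot (\<lambda>k. lmul (P k)) H"
    unfolding phiH_def Phi_def gen.case quad_def d
  proof (intro ext, unfold minus_fun_apply vsc_apply sum_fun_apply sum_distrib_left, intro arg_cong2[where f = "(-)"] refl sum.cong)
    have "2 / z * (- x / g * y) = (- 2 * x / (g * z)) * y" for x y z g :: complex
      by (simp add: mult.commute mult.left_commute)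
    then show "2 / zdot * (- (of_nat n + 1/2 - of_nat k) / gm n k * lmul (P (2*n+1-k)) (lmul (P k) v) w)
      = - 2 * (of_nat n + 1/2 - of_nat k) / (gm n k * zdot) * lmul (P (2*n+1-k)) (lmul (P k) v) w" for v w k .
  qed
qed

definition ghat :: "nat \<Rightarrow> complex \<Rightarrow> (gen \<Rightarrow> 'b vec \<Rightarrow> 'b vec) \<Rightarrow> gen \<Rightarrow> 'b vec \<Rightarrow> 'b vec" where
  "ghat n zdot \<rho> a = (if a \<in> GS then Phi n zdot (\<lambda>k. \<rho> (P k)) a else \<rho> a)"

lemma actHg_eq: "actHg n zdot = ghat n zdot lmul"
  by (auto simp: actHg_def ghat_def fun_eq_iff phi_eq GS_def split: gen.splits)

lemma MHg_eq: "MHg n zdot = (lists (GH n), pideal n (GH n) (CH n zdot), ghat n zdot lmul)"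
  unfolding MHg_def pideal_def cspan_eq actHg_eq
  by (intro arg_cong2[where f = Pair] arg_cong[where f = vs.span] refl)
    (auto simp: anns_def CH_def)

definition gS :: "gen \<Rightarrow> gen list vec \<Rightarrow> gen list vec" where
  "gS a v = (if a \<in> GS then lmul a v else 0)"

lemma Msl2g_eq: "Msl2g mu = (lists GS, pideal 0 GS (CS mu), gS)"
  unfolding Msl2g_def pideal_def cspan_eq
  by (intro arg_cong2[where f = Pair] arg_cong[where f = vs.span] refl)
    (auto simp: anns_def CS_def gS_def vzero_eq fun_eq_iff)

lemma repD:
  assumes "rep n A V J \<rho>"
  shows "vs.subspace V" "vs.subspace J" "J \<subseteq> V" "\<forall>a\<in>A. opr V J (\<rho> a)"
    "\<And>a b v. a \<in> A \<Longrightarrow> b \<in> A \<Longrightarrow> v \<in> V \<Longrightarrow> \<rho> a (\<rho> b v) - \<rho> b (\<rho> a v) - run \<rho> v (brk n a b) \<in> J"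
  using assms by (auto simp: rep_def)

lemma Gl_cases: "a \<in> Gl n \<Longrightarrow> (a \<in> GS \<Longrightarrow> R) \<Longrightarrow> (\<And>k. a = P k \<Longrightarrow> k \<le> 2*n+1 \<Longrightarrow> R) \<Longrightarrow> (a = Z \<Longrightarrow> R) \<Longrightarrow> R"
  by (auto simp: Gl_def GS_def)

lemma Gl_iff: "a \<in> Gl n \<longleftrightarrow> a \<in> GS \<or> (\<exists>k\<le>2*n+1. a = P k) \<or> a = Z"
  by (auto simp: Gl_def GS_def)

lemma GS_Gl: "a \<in> GS \<Longrightarrow> a \<in> Gl n" and GH_Gl: "a \<in> GH n \<Longrightarrow> a \<in> Gl n"
  by (auto simp: Gl_def GS_def GH_def)

lemma P_GH [simp]: "P k \<in> GH n \<longleftrightarrow> k \<le> 2*n+1" and P_Gl [simp]: "P k \<in> Gl n \<longleftrightarrow> k \<le> 2*n+1"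
  and Z_GH [simp]: "Z \<in> GH n" and Z_Gl [simp]: "Z \<in> Gl n"
  and P_GS [simp]: "P k \<notin> GS" and Z_GS [simp]: "Z \<notin> GS"
  by (auto simp: Gl_def GH_def GS_def)

lemma heis_rep:
  assumes rep: "rep n A V J \<rho>" and "GH n \<subseteq> A" "zdot \<noteq> 0"
    and Zs: "\<And>v. v \<in> V \<Longrightarrow> \<rho> Z v - vsc zdot v \<in> J"
  shows "heis n zdot V J (\<lambda>k. \<rho> (P k))"
proof
  show "opr V J (\<rho> (P k))" if "k \<le> 2*n+1" for k
    using repD(4)[OF rep] assms(2) that by force
  fix j k v assume jk: "j \<le> 2*n+1" "k \<le> 2*n+1" "v \<in> V"
  let ?c = "\<rho> (P j) (\<rho> (P k) v) - \<rho> (P k) (\<rho> (P j) v)"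
  have 1: "?c - run \<rho> v (brk n (P j) (P k)) \<in> J"
    using repD(5)[OF rep _ _ jk(3)] assms(2) jk by (meson P_GH subsetD)
  show "?c - vsc (if j + k = 2 * n + 1 then gm n j * zdot else 0) v \<in> J"
  proof (cases "j + k = 2*n+1")
    case True
    then have "?c - vsc (gm n j) (\<rho> Z v) \<in> J" using 1 by (simp add: gm_def del: of_nat_mult)
    moreover have "vsc (gm n j) (\<rho> Z v - vsc zdot v) \<in> J"
      by (intro vs.subspace_scale repD(2)[OF rep] Zs jk)
    ultimately have "?c - vsc (gm n j) (\<rho> Z v) + vsc (gm n j) (\<rho> Z v - vsc zdot v) \<in> J"
      by (intro vs.subspace_add repD(2)[OF rep])
    then show ?thesis using True by (simp add: vs.scale_right_diff_distrib algebra_simps)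
  next
    case False
    then show ?thesis using 1 by (simp add: vzero_eq)
  qed
qed (use rep assms(3) in \<open>auto simp: rep_def\<close>)

text \<open>Between two sl2 letters, and between an sl2 letter and \<open>P k\<close>, the relations
  are the commutators of Phi; those inside the Heisenberg algebra are inherited, and
  \<open>Z\<close> commutes with everything because it is a scalar modulo \<open>J\<close>.
  Antisymmetry supplies the reversed pairs.\<close>

lemma rep_ghat:
  assumes rep: "rep n (GH n) V J \<rho>" and zdot: "zdot \<noteq> 0"
    and Zs: "\<And>v. v \<in> V \<Longrightarrow> \<rho> Z v - vsc zdot v \<in> J"
  shows "rep n (Gl n) V J (ghat n zdot \<rho>)"
proof -
  interpret heis n zdot V J "\<lambda>k. \<rho> (P k)" by (rule heis_rep[OF rep _ zdot Zs]) auto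
  have J0: "0 \<in> J" by (rule vs.subspace_0[OF subJ])
  have opr: "opr V J (ghat n zdot \<rho> a)" if "a \<in> Gl n" for a
    using that by (rule Gl_cases) (use opr_Phi repD(4)[OF rep] in \<open>simp_all add: ghat_def\<close>)
  have neg: "- x \<in> J" if "x \<in> J" for x using J_closed(3)[OF that, of "-1"] by simp
  have sym: "ghat n zdot \<rho> a (ghat n zdot \<rho> b v) - ghat n zdot \<rho> b (ghat n zdot \<rho> a v) - run (ghat n zdot \<rho>) v (brk n a b) \<in> J"
    if "ghat n zdot \<rho> b (ghat n zdot \<rho> a v) - ghat n zdot \<rho> a (ghat n zdot \<rho> b v) - run (ghat n zdot \<rho>) v (brk n b a) \<in> J" for a b v
    using neg[OF that] by (simp add: brk_antisym[of n a b] algebra_simps)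
  have Zrel: "ghat n zdot \<rho> a (ghat n zdot \<rho> Z v) - ghat n zdot \<rho> Z (ghat n zdot \<rho> a v) - run (ghat n zdot \<rho>) v (brk n a Z) \<in> J"
    if "a \<in> Gl n" "v \<in> V" for a v
  proof -
    let ?X = "ghat n zdot \<rho> a"
    have X: "?X v \<in> V" "\<rho> Z v \<in> V"
      using opr_V[OF opr that(2)] opr_V[OF _ that(2), of J "\<rho> Z"] that repD(4)[OF rep] by auto
    have "?X (\<rho> Z v - vsc zdot v) \<in> J" by (rule opr_J[OF opr[OF that(1)] Zs[OF that(2)]])
    then have "?X (\<rho> Z v) - vsc zdot (?X v) \<in> J"
      using X that opr_linon[OF opr[OF that(1)]] by (simp add: linon_diff[OF _ subV] linon_scale)
    then have "?X (\<rho> Z v) - vsc zdot (?X v) - (\<rho> Z (?X v) - vsc zdot (?X v)) \<in> J"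
      by (rule J_closed(2)) (rule Zs[OF X(1)])
    moreover have "brk n a Z = 0" by (cases a) (auto simp: vzero_eq)
    ultimately show ?thesis by (simp add: ghat_def)
  qed
  have SP: "ghat n zdot \<rho> a (ghat n zdot \<rho> (P k) v) - ghat n zdot \<rho> (P k) (ghat n zdot \<rho> a v) - run (ghat n zdot \<rho>) v (brk n a (P k)) \<in> J"
    if "a \<in> GS" "k \<le> 2*n+1" "v \<in> V" for a k v
    using Phi_p[OF that] that(1) by (simp add: ghat_def brk_wt)
  have rel: "ghat n zdot \<rho> a (ghat n zdot \<rho> b v) - ghat n zdot \<rho> b (ghat n zdot \<rho> a v) - run (ghat n zdot \<rho>) v (brk n a b) \<in> J"
    if abv: "a \<in> Gl n" "b \<in> Gl n" "v \<in> V" for a b v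
  proof (cases "a = Z \<or> b = Z")
    case True
    then show ?thesis using Zrel[OF that(1,3)] sym[OF Zrel[OF that(2,3)]] by blast
  next
    case False
    then consider "a \<in> GS" "b \<in> GS" | k where "a \<in> GS" "b = P k" "k \<le> 2*n+1"
      | k where "b \<in> GS" "a = P k" "k \<le> 2*n+1" | j k where "a = P j" "b = P k" "j \<le> 2*n+1" "k \<le> 2*n+1"
      using abv(1,2) unfolding Gl_iff by blast
    then show ?thesis
    proof cases
      case 1
      then obtain c x where "x \<in> GS" "brk n a b = vsc c (dlt [x])"
        using brk_closed_GS[of n] unfolding brk_closed_def by blast
      then show ?thesis using Phi_brk[OF 1 that(3)] 1 by (simp add: ghat_def)
    next
      case 4
      then have "run (ghat n zdot \<rho>) v (brk n a b) = run \<rho> v (brk n a b)"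
        by (simp add: ghat_def vzero_eq del: of_nat_mult)
      then show ?thesis using repD(5)[OF rep, of a b v] 4 that(3) by (simp add: ghat_def)
    next
      case 2
      then show ?thesis using SP that(3) by blast
    next
      case 3
      then show ?thesis using sym[OF SP[OF 3(1,3) that(3)]] by simp
    qed
  qed
  show ?thesis unfolding rep_def using opr rel subV subJ JV by blast
qed

text \<open>\<open>Z\<close> is central modulo the Lie relations, so its eigenvalue on the
  generating vector is carried through each letter of a word.\<close>

lemma Z_scalar:
  assumes "brk_closed n A" "fst ` C \<subseteq> A" "(Z, c) \<in> C" "v \<in> fsv (lists A)"
  shows "lmul Z v - vsc c v \<in> pideal n A C"
proof (rule linon_into_fsv[OF _ _ _ assms(4)])
  note rep = rep_lmul[OF assms(1,2)]
  have Z: "Z \<in> A" using assms(2,3) by force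
  show J: "vs.subspace (pideal n A C)" by (rule repD(2)[OF rep])
  show "linon (fsv (lists A)) (\<lambda>v. lmul Z v - vsc c v)"
    by (intro linon_minus linon_lmul linon_vsc linon_id)
  fix w assume "w \<in> lists A"
  then show "lmul Z (dlt w) - vsc c (dlt w) \<in> pideal n A C"
  proof (induction w)
    case Nil
    show ?case using ann_in_pideal[OF assms(3), of "[]" A n] by simp
  next
    case (Cons a w)
    have "brk n Z a = 0" by (cases a) (auto simp: vzero_eq)
    then have 1: "dlt (Z # a # w) - dlt (a # Z # w) \<in> pideal n A C"
      using repD(5)[OF rep Z Cons.hyps(1), of "dlt w"] Cons.hyps(2) by simp
    have "lmul a (lmul Z (dlt w) - vsc c (dlt w)) \<in> pideal n A C"
      by (rule lmul_pideal[OF assms(1,2) Cons.hyps(1) Cons.IH])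
    then have 2: "dlt (a # Z # w) - vsc c (dlt (a # w)) \<in> pideal n A C"
      by (simp add: linon_diff[OF linon_lmul, where V = UNIV] linon_scale[OF linon_lmul, where V = UNIV])
    show ?case using vs.subspace_add[OF J 1 2] by simp
  qed
qed

section \<open>Tensor products\<close>

lemma tp_dlt: "tp (dlt b) (dlt c) = dlt (b, c)"
  by (auto simp: tp_def dlt_apply fun_eq_iff)

lemma linon_tp1: "linon V (\<lambda>v. tp v w)"
  by (rule linonI) (auto simp: tp_def fun_eq_iff vec_simps algebra_simps)

lemma linon_tp2: "linon V (\<lambda>w. tp v w)"
  by (rule linonI) (auto simp: tp_def fun_eq_iff vec_simps algebra_simps)

lemma tp_fsv:
  assumes "v \<in> fsv B" "w \<in> fsv C"
  shows "tp v w \<in> fsv (B \<times> C)"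
proof (rule linon_into_fsv[OF linon_tp1 subspace_fsv _ assms(1)])
  fix b assume "b \<in> B"
  then show "tp (dlt b) w \<in> fsv (B \<times> C)"
    by (intro linon_into_fsv[OF linon_tp2 subspace_fsv _ assms(2)]) (auto simp: tp_dlt)
qed

lemma tp_into:
  assumes "linon (fsv (B \<times> C)) f" "vs.subspace J" "\<And>b c. b \<in> B \<Longrightarrow> c \<in> C \<Longrightarrow> f (tp (dlt b) (dlt c)) \<in> J"
    "x \<in> fsv (B \<times> C)"
  shows "f x \<in> J"
  using assms(3) by (intro linon_into_fsv[OF assms(1,2) _ assms(4)]) (auto simp: tp_dlt)

lemma bilinear_eq:
  assumes "\<And>w. w \<in> fsv C \<Longrightarrow> linon (fsv B) (\<lambda>v. f v w)" "\<And>w. w \<in> fsv C \<Longrightarrow> linon (fsv B) (\<lambda>v. g v w)"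
    "\<And>b. b \<in> B \<Longrightarrow> linon (fsv C) (f (dlt b))" "\<And>b. b \<in> B \<Longrightarrow> linon (fsv C) (g (dlt b))"
    "\<And>b c. b \<in> B \<Longrightarrow> c \<in> C \<Longrightarrow> f (dlt b) (dlt c) = g (dlt b) (dlt c)" "v \<in> fsv B" "w \<in> fsv C"
  shows "f v w = g v w"
  by (rule linon_eq_fsv[OF assms(1)[OF assms(7)] assms(2)[OF assms(7)] _ assms(6)])
    (rule linon_eq_fsv[OF assms(3,4) assms(5) assms(7)])

lemma ext1_lext: "ext1 T = lext (\<lambda>p. tp (T (dlt (fst p))) (dlt (snd p)))"
  by (auto simp: ext1_def lext_def tp_def fun_eq_iff sum_fun_apply vsc_apply mult.assoc)

lemma ext2_lext: "ext2 T = lext (\<lambda>p. tp (dlt (fst p)) (T (dlt (snd p))))"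
  by (auto simp: ext2_def lext_def tp_def fun_eq_iff sum_fun_apply vsc_apply mult.assoc)

lemma ext1_tp:
  assumes T: "linon (fsv B) T" and "v \<in> fsv B" "w \<in> fsv C"
  shows "ext1 T (tp v w) = tp (T v) w"
proof (rule bilinear_eq[OF _ _ _ _ _ assms(2,3)])
  show "linon (fsv B) (\<lambda>v. ext1 T (tp v w))" if "w \<in> fsv C" for w
    unfolding ext1_lext using that by (intro linon_comp[OF linon_tp1 linon_lext[of "B \<times> C"]]) (auto intro: tp_fsv)
  show "linon (fsv B) (\<lambda>v. tp (T v) w)" for w
    by (rule linon_comp[OF T linon_tp1[of UNIV]]) auto
  show "linon (fsv C) (\<lambda>w. ext1 T (tp (dlt b) w))" if "b \<in> B" for b
    unfolding ext1_lext using that by (intro linon_comp[OF linon_tp2 linon_lext[of "B \<times> C"]]) (auto intro: tp_fsv)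
qed (auto simp: linon_tp2 ext1_lext tp_dlt)

lemma ext2_tp:
  assumes T: "linon (fsv C) T" and "v \<in> fsv B" "w \<in> fsv C"
  shows "ext2 T (tp v w) = tp v (T w)"
proof (rule bilinear_eq[OF _ _ _ _ _ assms(2,3)])
  show "linon (fsv B) (\<lambda>v. ext2 T (tp v w))" if "w \<in> fsv C" for w
    unfolding ext2_lext using that by (intro linon_comp[OF linon_tp1 linon_lext[of "B \<times> C"]]) (auto intro: tp_fsv)
  show "linon (fsv C) (\<lambda>w. ext2 T (tp (dlt b) w))" if "b \<in> B" for b
    unfolding ext2_lext using that by (intro linon_comp[OF linon_tp2 linon_lext[of "B \<times> C"]]) (auto intro: tp_fsv)
  show "linon (fsv C) (\<lambda>w. tp (dlt b) (T w))" for b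
    by (rule linon_comp[OF T linon_tp2[of UNIV]]) auto
qed (auto simp: linon_tp1 ext2_lext tp_dlt)

definition tact :: "('b vec \<Rightarrow> 'b vec) \<Rightarrow> ('c vec \<Rightarrow> 'c vec) \<Rightarrow> ('b \<times> 'c) vec \<Rightarrow> ('b \<times> 'c) vec" where
  "tact f g x = ext1 f x + ext2 g x"

text \<open>For \<open>J\<close> inside \<open>V\<close> and \<open>K\<close> inside
  \<open>W\<close> this is the kernel of the map from V (x) W to V/J (x) W/K, so the quotient by it
  is the tensor product of the two quotients.\<close>

definition tjdl :: "'b vec set \<Rightarrow> 'b vec set \<Rightarrow> 'c vec set \<Rightarrow> 'c vec set \<Rightarrow> ('b \<times> 'c) vec set" where
  "tjdl V J W K = vs.span ({tp v w | v w. v \<in> J \<and> w \<in> W} \<union> {tp v w | v w. v \<in> V \<and> w \<in> K})"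

lemma tjdl_1: "v \<in> J \<Longrightarrow> w \<in> W \<Longrightarrow> tp v w \<in> tjdl V J W K"
  and tjdl_2: "v \<in> V \<Longrightarrow> w \<in> K \<Longrightarrow> tp v w \<in> tjdl V J W K"
  unfolding tjdl_def by (blast intro: vs.span_base)+

lemma subspace_tjdl [simp]: "vs.subspace (tjdl V J W K)"
  by (simp add: tjdl_def)

lemma tjdl_sub:
  assumes "J \<subseteq> fsv B" "K \<subseteq> fsv C"
  shows "tjdl (fsv B) J (fsv C) K \<subseteq> fsv (B \<times> C)"
  unfolding tjdl_def using assms by (intro vs.span_minimal) (auto intro!: tp_fsv)

lemma tjdl_mono: "K \<subseteq> K' \<Longrightarrow> tjdl V J W K \<subseteq> tjdl V J W K'"
  unfolding tjdl_def by (rule vs.span_mono) blast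

lemma linon_tact: "linon (fsv A) (tact f g)"
  unfolding tact_def ext1_lext ext2_lext by (intro linon_plus linon_lext)

lemma tact_tp:
  assumes "linon (fsv B) f" "linon (fsv C) g" "v \<in> fsv B" "w \<in> fsv C"
  shows "tact f g (tp v w) = tp (f v) w + tp v (g w)"
  using assms by (simp add: tact_def ext1_tp ext2_tp)

lemma tjdl_into:
  assumes "J \<subseteq> fsv B" "K \<subseteq> fsv C" "linon (fsv (B \<times> C)) f" "vs.subspace U"
    "\<And>v w. v \<in> J \<Longrightarrow> w \<in> fsv C \<Longrightarrow> f (tp v w) \<in> U" "\<And>v w. v \<in> fsv B \<Longrightarrow> w \<in> K \<Longrightarrow> f (tp v w) \<in> U"
    "x \<in> tjdl (fsv B) J (fsv C) K"
  shows "f x \<in> U"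
  by (rule linon_into_span[OF assms(3) subspace_fsv _ assms(4) _ assms(7)[unfolded tjdl_def]])
    (use assms(1,2,5,6) in \<open>auto intro!: tp_fsv\<close>)

lemma opr_tact:
  assumes f: "opr (fsv B) J f" and g: "opr (fsv C) K g" and JK: "J \<subseteq> fsv B" "K \<subseteq> fsv C"
  shows "opr (fsv (B \<times> C)) (tjdl (fsv B) J (fsv C) K) (tact f g)"
  unfolding opr_def image_subset_iff
proof (intro conjI ballI linon_tact)
  fix x :: "('a \<times> 'b) vec" assume x: "x \<in> fsv (B \<times> C)"
  show "tact f g x \<in> fsv (B \<times> C)"
  proof (rule tp_into[OF linon_tact subspace_fsv _ x])
    fix b c assume "b \<in> B" "c \<in> C"
    then show "tact f g (tp (dlt b) (dlt c)) \<in> fsv (B \<times> C)"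
      using opr_V[OF f, of "dlt b"] opr_V[OF g, of "dlt c"]
      by (simp add: tact_tp[OF opr_linon[OF f] opr_linon[OF g]] vs.subspace_add tp_fsv)
  qed
next
  fix x assume x: "x \<in> tjdl (fsv B) J (fsv C) K"
  show "tact f g x \<in> tjdl (fsv B) J (fsv C) K"
  proof (rule tjdl_into[OF JK linon_tact subspace_tjdl _ _ x])
    fix v w assume "v \<in> J" "w \<in> fsv C"
    then show "tact f g (tp v w) \<in> tjdl (fsv B) J (fsv C) K"
      using JK opr_J[OF f] opr_V[OF g] by (subst tact_tp[OF opr_linon[OF f] opr_linon[OF g]])
        (auto intro!: vs.subspace_add tjdl_1)
  next
    fix v w assume "v \<in> fsv B" "w \<in> K"
    then show "tact f g (tp v w) \<in> tjdl (fsv B) J (fsv C) K"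
      using JK opr_V[OF f] opr_J[OF g] by (subst tact_tp[OF opr_linon[OF f] opr_linon[OF g]])
        (auto intro!: vs.subspace_add tjdl_2)
  qed
qed

lemma rep_tensor:
  assumes \<rho>: "rep n A (fsv B) J \<rho>" and \<sigma>: "rep n A (fsv C) K \<sigma>" and A: "brk_closed n A"
  shows "rep n A (fsv (B \<times> C)) (tjdl (fsv B) J (fsv C) K) (\<lambda>a. tact (\<rho> a) (\<sigma> a))"
proof -
  let ?V = "fsv (B \<times> C)" and ?J = "tjdl (fsv B) J (fsv C) K" and ?\<tau> = "\<lambda>a. tact (\<rho> a) (\<sigma> a)"
  have o1: "opr (fsv B) J (\<rho> a)" and o2: "opr (fsv C) K (\<sigma> a)" if "a \<in> A" for a
    using repD(4)[OF \<rho>] repD(4)[OF \<sigma>] that by auto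
  note JK = repD(3)[OF \<rho>] repD(3)[OF \<sigma>]
  have opr: "opr ?V ?J (?\<tau> a)" if "a \<in> A" for a
    by (rule opr_tact[OF o1[OF that] o2[OF that] JK])
  have t: "?\<tau> a (tp v w) = tp (\<rho> a v) w + tp v (\<sigma> a w)" if "a \<in> A" "v \<in> fsv B" "w \<in> fsv C" for a v w
    by (rule tact_tp[OF opr_linon[OF o1[OF that(1)]] opr_linon[OF o2[OF that(1)]] that(2,3)])
  have rel: "?\<tau> a (?\<tau> b x) - ?\<tau> b (?\<tau> a x) - run ?\<tau> x (brk n a b) \<in> ?J"
    if ab: "a \<in> A" "b \<in> A" and x: "x \<in> ?V" for a b x
  proof -
    obtain c y where y: "y \<in> A" "brk n a b = vsc c (dlt [y])"
      using A ab unfolding brk_closed_def by blast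
    have "?\<tau> a (?\<tau> b x) - ?\<tau> b (?\<tau> a x) - vsc c (?\<tau> y x) \<in> ?J"
    proof (rule tp_into[OF _ subspace_tjdl _ x])
      have c: "linon ?V (\<lambda>x. ?\<tau> a (?\<tau> b x))" if "a \<in> A" "b \<in> A" for a b
        using opr[OF that(2)] by (intro linon_comp[OF linon_tact linon_tact]) (auto simp: opr_def)
      show "linon ?V (\<lambda>x. ?\<tau> a (?\<tau> b x) - ?\<tau> b (?\<tau> a x) - vsc c (?\<tau> y x))"
        using ab by (intro linon_minus linon_vsc linon_tact c) auto
    next
      fix i j assume "i \<in> B" "j \<in> C"
      then have vw: "dlt i \<in> fsv B" "dlt j \<in> fsv C" by auto
      define v where "v = (dlt i :: 'a vec)"
      define w where "w = (dlt j :: 'b vec)"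
      note vw = vw[folded v_def w_def]
      have cl: "\<rho> a v \<in> fsv B" "\<rho> b v \<in> fsv B" "\<sigma> a w \<in> fsv C" "\<sigma> b w \<in> fsv C"
        using opr_V o1 o2 ab vw by blast+
      have tv: "?\<tau> d (x + x') = ?\<tau> d x + ?\<tau> d x'" if "x \<in> ?V" "x' \<in> ?V" for x x' d
        by (rule linon_add[OF linon_tact that])
      \<comment> \<open>The mixed terms \<open>tp (\<rho> a v) (\<sigma> b w)\<close> and
        \<open>tp (\<rho> b v) (\<sigma> a w)\<close> occur in both orders and cancel; one relation
        in each factor remains.\<close>
      have 1: "?\<tau> a (?\<tau> b (tp v w)) - ?\<tau> b (?\<tau> a (tp v w)) - vsc c (?\<tau> y (tp v w))
        = tp (\<rho> a (\<rho> b v) - \<rho> b (\<rho> a v) - vsc c (\<rho> y v)) w + tp v (\<sigma> a (\<sigma> b w) - \<sigma> b (\<sigma> a w) - vsc c (\<sigma> y w))"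
        using ab y vw cl
        by (simp add: t tv tp_fsv) (auto simp: tp_def fun_eq_iff vec_simps algebra_simps)
      have "\<rho> a (\<rho> b v) - \<rho> b (\<rho> a v) - vsc c (\<rho> y v) \<in> J"
        "\<sigma> a (\<sigma> b w) - \<sigma> b (\<sigma> a w) - vsc c (\<sigma> y w) \<in> K"
        using repD(5)[OF \<rho> ab vw(1)] repD(5)[OF \<sigma> ab vw(2)] y by simp_all
      then show "?\<tau> a (?\<tau> b (tp (dlt i) (dlt j))) - ?\<tau> b (?\<tau> a (tp (dlt i) (dlt j))) - vsc c (?\<tau> y (tp (dlt i) (dlt j))) \<in> ?J"
        unfolding v_def[symmetric] w_def[symmetric] 1 using vw
        by (intro vs.subspace_add subspace_tjdl tjdl_1 tjdl_2)
    qed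
    then show ?thesis using y by simp
  qed
  show ?thesis unfolding rep_def using opr rel JK by (auto simp: tjdl_sub)
qed

lemma tensor_eq:
  "tensor (lists A, J, \<rho>) (lists B, K, \<sigma>) =
    (lists A \<times> lists B, tjdl (fsv (lists A)) J (fsv (lists B)) K, \<lambda>a. tact (\<rho> a) (\<sigma> a))"
  by (auto simp: tensor_def bas_def jdl_def act_def tjdl_def cspan_eq vadd_eq tact_def fun_eq_iff)

lemma lmul_0: "lmul a 0 = 0"
  by (rule linon_zero[OF linon_lmul vs.subspace_UNIV])

text \<open>Inflation along the quotient by the Heisenberg ideal: a bracket that involves a letter
  outside \<open>GS\<close> is a multiple of such a letter, so both sides act by zero. Between sl2
  letters the bracket is the same for every \<open>n\<close>, which reconciles the indices
  \<open>0\<close> and \<open>n\<close>.\<close>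

lemma rep_gS:
  assumes K: "rep 0 GS V K lmul"
  shows "rep n (Gl n) V K gS"
proof -
  have 0: "0 \<in> V" "0 \<in> K" using repD(1,2)[OF K] by (auto intro: vs.subspace_0)
  have opr: "opr V K (gS a)" for a
    using repD(4)[OF K] 0 by (cases "a \<in> GS") (auto simp: opr_def linon_def gS_def)
  have rel: "gS a (gS b v) - gS b (gS a v) - run gS v (brk n a b) \<in> K"
    if "a \<in> Gl n" "b \<in> Gl n" "v \<in> V" for a b v
  proof (cases "a \<in> GS \<and> b \<in> GS")
    case True
    then have eq: "brk n a b = brk 0 a b" by (auto simp: GS_def)
    obtain c x where "x \<in> GS" "brk n a b = vsc c (dlt [x])"
      using brk_closed_GS[of n] True unfolding brk_closed_def by blast
    then show ?thesis using repD(5)[OF K, of a b v] True that(3) by (simp add: gS_def eq)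
  next
    case False
    have "\<exists>c x. x \<notin> GS \<and> brk n a b = vsc c (dlt [x])"
    proof (cases "a \<in> GS")
      case True
      then have "b = Z \<or> (\<exists>k. b = P k)" using False that(2) by (auto elim: Gl_cases)
      then show ?thesis
      proof
        assume "b = Z"
        then have "brk n a b = vsc 0 (dlt [Z])" using True by (auto simp: GS_def vzero_eq)
        then show ?thesis using Z_GS by blast
      next
        assume "\<exists>k. b = P k"
        then show ?thesis using brk_wt[OF True] P_GS by blast
      qed
    next
      case aF: False
      show ?thesis
      proof (cases "b \<in> GS")
        case True
        then have "a = Z \<or> (\<exists>k. a = P k)" using aF that(1) by (auto elim: Gl_cases)
        then show ?thesis
        proof
          assume "a = Z"
          then have "brk n a b = vsc 0 (dlt [Z])" using True by (auto simp: GS_def vzero_eq)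
          then show ?thesis using Z_GS by blast
        next
          assume "\<exists>k. a = P k"
          then obtain k where "brk n a b = vsc (- wt n b k) (dlt [P (sh b k)])"
            using brk_wt[OF True] brk_antisym[of n a b] by auto
          then show ?thesis using P_GS by blast
        qed
      next
        case bF: False
        then have "\<exists>c. brk n a b = vsc c (dlt [Z])"
        proof -
          have "brk n (P j) (P k) = vsc (if j + k = 2*n+1 then gm n j else 0) (dlt [Z])" for j k
            by (simp add: gm_def vzero_eq)
          moreover have "brk n Z d = vsc 0 (dlt [Z])" "brk n d Z = vsc 0 (dlt [Z])" for d
            by (cases d; simp add: vzero_eq)+
          ultimately show ?thesis using aF bF that(1,2) unfolding Gl_iff by metis
        qed
        then show ?thesis using Z_GS by blast
      qed
    qed
    then obtain c x where x: "x \<notin> GS" "brk n a b = vsc c (dlt [x])" by blast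
    have "gS a (gS b v) = 0" "gS b (gS a v) = 0" using False by (auto simp: gS_def lmul_0)
    then show ?thesis using x 0 by (simp add: gS_def)
  qed
  show ?thesis unfolding rep_def using opr rel repD(1-3)[OF K] by blast
qed

section \<open>The isomorphism of Verma modules\<close>

lemma rep_enlarge:
  assumes "rep n A V J \<rho>" "J \<subseteq> N" "N \<subseteq> V" "vs.subspace N" "\<And>a v. a \<in> A \<Longrightarrow> v \<in> N \<Longrightarrow> \<rho> a v \<in> N"
  shows "rep n A V N \<rho>"
  unfolding rep_def
proof (intro conjI ballI)
  show "opr V N (\<rho> a)" if "a \<in> A" for a
    using repD(4)[OF assms(1)] assms(5) that unfolding opr_def image_subset_iff by simp
  show "\<rho> a (\<rho> b v) - \<rho> b (\<rho> a v) - run \<rho> v (brk n a b) \<in> N" if "a \<in> A" "b \<in> A" "v \<in> V" for a b v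
    using repD(5)[OF assms(1) that] assms(2) by (rule rev_subsetD)
qed (use assms repD[OF assms(1)] in auto)

lemma rep_restrict: "rep n A V J \<rho> \<Longrightarrow> B \<subseteq> A \<Longrightarrow> rep n B V J \<rho>"
  by (simp add: rep_def subset_iff)

text \<open>An equality, not a congruence: \<open>run\<close> commutes exactly with prefixing a
  letter, so it carries Phi on words exactly to Phi on the target.\<close>

lemma Phi_intertwine:
  assumes "linon U f" "vs.subspace U" "\<And>k v. k \<le> 2*n+1 \<Longrightarrow> v \<in> U \<Longrightarrow> p k v \<in> U"
    "\<And>k v. k \<le> 2*n+1 \<Longrightarrow> v \<in> U \<Longrightarrow> f (p k v) = q k (f v)" "v \<in> U"
  shows "f (Phi n zdot p a v) = Phi n zdot q a (f v)"
proof -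
  have quad_U: "quad p K c i l v \<in> U" and quad: "f (quad p K c i l v) = quad q K c i l (f v)"
    if kl: "\<And>k. k \<in> K \<Longrightarrow> i k \<le> 2*n+1 \<and> l k \<le> 2*n+1" for K c i l
  proof -
    have U: "p (i k) (p (l k) v) \<in> U" if "k \<in> K" for k
      using kl[OF that] assms(3,5) by simp
    then show "quad p K c i l v \<in> U"
      unfolding quad_def by (intro vs.subspace_scale[OF assms(2)] vs.subspace_sum[OF assms(2)])
    have eq: "f (vsc (c k) (p (i k) (p (l k) v))) = vsc (c k) (q (i k) (q (l k) (f v)))" if "k \<in> K" for k
      using kl[OF that] assms(3,5) by (simp only: linon_scale[OF assms(1) U[OF that]] assms(4))
    have "f (quad p K c i l v) = (\<Sum>k\<in>K. f (vsc (c k) (p (i k) (p (l k) v))))"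
      unfolding quad_def by (rule linon_sum[OF assms(1,2)]) (rule vs.subspace_scale[OF assms(2) U])
    also have "\<dots> = quad q K c i l (f v)"
      unfolding quad_def by (rule sum.cong[OF refl eq])
    finally show "f (quad p K c i l v) = quad q K c i l (f v)" .
  qed
  show ?thesis
  proof (cases a)
    case H
    have c: "\<And>k. k \<in> {0..n} \<Longrightarrow> 2*n+1-k \<le> 2*n+1 \<and> k \<le> 2*n+1" by auto
    show ?thesis unfolding H Phi_def gen.case
      by (simp only: linon_diff[OF assms(1,2) quad_U[OF c] vs.subspace_scale[OF assms(2,5)]]
          quad[OF c] linon_scale[OF assms(1,5)])
  qed (auto simp: Phi_def linon_zero[OF assms(1,2)] intro!: quad)
qed

definition vacuum :: "(gen list \<times> gen list) vec" where
  "vacuum = tp (dlt []) (dlt [])"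

locale setting =
  fixes n :: nat and zdot hdot :: complex
  assumes zdot: "zdot \<noteq> 0"
begin

abbreviation "mu \<equiv> hdot + (of_nat n + 1) ^ 2 / 2"
abbreviation "VG \<equiv> fsv (lists (Gl n))"
abbreviation "JG \<equiv> pideal n (Gl n) (CG n zdot hdot)"
abbreviation "VH \<equiv> fsv (lists (GH n))"
abbreviation "JH \<equiv> pideal n (GH n) (CH n zdot)"
abbreviation "VS \<equiv> fsv (lists GS)"
abbreviation "JS \<equiv> pideal 0 GS (CS mu)"
abbreviation "VT \<equiv> fsv (lists (GH n) \<times> lists GS)"
abbreviation "TJ K \<equiv> tjdl VH JH VS K"
abbreviation "\<rho> a \<equiv> tact (ghat n zdot lmul a) (gS a)"
abbreviation "\<Phi> \<equiv> Phi n zdot (\<lambda>k. lmul (P k))"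

lemma repG: "rep n (Gl n) VG JG lmul"
  by (rule rep_lmul[OF brk_closed_Gl CG_sub])

lemma repH: "rep n (GH n) VH JH lmul"
  by (rule rep_lmul[OF brk_closed_GH CH_sub])

lemma repS: "rep 0 GS VS JS lmul"
  by (rule rep_lmul[OF brk_closed_GS CS_sub])

lemma Z_G: "v \<in> VG \<Longrightarrow> lmul Z v - vsc zdot v \<in> JG"
  by (rule Z_scalar[OF brk_closed_Gl CG_sub]) (simp_all add: CG_def CH_def)

lemma Z_H: "v \<in> VH \<Longrightarrow> lmul Z v - vsc zdot v \<in> JH"
  by (rule Z_scalar[OF brk_closed_GH CH_sub]) (simp_all add: CH_def)

sublocale hG: heis n zdot VG JG "\<lambda>k. lmul (P k)"
  by (rule heis_rep[OF repG _ zdot Z_G]) (auto simp: GH_Gl)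

sublocale hH: heis n zdot VH JH "\<lambda>k. lmul (P k)"
  by (rule heis_rep[OF repH _ zdot Z_H]) auto

definition submS :: "gen list vec set \<Rightarrow> bool" where
  "submS K \<longleftrightarrow> JS \<subseteq> K \<and> K \<subseteq> VS \<and> vs.subspace K \<and> (\<forall>a\<in>GS. \<forall>v\<in>K. lmul a v \<in> K)"

lemma submS_JS: "submS JS"
  unfolding submS_def using repD(2,3)[OF repS] lmul_pideal[OF brk_closed_GS CS_sub] by blast

lemma repHg: "rep n (Gl n) VH JH (ghat n zdot lmul)"
  by (rule rep_ghat[OF repH zdot Z_H])

text \<open>\<open>K\<close> stays arbitrary so that \<open>JS\<close> serves the Verma module and a
  larger \<open>K\<close> its quotients, with the same operators \<open>\<rho>\<close>.\<close>

lemma repT: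
  assumes "submS K"
  shows "rep n (Gl n) VT (TJ K) \<rho>"
proof -
  have "rep 0 GS VS K lmul"
    by (rule rep_enlarge[OF repS]) (use assms in \<open>simp_all add: submS_def\<close>)
  then show ?thesis by (intro rep_tensor[OF repHg rep_gS brk_closed_Gl])
qed

lemma \<rho>_tp: "a \<in> Gl n \<Longrightarrow> v \<in> VH \<Longrightarrow> w \<in> VS \<Longrightarrow> \<rho> a (tp v w) = tp (ghat n zdot lmul a v) w + tp v (gS a w)"
  using repD(4)[OF repHg] repD(4)[OF rep_gS[OF repS, of n]] by (intro tact_tp opr_linon) blast+

lemma \<rho>_GS: "a \<in> GS \<Longrightarrow> v \<in> VH \<Longrightarrow> w \<in> VS \<Longrightarrow> \<rho> a (tp v w) = tp (\<Phi> a v) w + tp v (lmul a w)"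
  by (subst \<rho>_tp) (auto simp: GS_Gl ghat_def gS_def)

lemma \<rho>_GH: "a \<in> GH n \<Longrightarrow> v \<in> VH \<Longrightarrow> w \<in> VS \<Longrightarrow> \<rho> a (tp v w) = tp (lmul a v) w"
proof -
  assume a: "a \<in> GH n" "v \<in> VH" "w \<in> VS"
  then have "a \<notin> GS" by (auto simp: GH_def GS_def)
  moreover have "tp v 0 = 0" by (simp add: tp_def fun_eq_iff zero_fun_def)
  ultimately show ?thesis using a by (subst \<rho>_tp) (auto simp: GH_Gl ghat_def gS_def)
qed

definition T :: "gen list vec \<Rightarrow> (gen list \<times> gen list) vec" where
  "T = run \<rho> vacuum"

lemma vacuum_VT [simp]: "vacuum \<in> VT"
  by (simp add: vacuum_def tp_fsv)

lemma T_V [simp]: "v \<in> VG \<Longrightarrow> T v \<in> VT"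
  unfolding T_def by (rule run_in[OF repD(4)[OF repT[OF submS_JS]] subspace_fsv vacuum_VT])

lemma T_lmul: "a \<in> Gl n \<Longrightarrow> v \<in> VG \<Longrightarrow> T (lmul a v) = \<rho> a (T v)"
  unfolding T_def by (rule run_lmul[OF repD(4)[OF repT[OF submS_JS]] subspace_fsv vacuum_VT])

lemma linon_T: "linon VG T"
  unfolding T_def by (rule linon_lext)

lemma vac_P: "k \<le> n \<Longrightarrow> lmul (P k) (dlt []) \<in> JH"
  using ann_in_pideal[of "P k" 0 "CH n zdot" "[]" "GH n" n] by (simp add: CH_def)

lemma vac_E: "\<Phi> E (dlt []) \<in> JH"
  by (rule hH.Phi_E_vacuum[OF _ vac_P]) auto

lemma vac_H: "\<Phi> H (dlt []) - vsc (- ((of_nat n + 1) ^ 2 / 2)) (dlt []) \<in> JH"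
  by (rule hH.Phi_H_vacuum) (rule vac_P)

lemma S_E: "lmul E (dlt []) \<in> JS"
  using ann_in_pideal[of E 0 "CS mu" "[]" GS 0] by (simp add: CS_def)

lemma S_H: "lmul H (dlt []) - vsc mu (dlt []) \<in> JS"
  using ann_in_pideal[of H mu "CS mu" "[]" GS 0] by (simp add: CS_def)

text \<open>By the universal property it suffices that the vacuum tensor is a highest weight vector.
  \<open>E\<close> kills both factors, \<open>Z\<close> and the annihilators see only the Heisenberg
  factor, and \<open>H\<close> gives -(n+1)^2/2 + mu = hdot.\<close>

lemma T_JG:
  assumes "v \<in> JG"
  shows "T v \<in> TJ JS"
  unfolding T_def
proof (rule universal[OF repT[OF submS_JS] brk_closed_Gl CG_sub vacuum_VT _ assms])
  fix y c assume "(y, c) \<in> CG n zdot hdot"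
  then consider "y = E" "c = 0" | "y = H" "c = hdot" | "y = Z" "c = zdot" | k where "y = P k" "c = 0" "k \<le> n"
    by (auto simp: CG_def CH_def)
  then show "\<rho> y vacuum - vsc c vacuum \<in> TJ JS"
  proof cases
    case 1
    then have "\<rho> y vacuum - vsc c vacuum = tp (\<Phi> E (dlt [])) (dlt []) + tp (dlt []) (lmul E (dlt []))"
      unfolding vacuum_def by (subst \<rho>_GS) (auto simp: GS_def)
    moreover have "tp (\<Phi> E (dlt [])) (dlt []) + tp (dlt []) (lmul E (dlt [])) \<in> TJ JS"
      by (rule vs.subspace_add[OF subspace_tjdl tjdl_1[OF vac_E] tjdl_2[OF _ S_E]]) auto
    ultimately show ?thesis by (simp only:)
  next
    case 2
    have "\<rho> y vacuum - vsc c vacuum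
      = tp (\<Phi> H (dlt []) - vsc (- ((of_nat n + 1) ^ 2 / 2)) (dlt [])) (dlt []) + tp (dlt []) (lmul H (dlt []) - vsc mu (dlt []))"
      unfolding 2 vacuum_def
      by (subst \<rho>_GS) (auto simp: GS_def tp_def fun_eq_iff vec_simps algebra_simps)
    also have "\<dots> \<in> TJ JS"
      by (rule vs.subspace_add[OF subspace_tjdl tjdl_1[OF vac_H] tjdl_2[OF _ S_H]]) auto
    finally show ?thesis .
  next
    case 3
    have "\<rho> y vacuum - vsc c vacuum = tp (lmul Z (dlt []) - vsc zdot (dlt [])) (dlt [])"
      unfolding 3 vacuum_def by (subst \<rho>_GH) (auto simp: tp_def fun_eq_iff vec_simps algebra_simps)
    then show ?thesis using Z_H[of "dlt []"] by (auto intro!: tjdl_1)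
  next
    case 4
    then show ?thesis using vac_P[of k]
      by (simp add: vacuum_def \<rho>_GH del: lmul_dlt) (rule tjdl_1, auto)
  qed
qed

section \<open>The copy of sl2 that commutes with the Heisenberg algebra\<close>

definition D :: "gen \<Rightarrow> gen list vec \<Rightarrow> gen list vec" where
  "D a v = lmul a v - \<Phi> a v"

lemma lmul_VG: "a \<in> Gl n \<Longrightarrow> v \<in> VG \<Longrightarrow> lmul a v \<in> VG"
  by (rule lmul_fsv)

lemma opr_lmul: "a \<in> Gl n \<Longrightarrow> opr VG JG (lmul a)"
  using repD(4)[OF repG] by blast

lemma opr_D:
  assumes "a \<in> GS"
  shows "opr VG JG (D a)"
proof -
  have "linon VG (\<lambda>v. lmul a v - \<Phi> a v)"
    by (intro linon_minus linon_lmul opr_linon[OF hG.opr_Phi])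
  then show ?thesis
    using opr_lmul[OF GS_Gl[OF assms]] hG.opr_Phi[of a] hG.V_closed(2) hG.J_closed(2)
    unfolding opr_def D_def image_subset_iff by auto
qed

lemma D_VG: "a \<in> GS \<Longrightarrow> v \<in> VG \<Longrightarrow> D a v \<in> VG"
  by (rule opr_V[OF opr_D])

text \<open>\<open>lmul a\<close> and \<open>\<Phi> a\<close> have the same commutator with
  \<open>P k\<close> modulo \<open>JG\<close>, so it cancels in their difference; for
  \<open>Z\<close> its scalar action is enough.\<close>

lemma D_GH:
  assumes "a \<in> GS" "x \<in> GH n" "v \<in> VG"
  shows "D a (lmul x v) - lmul x (D a v) \<in> JG"
proof (cases "x = Z")
  case True
  have Dv: "D a v \<in> VG" by (rule D_VG[OF assms(1,3)])
  have "D a (lmul Z v - vsc zdot v) \<in> JG" by (rule opr_J[OF opr_D[OF assms(1)] Z_G[OF assms(3)]])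
  then have "D a (lmul Z v) - vsc zdot (D a v) \<in> JG"
    using assms(3) by (simp add: linon_diff[OF opr_linon[OF opr_D[OF assms(1)]]]
        linon_scale[OF opr_linon[OF opr_D[OF assms(1)]]] lmul_VG)
  then have "D a (lmul Z v) - vsc zdot (D a v) - (lmul Z (D a v) - vsc zdot (D a v)) \<in> JG"
    by (rule hG.J_closed(2)) (rule Z_G[OF Dv])
  then show ?thesis using True by simp
next
  case False
  then obtain k where k: "x = P k" "k \<le> 2*n+1" using assms(2) by (auto simp: GH_def)
  have 1: "\<Phi> a (lmul (P k) v) - lmul (P k) (\<Phi> a v) - vsc (wt n a k) (lmul (P (sh a k)) v) \<in> JG"
    by (rule hG.Phi_p[OF assms(1) k(2) assms(3)])
  have 2: "lmul a (lmul (P k) v) - lmul (P k) (lmul a v) - vsc (wt n a k) (lmul (P (sh a k)) v) \<in> JG"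
    using repD(5)[OF repG GS_Gl[OF assms(1)] _ assms(3), of "P k"] k(2) brk_wt[OF assms(1)] by simp
  have "lmul (P k) (D a v) = lmul (P k) (lmul a v) - lmul (P k) (\<Phi> a v)"
    unfolding D_def by (rule linon_diff[OF linon_lmul vs.subspace_UNIV]) auto
  then have "D a (lmul (P k) v) - lmul (P k) (D a v) =
    (lmul a (lmul (P k) v) - lmul (P k) (lmul a v) - vsc (wt n a k) (lmul (P (sh a k)) v))
    - (\<Phi> a (lmul (P k) v) - lmul (P k) (\<Phi> a v) - vsc (wt n a k) (lmul (P (sh a k)) v))"
    by (simp only:) (simp add: D_def)
  then show ?thesis using hG.J_closed(2)[OF 2 1] k(1) by simp
qed

text \<open>\<open>\<Phi> b\<close> is a polynomial in the \<open>P k\<close>, and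
  \<open>D a\<close> commutes with these: the Leibniz rule with zero weights.\<close>

lemma D_\<Phi>:
  assumes "a \<in> GS" "v \<in> VG"
  shows "D a (\<Phi> b v) - \<Phi> b (D a v) \<in> JG"
proof -
  have quad: "D a (quad (\<lambda>k. lmul (P k)) K c i l v) - quad (\<lambda>k. lmul (P k)) K c i l (D a v) \<in> JG"
    if "\<And>k. k \<in> K \<Longrightarrow> i k \<le> 2*n+1 \<and> l k \<le> 2*n+1" for K c i l
  proof -
    have "D a (quad (\<lambda>k. lmul (P k)) K c i l v) - quad (\<lambda>k. lmul (P k)) K c i l (D a v)
     - (\<Sum>k\<in>K. vsc (c k) (vsc 0 (lmul (P (i k)) (lmul (P (l k)) v)) + vsc 0 (lmul (P (i k)) (lmul (P (l k)) v)))) \<in> JG"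
      by (rule hG.ad_quad[OF opr_D[OF assms(1)]]) (use D_GH[OF assms(1)] that assms(2) in auto)
    then show ?thesis by simp
  qed
  note Dl = linon_diff[OF opr_linon[OF opr_D[OF assms(1)]] subspace_fsv]
    linon_scale[OF opr_linon[OF opr_D[OF assms(1)]]] linon_zero[OF opr_linon[OF opr_D[OF assms(1)]] subspace_fsv]
  show ?thesis
  proof (cases b)
    case H
    let ?q = "quad (\<lambda>k. lmul (P k)) {0..n} (\<lambda>k. - 2 * (of_nat n + 1/2 - of_nat k) / (gm n k * zdot)) (\<lambda>k. 2*n+1-k) (\<lambda>k. k)"
    have q: "D a (?q v) - ?q (D a v) \<in> JG" by (rule quad) auto
    have qV: "?q v \<in> VG" by (rule opr_V[OF hG.opr_quad assms(2)]) auto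
    have "D a (?q v - vsc c v) = D a (?q v) - vsc c (D a v)" for c
      using qV assms(2) by (simp only: Dl hG.V_closed)
    moreover have "x - y \<in> JG \<Longrightarrow> (x - s) - (y - s) \<in> JG" for x y s by simp
    ultimately show ?thesis unfolding H Phi_def gen.case using q by (simp only:)
  qed (auto simp: Phi_def Dl vs.subspace_0[OF hG.subJ] intro!: quad)
qed

lemma D_rel:
  assumes "a \<in> GS" "b \<in> GS" "v \<in> VG"
  shows "D a (D b v) - D b (D a v) - run D v (brk 0 a b) \<in> JG"
proof -
  obtain c x where x: "x \<in> GS" "brk n a b = vsc c (dlt [x])"
    using brk_closed_GS[of n] assms(1,2) unfolding brk_closed_def by blast
  have brk0: "brk 0 a b = brk n a b" using assms(1,2) by (auto simp: GS_def)
  note ab = GS_Gl[OF assms(1)] GS_Gl[OF assms(2)]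
  note DaV = D_VG[OF assms(1,3)] D_VG[OF assms(2,3)]
  have bv: "lmul b v \<in> VG" "\<Phi> b v \<in> VG" "lmul a v \<in> VG" "\<Phi> a v \<in> VG"
    using lmul_VG ab assms(3) opr_V[OF hG.opr_Phi] by auto
  have 1: "D a (\<Phi> b v) - \<Phi> b (D a v) \<in> JG" by (rule D_\<Phi>[OF assms(1,3)])
  have 2: "D b (\<Phi> a v) - \<Phi> a (D b v) \<in> JG" by (rule D_\<Phi>[OF assms(2,3)])
  have 3: "lmul a (lmul b v) - lmul b (lmul a v) - vsc c (lmul x v) \<in> JG"
    using repD(5)[OF repG ab assms(3)] x by simp
  have 4: "\<Phi> a (\<Phi> b v) - \<Phi> b (\<Phi> a v) - vsc c (\<Phi> x v) \<in> JG"
    using hG.Phi_brk[OF assms] x by simp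
  have d: "lmul y (D z v) = lmul y (lmul z v) - lmul y (\<Phi> z v)" for y z
    unfolding D_def by (rule linon_diff[OF linon_lmul vs.subspace_UNIV]) auto
  have e: "\<Phi> a (D b v) = \<Phi> a (lmul b v) - \<Phi> a (\<Phi> b v)" "\<Phi> b (D a v) = \<Phi> b (lmul a v) - \<Phi> b (\<Phi> a v)"
    unfolding D_def by (rule linon_diff[OF opr_linon[OF hG.opr_Phi] subspace_fsv bv(1,2)],
      rule linon_diff[OF opr_linon[OF hG.opr_Phi] subspace_fsv bv(3,4)])
  \<comment> \<open>The relation for the letters minus the relation for \<open>\<Phi>\<close>, with
    two corrections, each a commutator of some \<open>D\<close> with some \<open>\<Phi>\<close> and
    hence in \<open>JG\<close>.\<close>
  have "D a (D b v) - D b (D a v) - vsc c (D x v) =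
     (lmul a (lmul b v) - lmul b (lmul a v) - vsc c (lmul x v)) - (\<Phi> a (\<Phi> b v) - \<Phi> b (\<Phi> a v) - vsc c (\<Phi> x v))
     - (D a (\<Phi> b v) - \<Phi> b (D a v)) + (D b (\<Phi> a v) - \<Phi> a (D b v))"
    unfolding e D_def[of _ "D _ _"] d e
    by (simp add: D_def vs.scale_right_diff_distrib algebra_simps)
  also have "\<dots> \<in> JG" by (rule hG.J_closed(1)[OF hG.J_closed(2)[OF hG.J_closed(2)[OF 3 4] 1] 2])
  finally show ?thesis using x brk0 by simp
qed

lemma rep_D: "rep 0 GS VG JG D"
  unfolding rep_def using opr_D D_rel repD[OF repG] by blast

lemma vacG_P: "k \<le> n \<Longrightarrow> lmul (P k) (dlt []) \<in> JG"
  using ann_in_pideal[of "P k" 0 "CG n zdot hdot" "[]" "Gl n" n] by (simp add: CG_def CH_def)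

lemma D_E: "D E (dlt []) \<in> JG"
proof -
  have "lmul E (dlt []) \<in> JG"
    using ann_in_pideal[of E 0 "CG n zdot hdot" "[]" "Gl n" n] by (simp add: CG_def)
  moreover have "\<Phi> E (dlt []) \<in> JG" by (rule hG.Phi_E_vacuum[OF _ vacG_P]) auto
  ultimately show ?thesis unfolding D_def by (rule hG.J_closed(2))
qed

text \<open>Subtracting the vacuum weight -(n+1)^2/2 from \<open>hdot\<close> produces
  \<open>mu\<close>.\<close>

lemma D_H: "D H (dlt []) - vsc mu (dlt []) \<in> JG"
proof -
  have 1: "lmul H (dlt []) - vsc hdot (dlt []) \<in> JG"
    using ann_in_pideal[of H hdot "CG n zdot hdot" "[]" "Gl n" n] by (simp add: CG_def)
  have 2: "\<Phi> H (dlt []) - vsc (- ((of_nat n + 1) ^ 2 / 2)) (dlt []) \<in> JG"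
    by (rule hG.Phi_H_vacuum) (rule vacG_P)
  have "D H (dlt []) - vsc mu (dlt []) = (lmul H (dlt []) - vsc hdot (dlt [])) - (\<Phi> H (dlt []) - vsc (- ((of_nat n + 1) ^ 2 / 2)) (dlt []))"
    by (simp add: D_def vs.scale_left_distrib)
  then show ?thesis using hG.J_closed(2)[OF 1 2] by simp
qed

abbreviation "Dv \<equiv> run D (dlt [])"

lemma Dv_VG [simp]: "w \<in> VS \<Longrightarrow> Dv w \<in> VG"
  by (rule run_in[OF repD(4)[OF rep_D]]) auto

lemma Dv_JS: "w \<in> JS \<Longrightarrow> Dv w \<in> JG"
  by (rule universal[OF rep_D brk_closed_GS CS_sub]) (use D_E D_H in \<open>auto simp: CS_def\<close>)

text \<open>Annihilators pass through the operators \<open>D a\<close> and reach the highest weight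
  vector, so every \<open>Dv w\<close> is again a Heisenberg vacuum. This is what makes
  \<open>S\<close> well defined in the first tensor factor.\<close>

lemma Dv_P:
  assumes "k \<le> n" "w \<in> VS"
  shows "lmul (P k) (Dv w) \<in> JG"
proof (rule linon_into_fsv[OF linon_comp[OF linon_lext linon_lmul[of UNIV]] hG.subJ _ assms(2)])
  fix s assume "s \<in> lists GS"
  then show "lmul (P k) (Dv (dlt s)) \<in> JG"
  proof (induction s)
    case Nil
    show ?case using vacG_P[OF assms(1)] by simp
  next
    case (Cons a s)
    let ?y = "foldr D s (dlt [])"
    have y: "?y \<in> VG" using Dv_VG[of "dlt s"] Cons.hyps(2) by simp
    have "lmul (P k) ?y \<in> JG" using Cons.IH by simp
    then have 1: "D a (lmul (P k) ?y) \<in> JG" by (rule opr_J[OF opr_D[OF Cons.hyps(1)]])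
    have 2: "D a (lmul (P k) ?y) - lmul (P k) (D a ?y) \<in> JG"
      using D_GH[OF Cons.hyps(1) _ y, of "P k"] assms(1) by simp
    show ?case using hG.J_closed(2)[OF 1 2] by simp
  qed
qed auto

section \<open>The inverse map\<close>

definition S :: "(gen list \<times> gen list) vec \<Rightarrow> gen list vec" where
  "S = lext (\<lambda>(u, s). foldr lmul u (foldr D s (dlt [])))"

lemma linon_S: "linon (fsv B) S"
  unfolding S_def by (rule linon_lext)

lemma opr_foldr_lmul: "u \<in> lists (Gl n) \<Longrightarrow> opr VG JG (foldr lmul u)"
  using repD(4)[OF repG] by (rule foldr_opr)

lemma listsHG: "u \<in> lists (GH n) \<Longrightarrow> u \<in> lists (Gl n)"
  using GH_Gl by auto

lemma S_tp:
  assumes "v \<in> VH" "w \<in> VS"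
  shows "S (tp v w) = run lmul (Dv w) v"
proof (rule bilinear_eq[OF _ linon_lext _ _ _ assms])
  show "linon VH (\<lambda>v. S (tp v w))" if "w \<in> VS" for w
    by (rule linon_comp[OF linon_tp1 linon_S]) (use that in \<open>auto intro: tp_fsv\<close>)
  show "linon VS (\<lambda>w. S (tp (dlt u) w))" if "u \<in> lists (GH n)" for u
    by (rule linon_comp[OF linon_tp2 linon_S]) (use that in \<open>auto intro: tp_fsv\<close>)
  show "linon VS (\<lambda>w. run lmul (Dv w) (dlt u))" if "u \<in> lists (GH n)" for u
    unfolding lext_dlt
    by (rule linon_comp[OF linon_lext opr_linon[OF opr_foldr_lmul[OF listsHG[OF that]]]]) auto
qed (simp add: S_def tp_dlt)

lemma S_VG [simp]: "x \<in> VT \<Longrightarrow> S x \<in> VG"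
  unfolding S_def
proof (rule lext_in)
  fix b assume "b \<in> lists (GH n) \<times> lists GS"
  then obtain u s where b: "b = (u, s)" "u \<in> lists (GH n)" "s \<in> lists GS" by auto
  show "(case b of (u, s) \<Rightarrow> foldr lmul u (foldr D s (dlt []))) \<in> VG"
    using opr_V[OF opr_foldr_lmul[OF listsHG[OF b(2)]] Dv_VG[of "dlt s"]] b by simp
qed auto

lemma repGH: "rep n (GH n) VG JG lmul"
  using repG by (rule rep_restrict) (auto simp: GH_Gl)

text \<open>Relations of the Heisenberg factor are respected because \<open>Dv w\<close> is a vacuum
  on which \<open>Z\<close> acts by \<open>zdot\<close>; relations of the sl2 factor because the
  operators \<open>D\<close> form a representation in which the highest weight vector has weight
  \<open>mu\<close>.\<close>

lemma S_TJ:
  assumes "x \<in> TJ JS"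
  shows "S x \<in> JG"
proof (rule tjdl_into[OF repD(3)[OF repH] repD(3)[OF repS] linon_S hG.subJ _ _ assms])
  fix v w assume v: "v \<in> JH" and w: "w \<in> VS"
  have vH: "v \<in> VH" using v repD(3)[OF repH] by blast
  show "S (tp v w) \<in> JG" unfolding S_tp[OF vH w]
    by (rule universal[OF repGH brk_closed_GH CH_sub Dv_VG[OF w] _ v])
      (use Dv_P[OF _ w] Z_G[OF Dv_VG[OF w]] in \<open>auto simp: CH_def\<close>)
next
  fix v w assume v: "v \<in> VH" and w: "w \<in> JS"
  have wS: "w \<in> VS" using w repD(3)[OF repS] by blast
  show "S (tp v w) \<in> JG" unfolding S_tp[OF v wS]
    by (rule lext_in[OF hG.subJ _ v]) (rule opr_J[OF opr_foldr_lmul[OF listsHG] Dv_JS[OF w]])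
qed

lemma run_\<Phi>:
  assumes "v \<in> VH" "y \<in> VG"
  shows "run lmul y (\<Phi> a v) = \<Phi> a (run lmul y v)"
proof (rule Phi_intertwine[OF linon_lext subspace_fsv _ _ assms(1)])
  fix k v assume k: "k \<le> 2*n+1" "v \<in> VH"
  show "lmul (P k) v \<in> VH" using k by (simp add: lmul_fsv)
  show "run lmul y (lmul (P k) v) = lmul (P k) (run lmul y v)"
    by (rule run_lmul[OF repD(4)[OF repGH] subspace_fsv assms(2) k(2)]) (use k in simp)
qed

lemma D_foldr_lmul:
  assumes "a \<in> GS" "u \<in> lists (GH n)" "y \<in> VG"
  shows "foldr lmul u (D a y) - D a (foldr lmul u y) \<in> JG"
  using assms(2)
proof induction
  case Nil
  then show ?case by (simp add: vs.subspace_0[OF hG.subJ])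
next
  case (Cons x u)
  have y: "foldr lmul u y \<in> VG" by (rule opr_V[OF opr_foldr_lmul[OF listsHG[OF Cons.hyps(2)]] assms(3)])
  have "lmul x (foldr lmul u (D a y) - D a (foldr lmul u y)) \<in> JG"
    by (rule opr_J[OF opr_lmul[OF GH_Gl[OF Cons.hyps(1)]] Cons.IH])
  then have 1: "lmul x (foldr lmul u (D a y)) - lmul x (D a (foldr lmul u y)) \<in> JG"
    by (simp add: linon_diff[OF linon_lmul vs.subspace_UNIV])
  have 2: "D a (lmul x (foldr lmul u y)) - lmul x (D a (foldr lmul u y)) \<in> JG"
    by (rule D_GH[OF assms(1) Cons.hyps(1) y])
  show ?case using hG.J_closed(2)[OF 1 2] by simp
qed

text \<open>An sl2 letter acts on u (x) s by \<open>\<Phi> a\<close> on u plus \<open>a\<close> on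
  s. Under \<open>S\<close> this becomes \<open>\<Phi> a\<close> plus \<open>D a\<close>, which is
  \<open>a\<close> by definition of \<open>D\<close>; moving \<open>D a\<close> past the word u
  costs an element of \<open>JG\<close>.\<close>

lemma S_\<rho>:
  assumes a: "a \<in> Gl n" and x: "x \<in> VT"
  shows "S (\<rho> a x) - lmul a (S x) \<in> JG"
proof (rule tp_into[OF _ hG.subJ _ x])
  have "opr VT (TJ JS) (\<rho> a)" using repD(4)[OF repT[OF submS_JS]] a by blast
  then show "linon VT (\<lambda>x. S (\<rho> a x) - lmul a (S x))"
    by (intro linon_minus linon_comp[OF linon_tact linon_S] linon_comp[OF linon_S linon_lmul[of UNIV]])
      (auto simp: opr_def)
  fix u s assume u: "u \<in> lists (GH n)" and s: "s \<in> lists GS"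
  have us: "dlt u \<in> VH" "dlt s \<in> VS" using u s by auto
  let ?y = "Dv (dlt s)"
  let ?X = "run lmul ?y (dlt u)"
  have y: "?y \<in> VG" by (rule Dv_VG[OF us(2)])
  have X: "S (tp (dlt u) (dlt s)) = ?X" by (rule S_tp[OF us])
  show "S (\<rho> a (tp (dlt u) (dlt s))) - lmul a (S (tp (dlt u) (dlt s))) \<in> JG"
  proof (cases "a \<in> GS")
    case True
    have V: "\<Phi> a (dlt u) \<in> VH" "lmul a (dlt s) \<in> VS"
      using opr_V[OF hH.opr_Phi us(1)] lmul_fsv[OF True us(2)] by auto
    have "S (\<rho> a (tp (dlt u) (dlt s))) = S (tp (\<Phi> a (dlt u)) (dlt s)) + S (tp (dlt u) (lmul a (dlt s)))"
      unfolding \<rho>_GS[OF True us] using V us by (intro linon_add[OF linon_S[of "lists (GH n) \<times> lists GS"]] tp_fsv)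
    also have "S (tp (\<Phi> a (dlt u)) (dlt s)) = \<Phi> a ?X"
      using S_tp[OF V(1) us(2)] run_\<Phi>[OF us(1) y] by simp
    also have "S (tp (dlt u) (lmul a (dlt s))) = foldr lmul u (D a ?y)"
      using S_tp[OF us(1) V(2)] by simp
    finally have st: "S (\<rho> a (tp (dlt u) (dlt s))) = \<Phi> a ?X + foldr lmul u (D a ?y)" .
    have eq: "S (\<rho> a (tp (dlt u) (dlt s))) - lmul a ?X = foldr lmul u (D a ?y) - D a ?X"
      unfolding st D_def[of a ?X] by (simp only: diff_diff_eq2 add.commute)
    show ?thesis unfolding X eq using D_foldr_lmul[OF True u y] by simp
  next
    case False
    then have a': "a \<in> GH n" using a by (auto simp: Gl_iff)
    have "lmul a (dlt u) \<in> VH" by (rule lmul_fsv[OF a' us(1)])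
    then have "S (\<rho> a (tp (dlt u) (dlt s))) = lmul a ?X"
      unfolding \<rho>_GH[OF a' us] using S_tp[OF _ us(2)] by simp
    then show ?thesis unfolding X by (simp add: vs.subspace_0[OF hG.subJ])
  qed
qed

text \<open>Induction on the word, as both maps commute with letters modulo the ideals. Injectivity
  of \<open>T\<close> needs only this composition and \<open>S_TJ\<close>; surjectivity takes the
  place of the opposite composition.\<close>

lemma ST:
  assumes "v \<in> VG"
  shows "S (T v) - v \<in> JG"
proof (rule linon_into_fsv[OF _ hG.subJ _ assms])
  show "linon VG (\<lambda>v. S (T v) - v)"
    by (intro linon_minus linon_id linon_comp[OF linon_T linon_S[of "lists (GH n) \<times> lists GS"]]) auto
  fix w assume "w \<in> lists (Gl n)"
  then show "S (T (dlt w)) - dlt w \<in> JG"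
  proof induction
    case Nil
    have "S (T (dlt [])) = dlt []" by (simp add: T_def vacuum_def S_tp)
    then show ?case by (simp add: vs.subspace_0[OF hG.subJ])
  next
    case (Cons a w)
    then have w: "dlt w \<in> VG" by simp
    have 1: "S (\<rho> a (T (dlt w))) - lmul a (S (T (dlt w))) \<in> JG"
      by (rule S_\<rho>[OF Cons.hyps(1) T_V[OF w]])
    have "lmul a (S (T (dlt w)) - dlt w) \<in> JG" by (rule opr_J[OF opr_lmul[OF Cons.hyps(1)] Cons.IH])
    then have 2: "lmul a (S (T (dlt w))) - dlt (a # w) \<in> JG"
      by (simp add: linon_diff[OF linon_lmul vs.subspace_UNIV])
    show ?case using hG.J_trans[OF 1 2] T_lmul[OF Cons.hyps(1) w] by simp
  qed
qed

lemma T_iff: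
  assumes "v \<in> VG"
  shows "T v \<in> TJ JS \<longleftrightarrow> v \<in> JG"
proof
  assume "T v \<in> TJ JS"
  then have 1: "S (T v) \<in> JG" by (rule S_TJ)
  show "v \<in> JG" using hG.J_closed(2)[OF 1 ST[OF assms]] by simp
qed (rule T_JG)

text \<open>The image is stable under all letters and contains the vacuum tensor. Heisenberg letters
  act on the first factor alone and give all v (x) 1; sl2 letters are then added one at a time by v
  (x) as = a(v (x) s) - (Phi a v) (x) s.\<close>

lemma T_surj:
  assumes "x \<in> VT"
  shows "\<exists>v\<in>VG. T v - x \<in> TJ JS"
proof -
  define I where "I = {x \<in> VT. \<exists>v\<in>VG. T v - x \<in> TJ JS}"
  have subI: "vs.subspace I"
  proof (rule vs.subspaceI)
    show "0 \<in> I" unfolding I_def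
      by (auto intro!: bexI[of _ 0] vs.subspace_0 simp: linon_zero[OF linon_T])
  next
    fix x y assume "x \<in> I" "y \<in> I"
    then obtain v w where vw: "x \<in> VT" "y \<in> VT" "v \<in> VG" "w \<in> VG" "T v - x \<in> TJ JS" "T w - y \<in> TJ JS"
      by (auto simp: I_def)
    have "T (v + w) - (x + y) = (T v - x) + (T w - y)" using vw by (simp add: linon_add[OF linon_T])
    then have "T (v + w) - (x + y) \<in> TJ JS" using vs.subspace_add[OF subspace_tjdl vw(5,6)] by (simp only:)
    then show "x + y \<in> I" using vw unfolding I_def
      by (auto intro!: bexI[of _ "v + w"] vs.subspace_add[OF subspace_fsv])
  next
    fix c x assume "x \<in> I"
    then obtain v where v: "x \<in> VT" "v \<in> VG" "T v - x \<in> TJ JS" by (auto simp: I_def)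
    have "T (vsc c v) - vsc c x = vsc c (T v - x)"
      using v by (simp add: linon_scale[OF linon_T] vs.scale_right_diff_distrib)
    then have "T (vsc c v) - vsc c x \<in> TJ JS" using vs.subspace_scale[OF subspace_tjdl v(3)] by (simp only:)
    then show "vsc c x \<in> I" using v unfolding I_def
      by (auto intro!: bexI[of _ "vsc c v"] vs.subspace_scale[OF subspace_fsv])
  qed
  have stab: "\<rho> a x \<in> I" if ax: "a \<in> Gl n" "x \<in> I" for a x
  proof -
    have o: "opr VT (TJ JS) (\<rho> a)" using repD(4)[OF repT[OF submS_JS]] that by blast
    obtain v where v: "x \<in> VT" "v \<in> VG" "T v - x \<in> TJ JS" using ax(2) by (auto simp: I_def)
    have "\<rho> a (T v - x) \<in> TJ JS" by (rule opr_J[OF o v(3)])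
    then have "T (lmul a v) - \<rho> a x \<in> TJ JS"
      by (simp only: linon_diff[OF linon_tact subspace_fsv T_V[OF v(2)] v(1)] T_lmul[OF ax(1) v(2)])
    then show ?thesis using opr_V[OF o v(1)] lmul_VG[OF ax(1) v(2)] by (auto simp: I_def)
  qed
  \<comment> \<open>The induction on \<open>s\<close> is over all \<open>v\<close>, since its step
    replaces \<open>v\<close> by \<open>\<Phi> a v\<close>.\<close>
  have base: "tp v (dlt s) \<in> I" if "s \<in> lists GS" "v \<in> VH" for s v
    using that
  proof (induction s arbitrary: v)
    case Nil
    show ?case
    proof (rule linon_into_fsv[OF linon_tp1 subI _ Nil.prems])
      fix u assume "u \<in> lists (GH n)"
      then show "tp (dlt u) (dlt []) \<in> I"
      proof induction
        case Nil
        have "T (dlt []) = vacuum" by (simp add: T_def)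
        then have "vacuum \<in> I" unfolding I_def by (auto intro!: bexI[of _ "dlt []"] vs.subspace_0)
        then show ?case by (simp add: vacuum_def)
      next
        case (Cons a u)
        then show ?case using stab[OF GH_Gl[OF Cons.hyps(1)] Cons.IH] \<rho>_GH[of a "dlt u" "dlt []"] by simp
      qed
    qed
  next
    case (Cons a s)
    have "\<rho> a (tp v (dlt s)) - tp (\<Phi> a v) (dlt s) \<in> I"
      using Cons by (intro vs.subspace_diff[OF subI] stab GS_Gl Cons.IH opr_V[OF hH.opr_Phi]) auto
    then show ?case using \<rho>_GS[OF Cons.hyps(1) Cons.prems, of "dlt s"] Cons.hyps(2) by simp
  qed
  have "x \<in> I"
    by (rule tp_into[OF linon_id subI _ assms]) (rule base, auto)
  then show ?thesis by (auto simp: I_def)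
qed

text \<open>Formulated for any \<open>K\<close> and its preimage \<open>N\<close> under
  \<open>T\<close>, so that one map proves both isomorphisms.\<close>

lemma iso_T:
  assumes K: "submS K" and N: "\<And>v. v \<in> VG \<Longrightarrow> T v \<in> TJ K \<longleftrightarrow> v \<in> N"
  shows "pmod_iso (Gl n) (lists (Gl n), N, lmul) (lists (GH n) \<times> lists GS, TJ K, \<rho>)"
proof -
  have "\<exists>v\<in>VG. T v - x \<in> TJ K" if "x \<in> VT" for x
    using T_surj[OF that] tjdl_mono[of JS K VH JH VS] K unfolding submS_def by blast
  moreover have "0 \<in> TJ K" by (rule vs.subspace_0) simp
  ultimately show ?thesis
    unfolding pmod_iso_def bas_def jdl_def act_def vadd_eq vsub_eq
    using N linon_T T_lmul by (intro exI[of _ T]) (auto simp: linon_def)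
qed

lemma verma_iso: "pmod_iso (Gl n) (Mg n zdot hdot) (tensor (MHg n zdot) (Msl2g mu))"
  unfolding Mg_eq MHg_eq Msl2g_eq tensor_eq using submS_JS T_iff by (rule iso_T)

end

section \<open>Models of the Fock module and of the Verma module of \<open>sl\<^sub>2\<close>\<close>

text \<open>A function of the exponent \<open>\<alpha>\<close> lists the coefficients of a formal
  power series. In these terms the formula is multiplication by the i-th variable, and that of
  \<open>deriv_var\<close> the partial derivative.\<close>

definition mult_var :: "nat \<Rightarrow> (nat \<Rightarrow> nat) vec \<Rightarrow> (nat \<Rightarrow> nat) vec" where
  "mult_var i g = (\<lambda>\<alpha>. if \<alpha> i = 0 then 0 else g (\<alpha>(i := \<alpha> i - 1)))"

definition deriv_var :: "nat \<Rightarrow> (nat \<Rightarrow> nat) vec \<Rightarrow> (nat \<Rightarrow> nat) vec" where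
  "deriv_var i g = (\<lambda>\<alpha>. of_nat (Suc (\<alpha> i)) * g (\<alpha>(i := Suc (\<alpha> i))))"

lemma mult_var_commute: "mult_var i (mult_var j g) = mult_var j (mult_var i g)"
  by (cases "i = j") (auto simp: mult_var_def fun_eq_iff fun_upd_twist[of i j])

lemma deriv_var_commute: "deriv_var i (deriv_var j g) = deriv_var j (deriv_var i g)"
  by (cases "i = j") (auto simp: deriv_var_def fun_eq_iff fun_upd_twist[of i j])

lemma deriv_var_mult_var: "i \<noteq> j \<Longrightarrow> deriv_var i (mult_var j g) = mult_var j (deriv_var i g)"
  by (auto simp: deriv_var_def mult_var_def fun_eq_iff fun_upd_twist[of i j])

lemma deriv_var_mult_var_same: "deriv_var i (mult_var i g) = mult_var i (deriv_var i g) + g"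
proof
  fix \<alpha>
  show "deriv_var i (mult_var i g) \<alpha> = (mult_var i (deriv_var i g) + g) \<alpha>"
    by (cases "\<alpha> i") (simp_all add: deriv_var_def mult_var_def plus_fun_apply fun_upd_idem algebra_simps)
qed

lemma mult_var_vsc: "mult_var i (vsc c g) = vsc c (mult_var i g)" and deriv_var_vsc: "deriv_var i (vsc c g) = vsc c (deriv_var i g)"
  by (auto simp: mult_var_def deriv_var_def vsc_apply)

lemma linon_mult_var: "linon V (mult_var i)"
  by (rule linonI) (auto simp: mult_var_def fun_eq_iff vec_simps)

lemma linon_deriv_var: "linon V (deriv_var i)"
  by (rule linonI) (auto simp: deriv_var_def fun_eq_iff vec_simps algebra_simps)

text \<open>A power series in variables \<open>x\<^sub>i\<close> is stored as its coefficient function.  The letter \<open>p\<^sub>k\<close> with \<open>k > n\<close>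
  multiplies by \<open>x\<^sub>k\<close>; for \<open>k \<le> n\<close> it differentiates in the dual variable \<open>x\<^bsub>2n+1-k\<^esub>\<close>.\<close>

fun fock :: "nat \<Rightarrow> complex \<Rightarrow> gen \<Rightarrow> (nat \<Rightarrow> nat) vec \<Rightarrow> (nat \<Rightarrow> nat) vec" where
  "fock n zdot (P k) g = (if k \<le> n then vsc (gm n k * zdot) (deriv_var (2*n+1-k) g) else mult_var k g)"
| "fock n zdot _ g = vsc zdot g"

lemma rep_fock: "rep n (GH n) UNIV {0} (fock n zdot)"
  unfolding rep_def
proof (intro conjI ballI)
  show "opr UNIV {0} (fock n zdot a)" for a
  proof -
    have "linon UNIV (\<lambda>g. fock n zdot a g)"
    proof (cases a)
      case (P k)
      then show ?thesis by (cases "k \<le> n") (simp_all add: linon_vsc linon_deriv_var linon_mult_var)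
    qed (auto intro!: linon_vsc linon_id)
    then show ?thesis using linon_zero[OF _ vs.subspace_UNIV] by (auto simp: opr_def)
  qed
  fix a b and v :: "(nat \<Rightarrow> nat) vec"
  assume "a \<in> GH n" "b \<in> GH n"
  then consider "a = Z \<or> b = Z" | j k where "a = P j" "b = P k" "j \<le> 2*n+1" "k \<le> 2*n+1"
    by (auto simp: GH_def)
  then show "fock n zdot a (fock n zdot b v) - fock n zdot b (fock n zdot a v) - run (fock n zdot) v (brk n a b) \<in> {0}"
  proof cases
    case 1
    have "brk n Z d = 0" "brk n d Z = 0" for d by (cases d; simp add: vzero_eq)+
    moreover have "fock n zdot c (vsc d v) = vsc d (fock n zdot c v)" for c d
      by (cases c) (auto simp: mult_var_vsc deriv_var_vsc mult.commute)
    ultimately show ?thesis using 1 by auto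
  next
    case 2
    have c: "run (fock n zdot) v (brk n a b) = vsc (if j + k = 2*n+1 then gm n j * zdot else 0) v"
      using 2 by (simp add: gm_def vzero_eq del: of_nat_mult)
    \<comment> \<open>Used when the creator stands first: the commutator then changes sign, and so
      does the constant.\<close>
    have f: "gm n j = - gm n k" if "j + k = 2*n+1"
      using that gm_flip[of k n] by (metis add_diff_cancel_right' le_add2)
    show ?thesis
    proof (cases "j \<le> n"; cases "k \<le> n")
      assume jk: "j \<le> n" "k \<le> n"
      then show ?thesis unfolding c using 2 deriv_var_commute[of "2*n+1-j" "2*n+1-k" v] by (simp add: deriv_var_vsc mult.commute)
    next
      assume jk: "j \<le> n" "\<not> k \<le> n"
      show ?thesis
      proof (cases "j + k = 2*n+1")
        case True
        then have "2*n+1-j = k" by simp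
        then show ?thesis unfolding c using 2 jk True
          by (simp add: mult_var_vsc deriv_var_mult_var_same vs.scale_right_distrib)
      next
        case False
        then have "2*n+1-j \<noteq> k" using 2(3) by simp
        then show ?thesis unfolding c using 2 jk False by (simp add: mult_var_vsc deriv_var_mult_var)
      qed
    next
      assume jk: "\<not> j \<le> n" "k \<le> n"
      show ?thesis
      proof (cases "j + k = 2*n+1")
        case True
        then have "2*n+1-k = j" by simp
        then show ?thesis unfolding c using 2 jk True f
          by (simp add: mult_var_vsc deriv_var_mult_var_same vs.scale_right_distrib)
      next
        case False
        then have "2*n+1-k \<noteq> j" using 2(4) by simp
        then show ?thesis unfolding c using 2 jk False by (simp add: mult_var_vsc deriv_var_mult_var)
      qed
    next
      assume jk: "\<not> j \<le> n" "\<not> k \<le> n"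
      then show ?thesis unfolding c using 2 by (simp add: mult_var_commute[of j])
    qed
  qed
qed (auto simp: vs.subspace_0)

text \<open>The coordinate \<open>g j\<close> belongs to the vector f^j w of the Verma module.
  \<open>E\<close> reads index \<open>j + 1\<close> because e f^(j+1) w = (j+1)(mu-j) f^j w.\<close>

fun slm :: "complex \<Rightarrow> gen \<Rightarrow> nat vec \<Rightarrow> nat vec" where
  "slm mu E g = (\<lambda>j. of_nat (j + 1) * (mu - of_nat j) * g (j + 1))"
| "slm mu H g = (\<lambda>j. (mu - 2 * of_nat j) * g j)"
| "slm mu F g = (\<lambda>j. if j = 0 then 0 else g (j - 1))"
| "slm mu _ g = 0"

lemma rep_slm: "rep 0 GS (fsv UNIV) {0} (slm mu)"
  unfolding rep_def
proof (intro conjI ballI)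
  fix a assume a: "a \<in> GS"
  have lin: "linon V (slm mu a)" for V
    using a by (auto simp: GS_def linon_def fun_eq_iff vec_simps algebra_simps)
  have "slm mu a v \<in> fsv UNIV" if "v \<in> fsv UNIV" for v
  proof (rule linon_into_fsv[OF lin subspace_fsv _ that])
    fix i :: nat
    have "slm mu a (dlt i) \<in> fsv {i - 1, i, i + 1}"
      using a by (auto simp: GS_def fsv_iff dlt_apply split: if_splits intro: finite_subset[of _ "{i - 1, i, i + 1}"])
    then show "slm mu a (dlt i) \<in> fsv UNIV" by (rule fsv_UNIV)
  qed
  then show "opr (fsv UNIV) {0} (slm mu a)"
    using lin[of UNIV] linon_zero[OF lin vs.subspace_UNIV] by (auto simp: opr_def linon_def)
next
  fix a b and v :: "nat vec" assume "a \<in> GS" "b \<in> GS"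
  then show "slm mu a (slm mu b v) - slm mu b (slm mu a v) - run (slm mu) v (brk 0 a b) \<in> {0}"
    by (auto simp: GS_def fun_eq_iff vec_simps vzero_eq uminus_apply algebra_simps of_nat_diff)
qed (auto simp: vs.subspace_0)

context setting
begin

text \<open>By \<open>lam_JH\<close> and \<open>psi_JS\<close> these evaluations in the models
  depend only on classes modulo the ideals; their values are the evidence that the presented
  quotients do not collapse.\<close>

abbreviation "lam \<equiv> run (fock n zdot) (dlt (\<lambda>_. 0))"
abbreviation "psi \<equiv> run (slm mu) (dlt 0)"

lemma lam_JH: "v \<in> JH \<Longrightarrow> lam v = 0"
proof -
  assume v: "v \<in> JH"
  have "lam v \<in> {0}"
  proof (rule universal[OF rep_fock brk_closed_GH CH_sub _ _ v])
    fix y c assume "(y, c) \<in> CH n zdot"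
    then show "fock n zdot y (dlt (\<lambda>_. 0)) - vsc c (dlt (\<lambda>_. 0)) \<in> {0}"
      by (auto simp: CH_def deriv_var_def fun_eq_iff vec_simps dlt_apply)
  qed simp
  then show ?thesis by simp
qed

lemma psi_JS: "v \<in> JS \<Longrightarrow> psi v = 0"
proof -
  assume v: "v \<in> JS"
  have "psi v \<in> {0}"
    by (rule universal[OF rep_slm brk_closed_GS CS_sub _ _ v])
      (auto simp: CS_def fun_eq_iff vec_simps dlt_apply)
  then show ?thesis by simp
qed

lemma psi_fsv: "v \<in> VS \<Longrightarrow> psi v \<in> fsv UNIV"
  by (rule run_in[OF repD(4)[OF rep_slm]]) auto

lemma psi_lmul: "a \<in> GS \<Longrightarrow> v \<in> VS \<Longrightarrow> psi (lmul a v) = slm mu a (psi v)"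
  by (rule run_lmul[OF repD(4)[OF rep_slm]]) auto

abbreviation "sec \<equiv> lext (\<lambda>j. dlt (replicate j F))"

lemma lmul_VS: "a \<in> GS \<Longrightarrow> v \<in> VS \<Longrightarrow> lmul a v \<in> VS"
  by (rule lmul_fsv)

lemma subJS: "vs.subspace JS"
  by (rule repD(2)[OF repS])

lemma GS_simps [simp]: "E \<in> GS" "H \<in> GS" "F \<in> GS"
  by (auto simp: GS_def)

lemma H_F: "dlt (H # replicate j F) - vsc (mu - 2 * of_nat j) (dlt (replicate j F)) \<in> JS"
proof (induction j)
  case 0
  then show ?case using S_H by simp
next
  case (Suc j)
  let ?x = "dlt (replicate j F) :: gen list vec"
  have x: "?x \<in> VS" by auto
  have 1: "lmul H (lmul F ?x) - lmul F (lmul H ?x) - vsc (-2) (lmul F ?x) \<in> JS"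
    using repD(5)[OF repS _ _ x, of H F] by simp
  have "lmul F (dlt (H # replicate j F) - vsc (mu - 2 * of_nat j) ?x) \<in> JS"
    by (rule lmul_pideal[OF brk_closed_GS CS_sub _ Suc.IH]) simp
  then have 2: "lmul F (lmul H ?x) - vsc (mu - 2 * of_nat j) (lmul F ?x) \<in> JS"
    by (simp add: linon_diff[OF linon_lmul vs.subspace_UNIV] linon_scale[OF linon_lmul, where V = UNIV])
  have eq: "dlt (H # replicate (Suc j) F) - vsc (mu - 2 * of_nat (Suc j)) (dlt (replicate (Suc j) F))
    = (lmul H (lmul F ?x) - lmul F (lmul H ?x) - vsc (-2) (lmul F ?x)) + (lmul F (lmul H ?x) - vsc (mu - 2 * of_nat j) (lmul F ?x))"
    by (auto simp: fun_eq_iff vec_simps algebra_simps)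
  show ?case unfolding eq by (rule vs.subspace_add[OF subJS 1 2])
qed

lemma E_F: "dlt (E # replicate j F) - vsc (of_nat j * (mu - of_nat j + 1)) (dlt (replicate (j - 1) F)) \<in> JS"
proof (induction j)
  case 0
  then show ?case using S_E by simp
next
  case (Suc j)
  let ?x = "dlt (replicate j F) :: gen list vec"
  let ?c = "of_nat j * (mu - of_nat j + 1)"
  have x: "?x \<in> VS" by auto
  have 1: "lmul E (lmul F ?x) - lmul F (lmul E ?x) - lmul H ?x \<in> JS"
    using repD(5)[OF repS _ _ x, of E F] by simp
  have "lmul F (dlt (E # replicate j F) - vsc ?c (dlt (replicate (j - 1) F))) \<in> JS"
    by (rule lmul_pideal[OF brk_closed_GS CS_sub _ Suc.IH]) simp
  then have "lmul F (lmul E ?x) - vsc ?c (lmul F (dlt (replicate (j - 1) F))) \<in> JS"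
    by (simp add: linon_diff[OF linon_lmul vs.subspace_UNIV] linon_scale[OF linon_lmul, where V = UNIV])
  \<comment> \<open>At \<open>j = 0\<close> the truncated \<open>j - 1\<close> makes the two vectors
    differ, but then \<open>?c\<close> is zero.\<close>
  moreover have "vsc ?c (lmul F (dlt (replicate (j - 1) F))) = vsc ?c ?x" by (cases j) auto
  ultimately have 2: "lmul F (lmul E ?x) - vsc ?c ?x \<in> JS" by (simp only:)
  have 3: "lmul H ?x - vsc (mu - 2 * of_nat j) ?x \<in> JS" using H_F[of j] by simp
  have eq: "dlt (E # replicate (Suc j) F) - vsc (of_nat (Suc j) * (mu - of_nat (Suc j) + 1)) (dlt (replicate (Suc j - 1) F))
    = (lmul E (lmul F ?x) - lmul F (lmul E ?x) - lmul H ?x) + (lmul F (lmul E ?x) - vsc ?c ?x) + (lmul H ?x - vsc (mu - 2 * of_nat j) ?x)"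
    by (auto simp: fun_eq_iff vec_simps algebra_simps)
  show ?case unfolding eq by (rule vs.subspace_add[OF subJS vs.subspace_add[OF subJS 1 2] 3])
qed

lemma sec_slm:
  assumes "a \<in> GS" "g \<in> fsv UNIV"
  shows "lmul a (sec g) - sec (slm mu a g) \<in> JS"
proof (rule linon_into_fsv[OF _ subJS _ assms(2)])
  have o: "opr (fsv UNIV) {0} (slm mu a)" using repD(4)[OF rep_slm] assms(1) by blast
  show "linon (fsv UNIV) (\<lambda>g. lmul a (sec g) - sec (slm mu a g))"
    by (intro linon_minus linon_comp[OF linon_lext linon_lmul[of UNIV]]
        linon_comp[OF opr_linon[OF o] linon_lext[of UNIV]]) (use o in \<open>auto simp: opr_def\<close>)
  fix j :: nat
  consider "a = E" | "a = H" | "a = F" using assms(1) by (auto simp: GS_def)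
  then show "lmul a (sec (dlt j)) - sec (slm mu a (dlt j)) \<in> JS"
  proof cases
    case 1
    have "slm mu E (dlt j) = vsc (of_nat j * (mu - of_nat j + 1)) (dlt (j - 1))"
      by (cases j) (auto simp: fun_eq_iff vec_simps dlt_apply)
    then show ?thesis using E_F[of j] 1 by simp
  next
    case 2
    have "slm mu H (dlt j) = vsc (mu - 2 * of_nat j) (dlt j)"
      by (auto simp: fun_eq_iff vec_simps dlt_apply)
    then show ?thesis using H_F[of j] 2 by simp
  next
    case 3
    have "slm mu F (dlt j) = dlt (Suc j)"
      by (auto simp: fun_eq_iff dlt_apply)
    then show ?thesis using 3 by (simp add: vs.subspace_0[OF subJS])
  qed
qed

text \<open>\<open>sec\<close> commutes with the letters modulo \<open>JS\<close> and sends
  coordinates back to words. Hence \<open>psi\<close> is faithful: an element of \<open>VS\<close>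
  is determined modulo \<open>JS\<close> by its coordinates in the f^j w.\<close>

lemma sec_psi:
  assumes "v \<in> VS"
  shows "v - sec (psi v) \<in> JS"
proof (rule linon_into_fsv[OF _ subJS _ assms])
  show "linon VS (\<lambda>v. v - sec (psi v))"
    by (intro linon_minus linon_id linon_comp[OF linon_lext linon_lext[of UNIV]]) (auto intro: psi_fsv)
  fix w assume "w \<in> lists GS"
  then show "dlt w - sec (psi (dlt w)) \<in> JS"
  proof induction
    case Nil
    then show ?case by (simp add: vs.subspace_0[OF subJS])
  next
    case (Cons a w)
    have w: "dlt w \<in> VS" using Cons by simp
    have "lmul a (dlt w - sec (psi (dlt w))) \<in> JS"
      by (rule lmul_pideal[OF brk_closed_GS CS_sub Cons.hyps(1) Cons.IH])
    then have 1: "dlt (a # w) - lmul a (sec (psi (dlt w))) \<in> JS"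
      by (simp add: linon_diff[OF linon_lmul vs.subspace_UNIV])
    have 2: "lmul a (sec (psi (dlt w))) - sec (slm mu a (psi (dlt w))) \<in> JS"
      by (rule sec_slm[OF Cons.hyps(1) psi_fsv[OF w]])
    show ?case using vs.subspace_add[OF subJS 1 2] by simp
  qed
qed

lemma psi_0: "v \<in> VS \<Longrightarrow> psi v = 0 \<Longrightarrow> v \<in> JS"
  using sec_psi[of v] by simp

section \<open>Submodules of the Verma module of sl2\<close>

lemma submS_stable: "submS N \<Longrightarrow> a \<in> GS \<Longrightarrow> v \<in> N \<Longrightarrow> lmul a v \<in> N"
  by (auto simp: submS_def)

lemma submS_D:
  assumes "submS N"
  shows "vs.subspace N" "JS \<subseteq> N" "N \<subseteq> VS"
  using assms by (auto simp: submS_def)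

lemma submS_all:
  assumes N: "submS N" and "dlt [] \<in> N"
  shows "N = VS"
proof
  show "VS \<subseteq> N"
  proof
    fix v assume "v \<in> VS"
    then show "v \<in> N"
    proof (rule linon_into_fsv[OF linon_id submS_D(1)[OF N], rotated])
      fix w assume "w \<in> lists GS"
      then show "dlt w \<in> N"
        by induction (use assms(2) submS_stable[OF N] in \<open>auto simp flip: lmul_dlt\<close>)
    qed
  qed
qed (rule submS_D(3)[OF N])

text \<open>The eigenvalues mu - 2j of h are distinct, so \<open>H\<close> minus the top eigenvalue
  removes the top coordinate and keeps coordinate 0 nonzero; iterating leaves a nonzero multiple of
  the highest weight vector.\<close>

lemma submS_weight:
  assumes N: "submS N" and "v \<in> N" "\<And>j. j > d \<Longrightarrow> psi v j = 0" "psi v 0 \<noteq> 0"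
  shows "N = VS"
  using assms(2-4)
proof (induction d arbitrary: v)
  case 0
  have vS: "v \<in> VS" using 0 submS_D[OF N] by blast
  have "g = vsc (g 0) (dlt 0)" if "\<And>j. j > 0 \<Longrightarrow> g j = 0" for g :: "nat vec"
    using that by (auto simp: fun_eq_iff vec_simps dlt_apply)
  from this[OF 0(2)] have "psi v = vsc (psi v 0) (dlt 0)" .
  then have "sec (psi v) = vsc (psi v 0) (dlt [])"
    by (metis lext_vsc replicate_0)
  then have "v - vsc (psi v 0) (dlt []) \<in> N" using sec_psi[OF vS] submS_D(2)[OF N] by auto
  then have "vsc (psi v 0) (dlt []) \<in> N"
    using vs.subspace_diff[OF submS_D(1)[OF N] 0(1), of "v - vsc (psi v 0) (dlt [])"] by simp
  then have "vsc (1 / psi v 0) (vsc (psi v 0) (dlt [])) \<in> N"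
    by (rule vs.subspace_scale[OF submS_D(1)[OF N]])
  then show ?case using 0(3) submS_all[OF N] by simp
next
  case (Suc d)
  have vS: "v \<in> VS" using Suc.prems submS_D[OF N] by blast
  \<comment> \<open>The weight of index \<open>Suc d\<close>: coordinate j is multiplied by
    2(d+1-j), which vanishes at j = d+1 but not at 0.\<close>
  define c where "c = mu - 2 * of_nat (Suc d)"
  let ?w = "lmul H v - vsc c v"
  have w: "?w \<in> N"
    using Suc.prems(1) submS_stable[OF N] by (intro vs.subspace_diff vs.subspace_scale submS_D(1)[OF N]) auto
  have eq: "psi ?w = slm mu H (psi v) - vsc c (psi v)"
    by (simp only: psi_lmul[OF GS_simps(2) vS] linon_scale[OF linon_lext vS]
        linon_diff[OF linon_lext subspace_fsv lmul_VS[OF GS_simps(2) vS] vs.subspace_scale[OF subspace_fsv vS]])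
  have p: "psi ?w j = (2 * of_nat (Suc d) - 2 * of_nat j) * psi v j" for j
    unfolding eq by (simp add: vec_simps c_def algebra_simps)
  show ?case
  proof (rule Suc.IH[OF w])
    show "psi ?w j = 0" if "j > d" for j
      using Suc.prems(2)[of j] that unfolding p by (cases "j = Suc d") auto
    show "psi ?w 0 \<noteq> 0" using Suc.prems(3) unfolding p by (simp del: of_nat_Suc)
  qed
qed

lemma psi_bound:
  assumes "v \<in> VS"
  shows "\<exists>d. \<forall>j>d. psi v j = 0"
proof -
  have "\<exists>d. \<forall>j>d. g j = 0" if "g \<in> fsv UNIV" for g :: "nat vec"
  proof -
    have "finite {j. g j \<noteq> 0}" using that by (simp add: fsv_iff)
    then obtain d where "\<forall>j\<in>{j. g j \<noteq> 0}. j \<le> d"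
      unfolding finite_nat_set_iff_bounded_le ..
    then show ?thesis by (intro exI[of _ d]) auto
  qed
  from this[OF psi_fsv[OF assms]] show ?thesis .
qed

lemma proper_psi:
  assumes "submS N" "N \<noteq> VS" "v \<in> N"
  shows "psi v 0 = 0"
proof (rule ccontr)
  assume nz: "psi v 0 \<noteq> 0"
  have "v \<in> VS" using assms(3) submS_D(3)[OF assms(1)] by blast
  from psi_bound[OF this] obtain d where d: "\<forall>j>d. psi v j = 0" ..
  have "N = VS" by (rule submS_weight[OF assms(1,3) _ nz]) (rule d[rule_format])
  then show False using assms(2) by blast
qed

text \<open>\<open>E\<close> lowers the top index from d+1 to d with the factor (d+1)(mu-d), which
  is nonzero unless \<open>mu\<close> is a natural number. Repetition leads to index 0.\<close>

lemma submS_generic: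
  assumes N: "submS N" and mu: "mu \<notin> range of_nat" and "v \<in> N" "psi v d \<noteq> 0" "\<And>j. j > d \<Longrightarrow> psi v j = 0"
  shows "N = VS"
  using assms(3-5)
proof (induction d arbitrary: v)
  case 0
  show ?case by (rule submS_weight[OF N 0(1) 0(3) 0(2)])
next
  case (Suc d)
  have vS: "v \<in> VS" using Suc.prems(1) submS_D(3)[OF N] by blast
  have p: "psi (lmul E v) j = of_nat (j + 1) * (mu - of_nat j) * psi v (j + 1)" for j
    using psi_lmul[OF _ vS, of E] by simp
  have "mu - of_nat d \<noteq> 0" using mu by auto
  then have "psi (lmul E v) d \<noteq> 0" using Suc.prems(2) unfolding p by (simp del: of_nat_Suc)
  moreover have "psi (lmul E v) j = 0" if "j > d" for j
    using Suc.prems(3)[of "j + 1"] that unfolding p by simp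
  ultimately show ?case by (rule Suc.IH[OF submS_stable[OF N GS_simps(1) Suc.prems(1)]])
qed

lemma simple_generic:
  assumes N: "submS N" and mu: "mu \<notin> range of_nat" and "N \<noteq> VS"
  shows "N = JS"
proof
  show "N \<subseteq> JS"
  proof
    fix v assume v: "v \<in> N"
    then have vS: "v \<in> VS" using submS_D(3)[OF N] by blast
    have top: "\<exists>d. g d \<noteq> 0 \<and> (\<forall>j>d. g j = 0)" if "g \<in> fsv UNIV" "g \<noteq> 0" for g :: "nat vec"
    proof -
      have ne: "{j. g j \<noteq> 0} \<noteq> {}" using that(2) by (auto simp: fun_eq_iff zero_fun_apply)
      have fin: "finite {j. g j \<noteq> 0}" using that(1) by (simp add: fsv_iff)
      have "\<forall>j>Max {j. g j \<noteq> 0}. g j = 0" using Max_ge[OF fin] by fastforce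
      then show ?thesis using Max_in[OF fin ne] by blast
    qed
    have "psi v = 0"
    proof (rule ccontr)
      assume "psi v \<noteq> 0"
      from top[OF psi_fsv[OF vS] this] obtain d where d: "psi v d \<noteq> 0 \<and> (\<forall>j>d. psi v j = 0)" ..
      have "N = VS"
        by (rule submS_generic[OF N mu v conjunct1[OF d]]) (rule conjunct2[OF d, rule_format])
      then show False using assms(3) by simp
    qed
    then show "v \<in> JS" by (rule psi_0[OF vS])
  qed
qed (rule submS_D(2)[OF N])

text \<open>The span of the f^j w with j > m: f and h preserve it, and the only step of e that could
  leave it, from m+1 to m, carries the factor mu - m = 0.\<close>

lemma submS_singular:
  assumes "mu = of_nat m"
  shows "submS {v \<in> VS. \<forall>j\<le>m. psi v j = 0}"
proof -
  let ?N = "{v \<in> VS. \<forall>j\<le>m. psi v j = 0}"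
  have lin: "psi (x + y) = psi x + psi y" "psi (vsc c x) = vsc c (psi x)" if "x \<in> VS" "y \<in> VS" for x y c
    using that linon_add[OF linon_lext] linon_scale[OF linon_lext] by blast+
  have "vs.subspace ?N"
    using lin by (intro vs.subspaceI)
      (auto simp: vec_simps intro: vs.subspace_add[OF subspace_fsv] vs.subspace_scale[OF subspace_fsv] vs.subspace_0[OF subspace_fsv])
  moreover have "JS \<subseteq> ?N" using psi_JS repD(3)[OF repS] by (auto simp: zero_fun_apply)
  moreover have "lmul a v \<in> ?N" if "a \<in> GS" "v \<in> ?N" for a v
  proof -
    have "psi (lmul a v) j = 0" if "j \<le> m" for j
    proof -
      have "psi v (j + 1) = 0 \<or> mu - of_nat j = 0" using \<open>v \<in> ?N\<close> \<open>j \<le> m\<close> assms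
        by (cases "j = m") auto
      then show ?thesis using \<open>v \<in> ?N\<close> \<open>j \<le> m\<close> \<open>a \<in> GS\<close> psi_lmul[of a v] by (auto simp: GS_def)
    qed
    then show ?thesis using that lmul_VS by auto
  qed
  ultimately show ?thesis by (auto simp: submS_def)
qed

lemma psi_F: "psi (dlt (replicate j F)) = dlt j"
proof (induction j)
  case (Suc j)
  have "psi (dlt (replicate (Suc j) F)) = slm mu F (psi (dlt (replicate j F)))" by simp
  also have "\<dots> = slm mu F (dlt j)" by (simp only: Suc)
  also have "\<dots> = dlt (Suc j)" by (auto simp: fun_eq_iff dlt_apply)
  finally show ?case .
qed simp

section \<open>Detecting elements of the tensor product in the models\<close>

definition theta :: "(gen list \<times> gen list) vec \<Rightarrow> ((nat \<Rightarrow> nat) \<times> nat) vec" where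
  "theta = lext (\<lambda>(u, s). tp (lam (dlt u)) (psi (dlt s)))"

lemma theta_tp:
  assumes "v \<in> VH" "w \<in> VS"
  shows "theta (tp v w) = tp (lam v) (psi w)"
proof (rule bilinear_eq[OF _ _ _ _ _ assms])
  show "linon VH (\<lambda>v. theta (tp v w))" if "w \<in> VS" for w
    unfolding theta_def
    by (rule linon_comp[OF linon_tp1 linon_lext[of "lists (GH n) \<times> lists GS"]]) (use that in \<open>auto intro: tp_fsv\<close>)
  show "linon VS (\<lambda>w. theta (tp (dlt u) w))" if "u \<in> lists (GH n)" for u
    unfolding theta_def
    by (rule linon_comp[OF linon_tp2 linon_lext[of "lists (GH n) \<times> lists GS"]]) (use that in \<open>auto intro: tp_fsv\<close>)
  show "linon VH (\<lambda>v. tp (lam v) (psi w))" for w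
    by (rule linon_comp[OF linon_lext linon_tp1[of UNIV]]) auto
  show "linon VS (\<lambda>w. tp (lam (dlt u)) (psi w))" for u
    by (rule linon_comp[OF linon_lext linon_tp2[of UNIV]]) auto
qed (simp add: theta_def tp_dlt)

text \<open>Reading one coefficient after \<open>theta\<close> is a functional that vanishes on
  \<open>TJ K\<close>: \<open>lam\<close> kills \<open>JH\<close>, and coordinate \<open>j\<close>
  of \<open>psi\<close> kills \<open>K\<close>. On 1 (x) w it returns \<open>psi w j\<close>, since
  the vacuum becomes the constant series 1. So a single coordinate can refute membership in
  \<open>TJ K\<close>.\<close>

lemma TJ_psi:
  assumes K: "submS K" "\<And>w. w \<in> K \<Longrightarrow> psi w j = 0" and w: "w \<in> VS" "tp (dlt []) w \<in> TJ K"
  shows "psi w j = 0"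
proof -
  let ?U = "{g :: ((nat \<Rightarrow> nat) \<times> nat) vec. g (\<lambda>_. 0, j) = 0}"
  have "theta (tp (dlt []) w) \<in> ?U"
  proof (rule tjdl_into[OF repD(3)[OF repH] submS_D(3)[OF K(1)] _ _ _ _ w(2)])
    show "linon VT theta" unfolding theta_def by (rule linon_lext)
    show "vs.subspace ?U" by (rule vs.subspaceI) (auto simp: vec_simps)
    show "theta (tp v w) \<in> ?U" if "v \<in> JH" "w \<in> VS" for v w
      using that repD(3)[OF repH] by (subst theta_tp) (auto simp: lam_JH tp_def zero_fun_apply)
    show "theta (tp v w) \<in> ?U" if "v \<in> VH" "w \<in> K" for v w
      using that K submS_D(3)[OF K(1)] by (subst theta_tp) (auto simp: tp_def)
  qed
  then show ?thesis using w(1) by (simp add: theta_tp) (simp add: tp_def dlt_apply)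
qed

section \<open>Submodules of the tensor product\<close>

definition creators :: "gen set" where
  "creators = P ` {n+1..2*n+1}"

lemma creators_GH: "u \<in> lists creators \<Longrightarrow> u \<in> lists (GH n)"
  by (auto simp: creators_def)

text \<open>The bound is strict: level \<open>d\<close> holds the degrees below \<open>d\<close>, so
  level 0 is zero in the quotient and can start the descent.\<close>

definition filtH :: "nat \<Rightarrow> gen list vec set" where
  "filtH d = vs.span (JH \<union> {dlt u | u. u \<in> lists creators \<and> length u < d})"

lemma subspace_filtH [simp]: "vs.subspace (filtH d)"
  by (simp add: filtH_def)

lemma JH_filtH: "v \<in> JH \<Longrightarrow> v \<in> filtH d"
  unfolding filtH_def by (blast intro: vs.span_base)

lemma dlt_filtH: "u \<in> lists creators \<Longrightarrow> length u < d \<Longrightarrow> dlt u \<in> filtH d"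
  unfolding filtH_def by (blast intro: vs.span_base)

lemma filtH_gen: "JH \<union> {dlt u | u. u \<in> lists creators \<and> length u < d} \<subseteq> VH"
proof (intro Un_least subsetI)
  show "v \<in> VH" if "v \<in> JH" for v using that repD(3)[OF repH] by blast
  show "v \<in> VH" if v: "v \<in> {dlt u | u. u \<in> lists creators \<and> length u < d}" for v
  proof -
    obtain u where u: "v = dlt u" "u \<in> lists creators" using v by blast
    show ?thesis unfolding u(1) using creators_GH[OF u(2)] by simp
  qed
qed

lemma filtH_mono: "d \<le> e \<Longrightarrow> filtH d \<subseteq> filtH e"
  unfolding filtH_def by (rule vs.span_mono) auto

lemma filtH_into:
  assumes "linon VH f" "vs.subspace U" "\<And>v. v \<in> JH \<Longrightarrow> f v \<in> U"
    "\<And>u. u \<in> lists creators \<Longrightarrow> length u < d \<Longrightarrow> f (dlt u) \<in> U" "v \<in> filtH d"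
  shows "f v \<in> U"
  by (rule linon_into_span[OF assms(1) subspace_fsv filtH_gen assms(2) _ assms(5)[unfolded filtH_def]])
    (use assms(3,4) in auto)

lemma lmul_JH: "a \<in> GH n \<Longrightarrow> v \<in> JH \<Longrightarrow> lmul a v \<in> JH"
  by (rule lmul_pideal[OF brk_closed_GH CH_sub])

lemma cre_filtH:
  assumes "a \<in> creators" "v \<in> filtH d"
  shows "lmul a v \<in> filtH (Suc d)"
proof (rule filtH_into[OF linon_lmul subspace_filtH _ _ assms(2)])
  have a: "a \<in> GH n" using assms(1) by (auto simp: creators_def)
  show "lmul a v \<in> filtH (Suc d)" if "v \<in> JH" for v
    by (rule JH_filtH[OF lmul_JH[OF a that]])
  show "lmul a (dlt u) \<in> filtH (Suc d)" if "u \<in> lists creators" "length u < d" for u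
    using that assms(1) by (auto intro!: dlt_filtH)
qed

text \<open>Moving an annihilator past a creator leaves at most a scalar contraction, which costs
  one letter; at the end it dies on the vacuum.\<close>

lemma ann_word:
  assumes "u \<in> lists creators" "k \<le> n"
  shows "lmul (P k) (dlt u) \<in> filtH (length u)"
  using assms(1)
proof induction
  case Nil
  show ?case by (rule JH_filtH[OF vac_P[OF assms(2)]])
next
  case (Cons a u)
  obtain j where j: "a = P j" "j \<le> 2*n+1" using Cons.hyps(1) by (auto simp: creators_def)
  have u: "dlt u \<in> VH" using creators_GH[OF Cons.hyps(2)] by simp
  let ?c = "if k + j = 2*n+1 then gm n k * zdot else 0"
  have "lmul (P k) (lmul (P j) (dlt u)) - lmul (P j) (lmul (P k) (dlt u)) - vsc ?c (dlt u) \<in> JH"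
    using hH.comm[OF _ j(2) u, of k] assms(2) by simp
  then have 1: "lmul (P k) (dlt (a # u)) - lmul a (lmul (P k) (dlt u)) - vsc ?c (dlt u) \<in> filtH (length (a # u))"
    using j by (simp add: JH_filtH)
  have 2: "lmul a (lmul (P k) (dlt u)) \<in> filtH (length (a # u))"
    using cre_filtH[OF Cons.hyps(1) Cons.IH] by simp
  have 3: "vsc ?c (dlt u) \<in> filtH (length (a # u))"
    by (intro vs.subspace_scale[OF subspace_filtH] dlt_filtH Cons.hyps(2)) simp
  show ?case using vs.subspace_add[OF subspace_filtH vs.subspace_add[OF subspace_filtH 1 2] 3] by simp
qed

lemma ann_filtH:
  assumes "k \<le> n" "v \<in> filtH (Suc d)"
  shows "lmul (P k) v \<in> filtH d"
proof (rule filtH_into[OF linon_lmul subspace_filtH _ _ assms(2)])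
  show "lmul (P k) v \<in> filtH d" if "v \<in> JH" for v
    using that assms(1) by (intro JH_filtH lmul_JH) simp_all
  show "lmul (P k) (dlt u) \<in> filtH d" if "u \<in> lists creators" "length u < Suc d" for u
    using ann_word[OF that(1) assms(1)] filtH_mono[of "length u" d] that(2) by auto
qed

text \<open>For k <= n the letter \<open>p_k\<close> is \<open>gm n k * zdot\<close> times the
  derivative in the variable that \<open>p_{2l-k}\<close> multiplies by, so this is the sum of the
  operators x d/dx.\<close>

definition euler :: "gen list vec \<Rightarrow> gen list vec" where
  "euler = quad (\<lambda>k. lmul (P k)) {0..n} (\<lambda>k. 1 / (gm n k * zdot)) (\<lambda>k. 2*n+1-k) (\<lambda>k. k)"

lemma euler_word:
  assumes "u \<in> lists creators"
  shows "euler (dlt u) - vsc (of_nat (length u)) (dlt u) \<in> JH"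
  using assms
proof induction
  case Nil
  have "euler (dlt []) \<in> JH" unfolding euler_def quad_def
    by (intro hH.J_sum hH.J_closed(3) lmul_JH vac_P) auto
  then show ?case by simp
next
  case (Cons a u)
  obtain j where j: "a = P j" "n + 1 \<le> j" "j \<le> 2*n+1" using Cons.hyps(1) by (auto simp: creators_def)
  have u: "dlt u \<in> VH" using creators_GH[OF Cons.hyps(2)] by simp
  let ?A = "\<Sum>k\<in>{0..n}. vsc (1 / (gm n k * zdot) * hH.om k j) (lmul (P (2*n+1-k)) (dlt u))"
  let ?B = "\<Sum>k\<in>{0..n}. vsc (1 / (gm n k * zdot) * hH.om (2*n+1-k) j) (lmul (P k) (dlt u))"
  have "euler (lmul (P j) (dlt u)) - lmul (P j) (euler (dlt u)) - (?A + ?B) \<in> JH"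
    unfolding euler_def by (rule hH.quad_ad_p) (use j u in auto)
  \<comment> \<open>Creators commute with one another, so only contractions with the annihilating
    factor remain, and among them one term.\<close>
  moreover have "?B = 0" using j by (auto simp: hH.om_def intro!: sum.neutral)
  moreover have "?A = dlt (a # u)"
    using j gm_nz[of n "2*n+1-j"] zdot by (subst sum_single[of _ "2*n+1-j"]) (auto simp: hH.om_def)
  ultimately have 1: "euler (dlt (a # u)) - lmul a (euler (dlt u)) - dlt (a # u) \<in> JH" using j by simp
  have "lmul a (euler (dlt u) - vsc (of_nat (length u)) (dlt u)) \<in> JH"
    using lmul_JH[OF _ Cons.IH, of a] j by simp
  then have 2: "lmul a (euler (dlt u)) - vsc (of_nat (length u)) (dlt (a # u)) \<in> JH"
    by (simp add: linon_diff[OF linon_lmul vs.subspace_UNIV] linon_scale[OF linon_lmul, where V = UNIV])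
  show ?case using hH.J_closed(1)[OF 1 2] by (simp add: vs.scale_left_distrib algebra_simps)
qed

text \<open>Normal ordering: reading a word from the right, \<open>Z\<close> becomes a scalar, a
  creator raises the level by one, and an annihilator does not raise it.\<close>

lemma word_filtH: "u \<in> lists (GH n) \<Longrightarrow> \<exists>d. dlt u \<in> filtH d"
proof (induction u rule: lists.induct)
  case Nil
  show ?case using dlt_filtH[of "[]" 1] by auto
next
  case (Cons a u)
  then obtain d where d: "dlt u \<in> filtH d" by blast
  have uV: "dlt u \<in> VH" using Cons.hyps by simp
  consider "a = Z" | "a \<in> creators" | k where "a = P k" "k \<le> n"
    using Cons.hyps(1) by (force simp: GH_def creators_def)
  then show ?case
  proof cases
    case 1
    have "lmul Z (dlt u) - vsc zdot (dlt u) \<in> filtH d" by (rule JH_filtH[OF Z_H[OF uV]])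
    moreover have "vsc zdot (dlt u) \<in> filtH d" using d by (rule vs.subspace_scale[OF subspace_filtH])
    ultimately have "lmul Z (dlt u) - vsc zdot (dlt u) + vsc zdot (dlt u) \<in> filtH d"
      by (rule vs.subspace_add[OF subspace_filtH])
    then show ?thesis using 1 by auto
  next
    case 2
    then show ?thesis using cre_filtH[OF 2 d] by auto
  next
    case 3
    have "dlt u \<in> filtH (Suc d)" using d filtH_mono[of d "Suc d"] by auto
    then show ?thesis using ann_filtH[OF 3(2), of "dlt u" d] 3 by auto
  qed
qed

definition filtT :: "nat \<Rightarrow> (gen list \<times> gen list) vec set" where
  "filtT d = vs.span (TJ JS \<union> {tp (dlt u) w | u w. u \<in> lists creators \<and> length u < d \<and> w \<in> VS})"

lemma subspace_filtT [simp]: "vs.subspace (filtT d)"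
  by (simp add: filtT_def)

lemma TJ_filtT: "x \<in> TJ JS \<Longrightarrow> x \<in> filtT d"
  unfolding filtT_def by (blast intro: vs.span_base)

lemma tp_filtT: "u \<in> lists creators \<Longrightarrow> length u < d \<Longrightarrow> w \<in> VS \<Longrightarrow> tp (dlt u) w \<in> filtT d"
  unfolding filtT_def by (blast intro: vs.span_base)

lemma TJ_VT: "submS K \<Longrightarrow> TJ K \<subseteq> VT"
  by (rule tjdl_sub[OF repD(3)[OF repH] submS_D(3)])

lemma filtT_gen: "TJ JS \<union> {tp (dlt u) w | u w. u \<in> lists creators \<and> length u < d \<and> w \<in> VS} \<subseteq> VT"
proof (intro Un_least subsetI)
  show "x \<in> VT" if "x \<in> TJ JS" for x using that TJ_VT[OF submS_JS] by blast
  show "x \<in> VT" if x: "x \<in> {tp (dlt u) w | u w. u \<in> lists creators \<and> length u < d \<and> w \<in> VS}" for x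
  proof -
    obtain u w where uw: "x = tp (dlt u) w" "u \<in> lists creators" "w \<in> VS" using x by blast
    have "dlt u \<in> VH" using creators_GH[OF uw(2)] by simp
    then show ?thesis unfolding uw(1) using uw(3) by (rule tp_fsv)
  qed
qed

lemma filtT_mono: "d \<le> e \<Longrightarrow> filtT d \<subseteq> filtT e"
proof -
  assume "d \<le> e"
  then have "length u < d \<Longrightarrow> length u < e" for u :: "gen list" by simp
  then show ?thesis unfolding filtT_def by (intro vs.span_mono Un_mono subset_refl) blast
qed

lemma filtT_into:
  assumes "linon VT f" "vs.subspace U" "\<And>x. x \<in> TJ JS \<Longrightarrow> f x \<in> U"
    "\<And>u w. u \<in> lists creators \<Longrightarrow> length u < d \<Longrightarrow> w \<in> VS \<Longrightarrow> f (tp (dlt u) w) \<in> U" "x \<in> filtT d"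
  shows "f x \<in> U"
  by (rule linon_into_span[OF assms(1) subspace_fsv filtT_gen assms(2) _ assms(5)[unfolded filtT_def]])
    (use assms(3,4) in auto)

lemma filtH_filtT:
  assumes "v \<in> filtH d" "w \<in> VS"
  shows "tp v w \<in> filtT d"
  by (rule filtH_into[OF linon_tp1 subspace_filtT _ _ assms(1)])
    (rule TJ_filtT[OF tjdl_1[OF _ assms(2)]] tp_filtT[OF _ _ assms(2)]; assumption)+

lemma opr_\<rho>: "submS K \<Longrightarrow> a \<in> Gl n \<Longrightarrow> opr VT (TJ K) (\<rho> a)"
  using repD(4)[OF repT] by blast

lemma ann_filtT:
  assumes "k \<le> n" "x \<in> filtT (Suc d)"
  shows "\<rho> (P k) x \<in> filtT d"
proof (rule filtT_into[OF linon_tact subspace_filtT _ _ assms(2)])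
  show "\<rho> (P k) x \<in> filtT d" if "x \<in> TJ JS" for x
    using assms(1) by (intro TJ_filtT opr_J[OF opr_\<rho>[OF submS_JS] that]) simp
  fix u w assume u: "u \<in> lists creators" "length u < Suc d" and w: "w \<in> VS"
  have "lmul (P k) (dlt u) \<in> filtH d"
    by (rule ann_filtH[OF assms(1) dlt_filtH[OF u]])
  then show "\<rho> (P k) (tp (dlt u) w) \<in> filtT d"
    using assms(1) creators_GH[OF u(1)] w by (subst \<rho>_GH) (auto intro: filtH_filtT)
qed

definition eulerT :: "(gen list \<times> gen list) vec \<Rightarrow> (gen list \<times> gen list) vec" where
  "eulerT x = (\<Sum>k\<in>{0..n}. vsc (1 / (gm n k * zdot)) (\<rho> (P (2*n+1-k)) (\<rho> (P k) x)))"

lemma linon_eulerT: "linon VT eulerT"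
proof -
  have "linon VT (\<lambda>x. \<rho> (P (2*n+1-k)) (\<rho> (P k) x))" if "k \<in> {0..n}" for k
    by (rule linon_comp[OF linon_tact linon_tact[of "lists (GH n) \<times> lists GS"]])
      (use opr_\<rho>[OF submS_JS, of "P k"] that in \<open>auto simp: opr_def\<close>)
  then show ?thesis unfolding eulerT_def by (intro linon_setsum linon_vsc)
qed

lemma eulerT_tp:
  assumes "v \<in> VH" "w \<in> VS"
  shows "eulerT (tp v w) = tp (euler v) w"
proof -
  have "tp (euler v) w = (\<Sum>k\<in>{0..n}. tp (vsc (1 / (gm n k * zdot)) (lmul (P (2*n+1-k)) (lmul (P k) v))) w)"
    unfolding euler_def quad_def by (rule linon_sum[OF linon_tp1 vs.subspace_UNIV]) simp
  also have "\<dots> = eulerT (tp v w)" unfolding eulerT_def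
  proof (rule sum.cong[OF refl])
    fix k assume "k \<in> {0..n}"
    then have k: "P k \<in> GH n" "P (2*n+1-k) \<in> GH n" by auto
    have "lmul (P k) v \<in> VH" by (rule lmul_fsv[OF k(1) assms(1)])
    then show "tp (vsc (1 / (gm n k * zdot)) (lmul (P (2*n+1-k)) (lmul (P k) v))) w
      = vsc (1 / (gm n k * zdot)) (\<rho> (P (2*n+1-k)) (\<rho> (P k) (tp v w)))"
      unfolding \<rho>_GH[OF k(1) assms]
      by (simp only: \<rho>_GH[OF k(2) _ assms(2)] linon_scale[OF linon_tp1, where V = UNIV] UNIV_I)
  qed
  finally show ?thesis ..
qed

lemma eulerT_stable:
  assumes "vs.subspace U" "\<And>a x. a \<in> GH n \<Longrightarrow> x \<in> U \<Longrightarrow> \<rho> a x \<in> U" "x \<in> U"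
  shows "eulerT x \<in> U"
  unfolding eulerT_def using assms(2,3)
  by (intro vs.subspace_sum[OF assms(1)] vs.subspace_scale[OF assms(1)]) simp

text \<open>\<open>filtT (Suc d)\<close> adds to \<open>filtT d\<close> the words of length exactly
  \<open>d\<close>, on which the Euler operator is the scalar \<open>d\<close>; shorter words remain
  in \<open>filtT d\<close> whatever multiple is subtracted.\<close>

lemma eulerT_filtT:
  assumes "x \<in> filtT (Suc d)"
  shows "eulerT x - vsc (of_nat d) x \<in> filtT d"
proof (rule filtT_into[OF _ subspace_filtT _ _ assms])
  show "linon VT (\<lambda>x. eulerT x - vsc (of_nat d) x)"
    by (intro linon_minus linon_eulerT linon_vsc linon_id)
  show "eulerT x - vsc (of_nat d) x \<in> filtT d" if "x \<in> TJ JS" for x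
    using that opr_J[OF opr_\<rho>[OF submS_JS GH_Gl]]
    by (intro TJ_filtT vs.subspace_diff[OF subspace_tjdl] vs.subspace_scale[OF subspace_tjdl]
        eulerT_stable[OF subspace_tjdl])
  fix u w assume u: "u \<in> lists creators" "length u < Suc d" and w: "w \<in> VS"
  have uV: "dlt u \<in> VH" using creators_GH[OF u(1)] by simp
  have eq: "eulerT (tp (dlt u) w) - vsc (of_nat d) (tp (dlt u) w)
    = tp (euler (dlt u) - vsc (of_nat (length u)) (dlt u)) w + vsc (of_nat (length u) - of_nat d) (tp (dlt u) w)"
    unfolding eulerT_tp[OF uV w] by (auto simp: tp_def fun_eq_iff vec_simps algebra_simps)
  have "vsc (of_nat (length u) - of_nat d) (tp (dlt u) w) \<in> filtT d"
  proof (cases "length u = d")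
    case True
    then show ?thesis by (simp add: vs.subspace_0)
  next
    case False
    then show ?thesis using u w by (intro vs.subspace_scale[OF subspace_filtT] tp_filtT) auto
  qed
  then show "eulerT (tp (dlt u) w) - vsc (of_nat d) (tp (dlt u) w) \<in> filtT d"
    unfolding eq using TJ_filtT[OF tjdl_1[OF euler_word[OF u(1)] w]] by (intro vs.subspace_add[OF subspace_filtT])
qed

lemma VT_filtT:
  assumes "x \<in> VT"
  shows "\<exists>d. x \<in> filtT d"
proof -
  have "vs.subspace {x. \<exists>d. x \<in> filtT d}"
  proof (rule vs.subspaceI)
    show "0 \<in> {x. \<exists>d. x \<in> filtT d}" using vs.subspace_0[OF subspace_filtT] by blast
  next
    fix x y assume "x \<in> {x. \<exists>d. x \<in> filtT d}" "y \<in> {x. \<exists>d. x \<in> filtT d}"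
    then obtain d e where "x \<in> filtT d" "y \<in> filtT e" by blast
    then have "x \<in> filtT (max d e)" "y \<in> filtT (max d e)"
      using filtT_mono[of d "max d e"] filtT_mono[of e "max d e"] by auto
    then have "x + y \<in> filtT (max d e)" by (rule vs.subspace_add[OF subspace_filtT])
    then show "x + y \<in> {x. \<exists>d. x \<in> filtT d}" by blast
  next
    fix c x assume "x \<in> {x. \<exists>d. x \<in> filtT d}"
    then obtain d where "x \<in> filtT d" by blast
    then have "vsc c x \<in> filtT d" by (rule vs.subspace_scale[OF subspace_filtT])
    then show "vsc c x \<in> {x. \<exists>d. x \<in> filtT d}" by blast
  qed
  then have "x \<in> {x. \<exists>d. x \<in> filtT d}"
  proof (rule tp_into[OF linon_id _ _ assms])
    fix u s assume "u \<in> lists (GH n)" "s \<in> lists GS"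
    then obtain d where "dlt u \<in> filtH d" using word_filtH by blast
    then have "tp (dlt u) (dlt s) \<in> filtT d" using \<open>s \<in> lists GS\<close> by (intro filtH_filtT) simp_all
    then show "tp (dlt u) (dlt s) \<in> {x. \<exists>d. x \<in> filtT d}" by blast
  qed
  then show ?thesis by blast
qed

text \<open>The part of \<open>W\<close> over the vacuum: the only candidate for \<open>K\<close> if
  \<open>W\<close> is to have the form M_H (x) K.\<close>

definition fibre :: "(gen list \<times> gen list) vec set \<Rightarrow> gen list vec set" where
  "fibre W = {w \<in> VS. tp (dlt []) w \<in> W}"

definition submT :: "(gen list \<times> gen list) vec set \<Rightarrow> bool" where
  "submT W \<longleftrightarrow> vs.subspace W \<and> TJ JS \<subseteq> W \<and> W \<subseteq> VT \<and> (\<forall>a\<in>Gl n. \<forall>x\<in>W. \<rho> a x \<in> W)"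

lemma submT_D:
  assumes "submT W"
  shows "vs.subspace W" "TJ JS \<subseteq> W" "W \<subseteq> VT" "\<And>a x. a \<in> Gl n \<Longrightarrow> x \<in> W \<Longrightarrow> \<rho> a x \<in> W"
  using assms by (auto simp: submT_def)

lemma fibre_tp:
  assumes W: "submT W" and v: "v \<in> VH" and w: "w \<in> fibre W"
  shows "tp v w \<in> W"
proof (rule linon_into_fsv[OF linon_tp1 submT_D(1)[OF W] _ v])
  have wV: "w \<in> VS" using w by (simp add: fibre_def)
  fix u assume "u \<in> lists (GH n)"
  then show "tp (dlt u) w \<in> W"
  proof induction
    case Nil
    then show ?case using w by (simp add: fibre_def)
  next
    case (Cons a u)
    have "\<rho> a (tp (dlt u) w) \<in> W" by (rule submT_D(4)[OF W GH_Gl[OF Cons.hyps(1)] Cons.IH])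
    moreover have "\<rho> a (tp (dlt u) w) = tp (dlt (a # u)) w"
      using \<rho>_GH[OF Cons.hyps(1) _ wV, of "dlt u"] Cons.hyps(2) by simp
    ultimately show ?case by simp
  qed
qed

text \<open>sl2 does not act on the second factor alone, but the extra term
  \<open>tp (\<Phi> a (dlt [])) w\<close> lies in \<open>W\<close> by \<open>fibre_tp\<close> and
  can be subtracted.\<close>

lemma submS_fibre:
  assumes W: "submT W"
  shows "submS (fibre W)"
  unfolding submS_def
proof (intro conjI ballI subsetI)
  show "w \<in> fibre W" if "w \<in> JS" for w
    using that repD(3)[OF repS] submT_D(2)[OF W] tjdl_2[OF _ that, of "dlt []" VH JH VS]
    by (auto simp: fibre_def)
  show "w \<in> VS" if "w \<in> fibre W" for w using that by (simp add: fibre_def)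
  show "vs.subspace (fibre W)"
    using submT_D(1)[OF W] unfolding fibre_def
    by (intro vs.subspaceI)
      (auto simp: linon_add[OF linon_tp2, where V = UNIV] linon_scale[OF linon_tp2, where V = UNIV]
        linon_zero[OF linon_tp2 vs.subspace_UNIV] vs.subspace_0
        intro: vs.subspace_add vs.subspace_scale)
  fix a w assume a: "a \<in> GS" and w: "w \<in> fibre W"
  have wV: "w \<in> VS" using w by (simp add: fibre_def)
  have "\<rho> a (tp (dlt []) w) \<in> W" using w GS_Gl[OF a] by (intro submT_D(4)[OF W]) (simp_all add: fibre_def)
  moreover have "tp (\<Phi> a (dlt [])) w \<in> W"
    using w by (intro fibre_tp[OF W] opr_V[OF hH.opr_Phi]) simp_all
  ultimately have "\<rho> a (tp (dlt []) w) - tp (\<Phi> a (dlt [])) w \<in> W"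
    by (rule vs.subspace_diff[OF submT_D(1)[OF W]])
  then show "lmul a w \<in> fibre W"
    using \<rho>_GS[OF a _ wV, of "dlt []"] lmul_VS[OF a wV] by (simp add: fibre_def)
qed

text \<open>Let x in \<open>W\<close> have degree at most d > 0. Annihilators lower the degree, so
  the induction hypothesis covers each \<open>\<rho> (P k) x\<close> and with them
  \<open>eulerT x\<close>. It also covers \<open>eulerT x\<close> minus d times x, which lies one
  level lower. Hence d x is in \<open>TJ (fibre W)\<close>, and so is x.\<close>

lemma submT_filtT:
  assumes W: "submT W" and "x \<in> W" "x \<in> filtT d"
  shows "x \<in> TJ (fibre W)"
proof -
  note K = submS_fibre[OF W]
  have JK: "TJ JS \<subseteq> TJ (fibre W)" by (rule tjdl_mono[OF submS_D(2)[OF K]])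
  have \<rho>K: "\<rho> a x \<in> TJ (fibre W)" if "a \<in> GH n" "x \<in> TJ (fibre W)" for a x
    by (rule opr_J[OF opr_\<rho>[OF K GH_Gl[OF that(1)]] that(2)])
  show ?thesis using assms(2,3)
  proof (induction d arbitrary: x)
    case 0
    have "filtT 0 = TJ JS" unfolding filtT_def by (simp add: vs.span_eq_iff)
    then show ?case using 0 JK by blast
  next
    case (Suc d)
    show ?case
    proof (cases d)
      \<comment> \<open>In degree 0 the Euler eigenvalue is zero and division is impossible. Here x
        is, modulo \<open>TJ JS\<close>, of the form 1 (x) w, and w is in the fibre by
        definition.\<close>
      case 0
      let ?U = "{y + tp (dlt []) w | y w. y \<in> TJ JS \<and> w \<in> VS}"
      have "x \<in> ?U"
      proof (rule filtT_into[OF linon_id])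
        show "vs.subspace ?U"
        proof (rule vs.subspaceI)
          show "0 \<in> ?U"
            using vs.subspace_0[OF subspace_tjdl] vs.subspace_0[OF subspace_fsv]
              linon_zero[OF linon_tp2 vs.subspace_UNIV, of "dlt []"]
            by (auto intro!: exI[of _ 0])
        next
          fix a b assume "a \<in> ?U" "b \<in> ?U"
          then obtain y w y' w' where *: "a = y + tp (dlt []) w" "b = y' + tp (dlt []) w'"
            "y \<in> TJ JS" "w \<in> VS" "y' \<in> TJ JS" "w' \<in> VS" by auto
          have "a + b = (y + y') + tp (dlt []) (w + w')"
            unfolding * by (simp add: linon_add[OF linon_tp2, where V = UNIV])
          then show "a + b \<in> ?U"
            using vs.subspace_add[OF subspace_tjdl *(3,5)] vs.subspace_add[OF subspace_fsv *(4,6)] by blast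
        next
          fix c a assume "a \<in> ?U"
          then obtain y w where *: "a = y + tp (dlt []) w" "y \<in> TJ JS" "w \<in> VS" by auto
          have "vsc c a = vsc c y + tp (dlt []) (vsc c w)"
            unfolding * by (simp add: linon_scale[OF linon_tp2, where V = UNIV] vs.scale_right_distrib)
          then show "vsc c a \<in> ?U"
            using vs.subspace_scale[OF subspace_tjdl *(2)] vs.subspace_scale[OF subspace_fsv *(3)] by blast
        qed
        show "x \<in> ?U" if "x \<in> TJ JS" for x
        proof -
          have "x = x + tp (dlt []) 0" using linon_zero[OF linon_tp2 vs.subspace_UNIV] by simp
          then show ?thesis using that vs.subspace_0[OF subspace_fsv] by blast
        qed
        show "tp (dlt u) w \<in> ?U" if "u \<in> lists creators" "length u < Suc 0" "w \<in> VS" for u w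
        proof -
          have "tp (dlt u) w = 0 + tp (dlt []) w" using that(2) by simp
          then show ?thesis using that(3) vs.subspace_0[OF subspace_tjdl] by blast
        qed
        show "x \<in> filtT (Suc 0)" using Suc.prems(2) 0 by simp
      qed
      then obtain y w where y: "x = y + tp (dlt []) w" "y \<in> TJ JS" "w \<in> VS" by auto
      have "x - y \<in> W" using y(2) submT_D(2)[OF W] by (intro vs.subspace_diff[OF submT_D(1)[OF W] Suc.prems(1)]) auto
      then have "w \<in> fibre W" using y by (simp add: fibre_def)
      then have "tp (dlt []) w \<in> TJ (fibre W)" by (intro tjdl_2) simp_all
      then show ?thesis unfolding y(1) using y(2) JK by (intro vs.subspace_add[OF subspace_tjdl]) auto
    next
      case d: (Suc e)
      have Px: "\<rho> (P k) x \<in> TJ (fibre W)" if "k \<in> {0..n}" for k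
        using that by (intro Suc.IH submT_D(4)[OF W] Suc.prems ann_filtT) simp_all
      have 1: "eulerT x \<in> TJ (fibre W)" unfolding eulerT_def
        by (intro vs.subspace_sum[OF subspace_tjdl] vs.subspace_scale[OF subspace_tjdl] \<rho>K Px) simp_all
      have "eulerT x \<in> W"
        by (rule eulerT_stable[OF submT_D(1)[OF W] submT_D(4)[OF W GH_Gl] Suc.prems(1)])
      then have 2: "eulerT x - vsc (of_nat d) x \<in> TJ (fibre W)"
        by (intro Suc.IH eulerT_filtT Suc.prems vs.subspace_diff vs.subspace_scale submT_D(1)[OF W])
      have "vsc (of_nat d) x \<in> TJ (fibre W)" using vs.subspace_diff[OF subspace_tjdl 1 2] by simp
      then have "vsc (1 / of_nat d) (vsc (of_nat d) x) \<in> TJ (fibre W)"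
        by (rule vs.subspace_scale[OF subspace_tjdl])
      then show ?thesis using d by (simp del: of_nat_Suc)
    qed
  qed
qed

lemma submT_eq:
  assumes W: "submT W"
  shows "W = TJ (fibre W)"
proof
  show "W \<subseteq> TJ (fibre W)"
    using VT_filtT submT_D(3)[OF W] submT_filtT[OF W] by blast
  show "TJ (fibre W) \<subseteq> W"
  proof
    fix x assume "x \<in> TJ (fibre W)"
    then show "x \<in> W"
    proof (rule tjdl_into[OF repD(3)[OF repH] submS_D(3)[OF submS_fibre[OF W]] linon_id submT_D(1)[OF W], rotated 2])
      show "tp v w \<in> W" if "v \<in> JH" "w \<in> VS" for v w
        using tjdl_1[OF that] submT_D(2)[OF W] by blast
      show "tp v w \<in> W" if "v \<in> VH" "w \<in> fibre W" for v w
        by (rule fibre_tp[OF W that])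
    qed
  qed
qed

section \<open>Transfer to the Verma module of the full algebra\<close>

definition submG :: "gen list vec set \<Rightarrow> bool" where
  "submG W \<longleftrightarrow> JG \<subseteq> W \<and> W \<subseteq> VG \<and> vs.subspace W \<and> (\<forall>a\<in>Gl n. \<forall>v\<in>W. lmul a v \<in> W)"

text \<open>Pulling \<open>W\<close> back along \<open>S\<close> gives a submodule of the tensor
  product, and its fibre is \<open>K\<close>. As \<open>S (T v)\<close> and \<open>v\<close> differ
  by an element of \<open>JG\<close>, pulling back again along \<open>T\<close> recovers
  \<open>W\<close>.\<close>

lemma submG_fibre:
  assumes W: "submG W"
  obtains K where "submS K" "\<And>v. v \<in> VG \<Longrightarrow> T v \<in> TJ K \<longleftrightarrow> v \<in> W"
proof -
  have JW: "JG \<subseteq> W" and WV: "W \<subseteq> VG" and sub: "vs.subspace W" and st: "\<And>a v. a \<in> Gl n \<Longrightarrow> v \<in> W \<Longrightarrow> lmul a v \<in> W"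
    using W by (auto simp: submG_def)
  let ?W = "{x \<in> VT. S x \<in> W}"
  have T: "submT ?W"
    unfolding submT_def
  proof (intro conjI ballI subsetI)
    show "vs.subspace ?W"
      by (intro vs.subspaceI)
        (auto simp: linon_add[OF linon_S[of "lists (GH n) \<times> lists GS"]] linon_scale[OF linon_S[of "lists (GH n) \<times> lists GS"]]
          linon_zero[OF linon_S subspace_fsv[of "lists (GH n) \<times> lists GS"]] vs.subspace_0[OF sub] vs.subspace_0[OF subspace_fsv]
          intro: vs.subspace_add[OF sub] vs.subspace_scale[OF sub] vs.subspace_add[OF subspace_fsv] vs.subspace_scale[OF subspace_fsv])
    show "x \<in> ?W" if "x \<in> TJ JS" for x
      using S_TJ[OF that] TJ_VT[OF submS_JS] that JW by auto
    show "x \<in> VT" if "x \<in> ?W" for x using that by simp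
    show "\<rho> a x \<in> ?W" if a: "a \<in> Gl n" and x: "x \<in> ?W" for a x
    proof -
      have xV: "x \<in> VT" "S x \<in> W" using x by auto
      have "S (\<rho> a x) - lmul a (S x) \<in> W" using S_\<rho>[OF a xV(1)] JW by blast
      then have "S (\<rho> a x) - lmul a (S x) + lmul a (S x) \<in> W"
        by (rule vs.subspace_add[OF sub _ st[OF a xV(2)]])
      then show ?thesis using opr_V[OF opr_\<rho>[OF submS_JS a] xV(1)] by simp
    qed
  qed
  have "T v \<in> TJ (fibre ?W) \<longleftrightarrow> v \<in> W" if v: "v \<in> VG" for v
  proof -
    have *: "S (T v) - v \<in> W" using ST[OF v] JW by blast
    have "T v \<in> TJ (fibre ?W) \<longleftrightarrow> T v \<in> ?W" using submT_eq[OF T] by simp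
    also have "\<dots> \<longleftrightarrow> S (T v) \<in> W" using v by simp
    also have "\<dots> \<longleftrightarrow> v \<in> W"
      using vs.subspace_diff[OF sub _ *, of "S (T v)"] vs.subspace_add[OF sub *, of v] by auto
    finally show ?thesis .
  qed
  then show ?thesis using that submS_fibre[OF T] by blast
qed

lemma submG_pull:
  assumes K: "submS K"
  shows "submG {v \<in> VG. T v \<in> TJ K}"
  unfolding submG_def
proof (intro conjI ballI subsetI)
  show "v \<in> {v \<in> VG. T v \<in> TJ K}" if "v \<in> JG" for v
    using T_JG[OF that] tjdl_mono[OF submS_D(2)[OF K]] repD(3)[OF repG] that by blast
  show "vs.subspace {v \<in> VG. T v \<in> TJ K}"
    by (intro vs.subspaceI)
      (auto simp: linon_add[OF linon_T] linon_scale[OF linon_T] linon_zero[OF linon_T]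
        vs.subspace_0[OF subspace_fsv] vs.subspace_0[OF subspace_tjdl]
        intro: vs.subspace_add[OF subspace_tjdl] vs.subspace_scale[OF subspace_tjdl]
          vs.subspace_add[OF subspace_fsv] vs.subspace_scale[OF subspace_fsv])
  show "lmul a v \<in> {v \<in> VG. T v \<in> TJ K}" if "a \<in> Gl n" "v \<in> {v \<in> VG. T v \<in> TJ K}" for a v
    using that opr_J[OF opr_\<rho>[OF K]] lmul_VG T_lmul by auto
qed auto

lemma submod_Mg: "submod (Gl n) (lists (Gl n), JG, lmul) W \<longleftrightarrow> submG W"
  by (auto simp: submod_def submG_def jdl_def bas_def act_def cspan_eq_self_iff)

lemma submod_Msl2: "submod GS (lists GS, JS, gS) N \<longleftrightarrow> submS N"
  by (auto simp: submod_def submS_def jdl_def bas_def act_def cspan_eq_self_iff gS_def)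

section \<open>Maximal submodules and simple quotients\<close>

definition maxS :: "gen list vec set" where
  "maxS = vs.span (JS \<union> \<Union>{N. submS N \<and> N \<noteq> VS})"

lemma proper_maxS: "submS N \<Longrightarrow> N \<noteq> VS \<Longrightarrow> N \<subseteq> maxS"
  unfolding maxS_def by (blast intro: vs.span_base)

lemma maxS_gen: "JS \<union> \<Union>{N. submS N \<and> N \<noteq> VS} \<subseteq> VS"
  using submS_D(3) submS_JS by blast

lemma maxS_into:
  assumes "linon VS f" "vs.subspace U" "\<And>w. w \<in> JS \<Longrightarrow> f w \<in> U"
    "\<And>N w. submS N \<Longrightarrow> N \<noteq> VS \<Longrightarrow> w \<in> N \<Longrightarrow> f w \<in> U" "w \<in> maxS"
  shows "f w \<in> U"
  by (rule linon_into_span[OF assms(1) subspace_fsv maxS_gen assms(2) _ assms(5)[unfolded maxS_def]])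
    (use assms(3,4) in blast)

lemma submS_maxS: "submS maxS"
  unfolding submS_def
proof (intro conjI ballI)
  show "JS \<subseteq> maxS" unfolding maxS_def by (blast intro: vs.span_base)
  show "maxS \<subseteq> VS" unfolding maxS_def by (rule vs.span_minimal[OF maxS_gen subspace_fsv])
  show sub: "vs.subspace maxS" by (simp add: maxS_def)
  fix a w assume a: "a \<in> GS" and w: "w \<in> maxS"
  show "lmul a w \<in> maxS"
  proof (rule maxS_into[OF linon_lmul sub _ _ w])
    show "lmul a w \<in> maxS" if "w \<in> JS" for w
      using submS_stable[OF submS_JS a that] \<open>JS \<subseteq> maxS\<close> by blast
    show "lmul a w \<in> maxS" if "submS N" "N \<noteq> VS" "w \<in> N" for N w
      using submS_stable[OF that(1) a that(3)] proper_maxS[OF that(1,2)] by blast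
  qed
qed

lemma JS_proper: "JS \<noteq> VS"
proof
  assume "JS = VS"
  then have "psi (dlt []) = 0" by (intro psi_JS) simp
  then have "psi (dlt []) 0 = 0" by (simp add: zero_fun_apply)
  then show False by (simp add: dlt_apply)
qed

text \<open>Coordinate 0 vanishes on every proper submodule by the weight argument, and this
  condition is linear, so it survives the sum of all of them.\<close>

lemma maxS_psi:
  assumes "w \<in> maxS"
  shows "psi w 0 = 0"
proof -
  have "psi w \<in> {g. g 0 = 0}"
    by (rule maxS_into[OF linon_lext _ _ _ assms])
      (use proper_psi proper_psi[OF submS_JS JS_proper] in \<open>auto intro!: vs.subspaceI simp: vec_simps\<close>)
  then show ?thesis by simp
qed

text \<open>The highest weight vector has coordinate 0 equal to 1. From this one non-membership
  follows the properness of all preimages under \<open>T\<close> considered below.\<close>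

lemma vacuum_maxS: "T (dlt []) \<notin> TJ maxS"
proof
  assume "T (dlt []) \<in> TJ maxS"
  then have "tp (dlt []) (dlt []) \<in> TJ maxS" by (simp add: T_def vacuum_def)
  then have "psi (dlt []) 0 = 0" by (intro TJ_psi[OF submS_maxS maxS_psi]) simp_all
  then show False by (simp add: dlt_apply)
qed

lemma TJ_VS: "TJ VS = VT"
proof
  show "VT \<subseteq> TJ VS"
  proof
    fix x assume "x \<in> VT"
    then show "x \<in> TJ VS"
      by (rule tp_into[OF linon_id subspace_tjdl, rotated]) (auto intro: tjdl_2)
  qed
qed (rule tjdl_sub[OF repD(3)[OF repH] subset_refl])

definition maxG :: "gen list vec set" where
  "maxG = vs.span (JG \<union> \<Union>{W. submG W \<and> W \<noteq> VG})"

text \<open>A proper \<open>W\<close> has a proper fibre, because the fibre \<open>VS\<close> would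
  yield the whole tensor product; a proper fibre lies in \<open>maxS\<close>.\<close>

lemma proper_submG:
  assumes "submG W" "W \<noteq> VG" "v \<in> W"
  shows "T v \<in> TJ maxS"
proof -
  obtain K where K: "submS K" "\<And>v. v \<in> VG \<Longrightarrow> T v \<in> TJ K \<longleftrightarrow> v \<in> W"
    using submG_fibre[OF assms(1)] by blast
  have WV: "W \<subseteq> VG" using assms(1) by (simp add: submG_def)
  have "K \<noteq> VS"
  proof
    assume "K = VS"
    then have "W = VG" using K(2) T_V TJ_VS WV by blast
    then show False using assms(2) by simp
  qed
  then show ?thesis using tjdl_mono[OF proper_maxS[OF K(1)]] K(2) assms(3) WV by blast
qed

lemma pull_proper: "submS K \<Longrightarrow> K \<subseteq> maxS \<Longrightarrow> {v \<in> VG. T v \<in> TJ K} \<noteq> VG"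
proof
  assume K: "submS K" "K \<subseteq> maxS" "{v \<in> VG. T v \<in> TJ K} = VG"
  have "dlt [] \<in> VG" by simp
  then have "T (dlt []) \<in> TJ K" using K(3) by blast
  then show False using vacuum_maxS tjdl_mono[OF K(2)] by blast
qed

text \<open>The preimage of \<open>TJ maxS\<close> is proper, so it is among the submodules summed
  in \<open>maxG\<close>; conversely it contains every proper submodule.\<close>

lemma T_maxG:
  assumes "v \<in> VG"
  shows "T v \<in> TJ maxS \<longleftrightarrow> v \<in> maxG"
proof
  let ?W = "{v \<in> VG. T v \<in> TJ maxS}"
  assume "T v \<in> TJ maxS"
  moreover have "?W \<noteq> VG" by (rule pull_proper[OF submS_maxS subset_refl])
  ultimately show "v \<in> maxG"
    unfolding maxG_def using submG_pull[OF submS_maxS] assms by (intro vs.span_base) blast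
next
  assume "v \<in> maxG"
  moreover have "JG \<union> \<Union>{W. submG W \<and> W \<noteq> VG} \<subseteq> {v \<in> VG. T v \<in> TJ maxS}"
    using proper_submG submG_pull[OF submS_maxS] by (auto simp: submG_def)
  ultimately have "v \<in> {v \<in> VG. T v \<in> TJ maxS}"
    unfolding maxG_def using submG_pull[OF submS_maxS] vs.span_minimal by (metis (no_types, lifting) submG_def subsetD)
  then show "T v \<in> TJ maxS" by simp
qed

lemma simple_quot_iso: "pmod_iso (Gl n) (simple_quot (Gl n) (Mg n zdot hdot))
   (tensor (MHg n zdot) (simple_quot GS (Msl2g mu)))"
proof -
  have 1: "simple_quot (Gl n) (Mg n zdot hdot) = (lists (Gl n), maxG, lmul)"
    unfolding Mg_eq simple_quot_def submod_Mg cspan_eq by (simp add: bas_def jdl_def act_def maxG_def)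
  have 2: "simple_quot GS (Msl2g mu) = (lists GS, maxS, gS)"
    unfolding Msl2g_eq simple_quot_def submod_Msl2 cspan_eq by (simp add: bas_def jdl_def act_def maxS_def)
  show ?thesis unfolding 1 2 MHg_eq tensor_eq by (rule iso_T[OF submS_maxS T_maxG])
qed

lemma JG_proper: "JG \<noteq> VG"
proof
  assume "JG = VG"
  then have "T (dlt []) \<in> TJ JS" by (intro T_JG) simp
  then show False using vacuum_maxS tjdl_mono[OF submS_D(2)[OF submS_maxS]] by blast
qed

lemma verma_simple_iff: "simple_mod (Gl n) (Mg n zdot hdot) \<longleftrightarrow> mu \<notin> range of_nat"
proof -
  have simple: "simple_mod (Gl n) (Mg n zdot hdot) \<longleftrightarrow> (\<forall>W. submG W \<longrightarrow> W = JG \<or> W = VG)"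
    unfolding Mg_eq simple_mod_def submod_Mg using JG_proper by (simp add: jdl_def bas_def)
  show ?thesis unfolding simple
  proof
    assume mu: "mu \<notin> range of_nat"
    show "\<forall>W. submG W \<longrightarrow> W = JG \<or> W = VG"
    proof (intro allI impI)
      fix W assume W: "submG W"
      have WV: "W \<subseteq> VG" using W by (simp add: submG_def)
      obtain K where K: "submS K" "\<And>v. v \<in> VG \<Longrightarrow> T v \<in> TJ K \<longleftrightarrow> v \<in> W"
        using submG_fibre[OF W] by blast
      show "W = JG \<or> W = VG"
      proof (cases "K = VS")
        case True
        then show ?thesis using K(2) T_V TJ_VS WV by blast
      next
        case False
        then have "K = JS" by (rule simple_generic[OF K(1) mu])
        then show ?thesis using K(2) T_iff WV repD(3)[OF repG] by blast
      qed
    qed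
  next
    assume simp: "\<forall>W. submG W \<longrightarrow> W = JG \<or> W = VG"
    show "mu \<notin> range of_nat"
    proof
      assume "mu \<in> range of_nat"
      then obtain m where m: "mu = of_nat m" by blast
      let ?K = "{v \<in> VS. \<forall>j\<le>m. psi v j = 0}"
      \<comment> \<open>The singular vector f^(m+1) w: it lies in the proper submodule
        \<open>?K\<close>, while its coordinate m+1 is 1. If the preimage of \<open>TJ ?K\<close>
        were only \<open>JG\<close>, then 1 (x) \<open>?w\<close> would be in \<open>TJ JS\<close>,
        against \<open>TJ_psi\<close>.\<close>
      let ?w = "dlt (replicate (Suc m) F)"
      have K: "submS ?K" by (rule submS_singular[OF m])
      have "dlt [] \<notin> ?K" by (simp add: dlt_apply)
      then have "?K \<noteq> VS" by (metis dlt_in_fsv lists.Nil)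
      then have "{v \<in> VG. T v \<in> TJ ?K} \<noteq> VG" by (intro pull_proper K proper_maxS)
      then have pull: "{v \<in> VG. T v \<in> TJ ?K} = JG" using simp submG_pull[OF K] by blast
      have w: "?w \<in> VS" by auto
      have "?w \<in> ?K" using w psi_F[of "Suc m"] by (simp add: dlt_apply del: replicate_Suc)
      then have wK: "tp (dlt []) ?w \<in> TJ ?K" by (intro tjdl_2) simp_all
      have "tp (dlt []) ?w \<in> VT" using w by (intro tp_fsv) simp_all
      then obtain v where v: "v \<in> VG" "T v - tp (dlt []) ?w \<in> TJ JS" using T_surj by blast
      have "T v - tp (dlt []) ?w \<in> TJ ?K" using v(2) tjdl_mono[OF submS_D(2)[OF K]] by blast
      then have "T v - tp (dlt []) ?w + tp (dlt []) ?w \<in> TJ ?K"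
        using wK by (rule vs.subspace_add[OF subspace_tjdl])
      then have "v \<in> JG" using pull v(1) by auto
      then have "T v \<in> TJ JS" by (rule T_JG)
      then have "T v - (T v - tp (dlt []) ?w) \<in> TJ JS"
        using v(2) by (rule vs.subspace_diff[OF subspace_tjdl])
      then have "tp (dlt []) ?w \<in> TJ JS" by simp
      then have "psi ?w (Suc m) = 0"
        using psi_JS by (intro TJ_psi[OF submS_JS _ w]) (simp_all add: zero_fun_apply)
      then show False unfolding psi_F by (simp add: dlt_apply)
    qed
  qed
qed

end

theorem theorem2:
  fixes n :: nat and zdot hdot :: complex
  assumes "zdot \<noteq> 0"
  shows "pmod_iso (Gl n) (Mg n zdot hdot)
           (tensor (MHg n zdot) (Msl2g (hdot + (of_nat n + 1) ^ 2 / 2)))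
       \<and> pmod_iso (Gl n) (simple_quot (Gl n) (Mg n zdot hdot))
           (tensor (MHg n zdot) (simple_quot GS (Msl2g (hdot + (of_nat n + 1) ^ 2 / 2))))
       \<and> (simple_mod (Gl n) (Mg n zdot hdot) \<longleftrightarrow>
           hdot + (of_nat n + 1) ^ 2 / 2 \<notin> range (of_nat :: nat \<Rightarrow> complex))"
proof -
  interpret setting n zdot hdot by unfold_locales (rule assms)
  show ?thesis using verma_iso simple_quot_iso verma_simple_iff by blast
qed

end
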